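(* Let $A,B$ be finite-dimensional Hilbert spaces, $\rho_{AB}\in \mathrm{S}(A\otimes B)$ and $\sigma_A\in\mathrm{S}(A)$. Then $$D(\rho_A\|\sigma_A)=D^\infty(\rho_{AB}\|\mathcal{C}^{\sigma_A}_{AB}),$$ where $\rho_A=\mathrm{tr}_B[\rho_{AB}]$ and $$D^\infty(\rho_{AB}\|\mathcal{C}^{\sigma_A}_{AB}):=\lim_{n\to\infty}\frac1n D(\rho_{AB}^{\otimes n}\|\mathcal{C}^{\sigma_A}_{AB,n}).$$
   Context: $\mathrm{S}(A)$ is the set of density matrices (positive semidefinite, trace one) on the finite-dimensional Hilbert space $A$. Write $A_1^n=A^{\otimes n}$, $B_1^n=B^{\otimes n}$. For $n\in\mathbb{N}$, $\mathcal{C}^{\sigma_A}_{AB,n}:=\{\sigma'\in\mathrm{S}(A_1^n\otimes B_1^n):\mathrm{tr}_{B_1^n}[\sigma']=\sigma_A^{\otimes n}\}$ is the set of extensions of $\sigma_A^{\otimes n}$, and $\mathcal{C}^{\sigma_A}_{AB}:=\mathcal{C}^{\sigma_A}_{AB,1}$. The relative entropy is $D(\rho\|\sigma):=\mathrm{tr}[\rho(\log\rho-\log\sigma)]$ if $\mathrm{supp}\,\rho\subseteq\mathrm{supp}\,\sigma$, and $+\infty$ otherwise. For a set $\mathcal{S}$ of density matrices, $D(\rho\|\mathcal{S}):=\inf_{\sigma\in\mathcal{S}}D(\rho\|\sigma)$. The limit defining $D^\infty$ exists and equals the infimum over $n\in\mathbb{N}$, by subadditivity (Fekete's lemma). *)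

theory Defs
  imports
    "Jordan_Normal_Form.Schur_Decomposition"
    "Jordan_Normal_Form.Matrix_Kernel"
    "HOL-Library.Extended_Real"
begin

text \<open>
  A finite-dimensional Hilbert space with a fixed orthonormal basis is represented by its
  dimension, and its operators by the complex square matrices of that size. The product basis
  of \<open>C\<^sup>a \<otimes> C\<^sup>b\<close> is ordered lexicographically: the basis vector \<open>e\<^sub>i \<otimes> e\<^sub>j\<close> has index \<open>i * b + j\<close>.
\<close>

definition mat_trace :: "complex mat \<Rightarrow> complex" where
  "mat_trace M = (\<Sum>i<dim_row M. M $$ (i, i))"

definition psd_mat :: "nat \<Rightarrow> complex mat \<Rightarrow> bool" where
  "psd_mat d M \<longleftrightarrow> M \<in> carrier_mat d d \<and> mat_adjoint M = M \<and>
     (\<forall>v \<in> carrier_vec d. 0 \<le> Re ((M *\<^sub>v v) \<bullet>c v))"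

definition density_mats :: "nat \<Rightarrow> complex mat set" where
  "density_mats d = {M. psd_mat d M \<and> mat_trace M = 1}"

definition kron :: "complex mat \<Rightarrow> complex mat \<Rightarrow> complex mat" where
  "kron M N = mat (dim_row M * dim_row N) (dim_col M * dim_col N)
     (\<lambda>(i, j). M $$ (i div dim_row N, j div dim_col N) * N $$ (i mod dim_row N, j mod dim_col N))"

primrec tensor_pow :: "complex mat \<Rightarrow> nat \<Rightarrow> complex mat" where
  "tensor_pow M 0 = 1\<^sub>m 1"
| "tensor_pow M (Suc n) = kron (tensor_pow M n) M"

definition partial_trace_snd :: "nat \<Rightarrow> nat \<Rightarrow> complex mat \<Rightarrow> complex mat" where
  "partial_trace_snd a b M = mat a a (\<lambda>(i, j). \<Sum>k<b. M $$ (i * b + k, j * b + k))"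

text \<open>
  The canonical identification of \<open>A\<^sup>n \<otimes> B\<^sup>n\<close> with \<open>(A \<otimes> B)\<^sup>n\<close> (tensor powers) on basis indices.
  The index \<open>x * b ^ n + y\<close> of \<open>e\<^sub>x \<otimes> e\<^sub>y\<close> is sent to the index whose digits in base \<open>a * b\<close> are
  \<open>x\<^sub>k * b + y\<^sub>k\<close>, where \<open>x\<^sub>k\<close> and \<open>y\<^sub>k\<close> are the digits of \<open>x\<close> in base \<open>a\<close> and of \<open>y\<close> in base \<open>b\<close>.
\<close>

definition regroup_index :: "nat \<Rightarrow> nat \<Rightarrow> nat \<Rightarrow> nat \<Rightarrow> nat" where
  "regroup_index a b n i =
     (\<Sum>k<n. (((i div b ^ n) div a ^ k mod a) * b + (i mod b ^ n) div b ^ k mod b) * (a * b) ^ k)"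

definition regroup :: "nat \<Rightarrow> nat \<Rightarrow> nat \<Rightarrow> complex mat \<Rightarrow> complex mat" where
  "regroup a b n M = mat (a ^ n * b ^ n) (a ^ n * b ^ n)
     (\<lambda>(i, j). M $$ (regroup_index a b n i, regroup_index a b n j))"

text \<open>
  The natural logarithm of a positive semidefinite matrix by functional calculus, taken on its
  support and extended by zero on its kernel. The result does not depend on the chosen
  diagonalisation.
\<close>

definition mat_log :: "complex mat \<Rightarrow> complex mat" where
  "mat_log M = (SOME L. \<exists>U e. let d = dim_row M in
     U \<in> carrier_mat d d \<and> mat_adjoint U * U = 1\<^sub>m d \<and>
     M = U * mat_diag d (\<lambda>i. complex_of_real (e i)) * mat_adjoint U \<and>
     L = U * mat_diag d (\<lambda>i. complex_of_real (if 0 < e i then ln (e i) else 0)) * mat_adjoint U)"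

definition mat_supp :: "complex mat \<Rightarrow> complex vec set" where
  "mat_supp M = {v \<in> carrier_vec (dim_col M). \<forall>w \<in> mat_kernel M. v \<bullet>c w = 0}"

definition rel_entropy :: "complex mat \<Rightarrow> complex mat \<Rightarrow> ereal" where
  "rel_entropy \<rho> \<sigma> =
     (if mat_supp \<rho> \<subseteq> mat_supp \<sigma> then ereal (Re (mat_trace (\<rho> * (mat_log \<rho> - mat_log \<sigma>)))) else \<infinity>)"

definition rel_entropy_set :: "complex mat \<Rightarrow> complex mat set \<Rightarrow> ereal" where
  "rel_entropy_set \<rho> S = (INF \<sigma>\<in>S. rel_entropy \<rho> \<sigma>)"

definition extensions :: "nat \<Rightarrow> nat \<Rightarrow> nat \<Rightarrow> complex mat \<Rightarrow> complex mat set" where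
  "extensions a b n \<sigma> =
     {\<tau> \<in> density_mats (a ^ n * b ^ n). partial_trace_snd (a ^ n) (b ^ n) \<tau> = tensor_pow \<sigma> n}"

text \<open>The term at \<open>n = 0\<close> is irrelevant for the limit.\<close>

definition rel_entropy_seq :: "nat \<Rightarrow> nat \<Rightarrow> complex mat \<Rightarrow> complex mat \<Rightarrow> nat \<Rightarrow> ereal" where
  "rel_entropy_seq a b \<rho> \<sigma> n =
     ereal (1 / real n) * rel_entropy_set (regroup a b n (tensor_pow \<rho> n)) (extensions a b n \<sigma>)"

definition reg_rel_entropy :: "nat \<Rightarrow> nat \<Rightarrow> complex mat \<Rightarrow> complex mat \<Rightarrow> ereal" where
  "reg_rel_entropy a b \<rho> \<sigma> = lim (rel_entropy_seq a b \<rho> \<sigma>)"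

end

(*
  Lower bound: the relative entropy does not increase under the partial trace. Integrating
  1 / (x^(-1) + t) over t expresses D(rho || sigma) through the functions
    Q(t) = sup_X (2 Re tr(X rho) - tr(X X* sigma) - t tr(X* X rho)),
  and restricting the supremum to X = X_A (x) 1 gives the same functions for the marginals.
  The same formula shows that D(rho || sigma) is antitone in sigma.

  Upper bound: for every n there is an extension tau of sigma_A^n with
    D(rho^n || tau) <= n D(rho_A || sigma_A) + O(log n).
  It is obtained from the pinching of rho^n onto blocks of A^n on which both sigma_A^n and the
  pinched rho_A^n are constant up to a factor e. Only O(n^2) blocks are needed, and the pinching
  costs at most the logarithm of their number. In each block the pinched state is rescaled, and
  completed by a product term, so that its marginal becomes sigma_A^n.
*)

theory Submission
  imports Defs "Jordan_Normal_Form.Spectral_Radius"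
begin

section \<open>Spectral decomposition\<close>

text \<open>An obvious candidate for a good extension, \<rho> conjugated by \<sigma>_A^(1/2)
  \<rho>_A^(-1/2), is hard to estimate because \<rho>_A and \<sigma>_A need not commute. After the
  pinching, the correction is a scalar on each block and everything reduces to sums over
  eigenvalues. The loss vanishes after division by n because only integer parts of negative
  logarithms of eigenvalues are kept. The nonzero eigenvalues of \<sigma>_A^n are at least m^n,
  which leaves O(n) integer parts. The pinched \<rho>_A^n has no such lower bound; there the integer
  part is capped at a K of order n ln(dim A), and since there are at most (dim A)^n eigenvalues, the
  capped ones cost at most (dim A)^n exp(-K), which is at most 1. Each rounding costs a constant in
  total and not one per copy, because it is averaged against a state of trace one. If the support of
  \<rho>_A is not contained in that of \<sigma>_A, the same is true of all positive tensor powers,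
  and every term with n at least 1 is infinite.\<close>

lemma mat_adjoint_dim [simp]:
  "dim_row (mat_adjoint A) = dim_col A" "dim_col (mat_adjoint A) = dim_row A"
  by (auto simp: mat_adjoint_def)

lemma mat_adjoint_index [simp]:
  fixes A :: "complex mat"
  assumes "i < dim_col A" "j < dim_row A"
  shows "mat_adjoint A $$ (i, j) = cnj (A $$ (j, i))"
  using assms by (simp add: mat_adjoint_def mat_of_rows_def)

lemma mat_adjoint_carrier [simp]:
  "A \<in> carrier_mat n m \<Longrightarrow> mat_adjoint A \<in> carrier_mat m n"
  by auto

lemma mat_adjoint_adjoint [simp]: "mat_adjoint (mat_adjoint A) = (A :: complex mat)"
  by (rule eq_matI) auto

lemma mult_mat_index:
  assumes "A \<in> carrier_mat n m" "B \<in> carrier_mat m k" "i < n" "j < k"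
  shows "(A * B) $$ (i, j) = (\<Sum>l<m. A $$ (i, l) * B $$ (l, j))"
  using assms by (auto simp: scalar_prod_def lessThan_atLeast0)

lemma mat_adjoint_mult:
  fixes A B :: "complex mat"
  assumes "A \<in> carrier_mat n m" "B \<in> carrier_mat m k"
  shows "mat_adjoint (A * B) = mat_adjoint B * mat_adjoint A"
proof (rule eq_matI)
  fix i j assume "i < dim_row (mat_adjoint B * mat_adjoint A)" "j < dim_col (mat_adjoint B * mat_adjoint A)"
  then have ij: "i < k" "j < n" using assms by auto
  have "mat_adjoint (A * B) $$ (i, j) = cnj ((A * B) $$ (j, i))"
    using assms ij by (subst mat_adjoint_index) auto
  also have "\<dots> = (\<Sum>l<m. cnj (A $$ (j, l)) * cnj (B $$ (l, i)))"
    using assms ij by (subst mult_mat_index[of _ n m _ k]) auto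
  also have "\<dots> = (mat_adjoint B * mat_adjoint A) $$ (i, j)"
    using assms ij by (subst mult_mat_index[of _ k m _ n]) (auto intro!: sum.cong)
  finally show "mat_adjoint (A * B) $$ (i, j) = (mat_adjoint B * mat_adjoint A) $$ (i, j)" .
qed (use assms in auto)

lemma mult_carrier_square [simp]:
  "A \<in> carrier_mat d d \<Longrightarrow> B \<in> carrier_mat d d \<Longrightarrow> A * B \<in> carrier_mat d d"
  by (rule mult_carrier_mat)

lemmas assoc_mult_square = assoc_mult_mat[of _ d d _ d _ d] for d

lemma mat_trace_mult:
  assumes "A \<in> carrier_mat n m" "B \<in> carrier_mat m n"
  shows "mat_trace (A * B) = (\<Sum>i<n. \<Sum>l<m. A $$ (i, l) * B $$ (l, i))"
proof -
  have "mat_trace (A * B) = (\<Sum>i<n. (A * B) $$ (i, i))"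
    using assms by (simp add: mat_trace_def)
  also have "\<dots> = (\<Sum>i<n. \<Sum>l<m. A $$ (i, l) * B $$ (l, i))"
    by (intro sum.cong refl mult_mat_index[OF assms]) auto
  finally show ?thesis .
qed

lemma mat_trace_comm:
  assumes "A \<in> carrier_mat n m" "B \<in> carrier_mat m n"
  shows "mat_trace (A * B) = mat_trace (B * A)"
  unfolding mat_trace_mult[OF assms] mat_trace_mult[OF assms(2,1)]
  by (subst sum.swap) (simp add: mult.commute)

section \<open>Unitary matrices and the spectral theorem\<close>

definition unitary_mat :: "nat \<Rightarrow> complex mat \<Rightarrow> bool" where
  "unitary_mat d U \<longleftrightarrow> U \<in> carrier_mat d d \<and> mat_adjoint U * U = 1\<^sub>m d"

lemma unitary_mat_carrier [simp]: "unitary_mat d U \<Longrightarrow> U \<in> carrier_mat d d"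
  by (simp add: unitary_mat_def)

lemma unitary_mat_left: "unitary_mat d U \<Longrightarrow> mat_adjoint U * U = 1\<^sub>m d"
  by (simp add: unitary_mat_def)

lemma unitary_mat_right: "unitary_mat d U \<Longrightarrow> U * mat_adjoint U = 1\<^sub>m d"
  using mat_mult_left_right_inverse[of "mat_adjoint U" d U] by (simp add: unitary_mat_def)

lemma unitary_mat_adjoint: "unitary_mat d U \<Longrightarrow> unitary_mat d (mat_adjoint U)"
  using unitary_mat_right[of d U] by (simp add: unitary_mat_def)

lemma unitary_mat_cancel:
  assumes "unitary_mat d U" "M \<in> carrier_mat d n"
  shows "mat_adjoint U * (U * M) = M" "U * (mat_adjoint U * M) = M"
  using assms unitary_mat_left[of d U] unitary_mat_right[of d U]
    assoc_mult_mat[of "mat_adjoint U" d d U d M n] assoc_mult_mat[of U d d "mat_adjoint U" d M n]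
  by simp_all

lemma unitary_mat_mult:
  assumes "unitary_mat d U" "unitary_mat d V"
  shows "unitary_mat d (U * V)"
proof -
  have "mat_adjoint (U * V) * (U * V) = mat_adjoint V * (mat_adjoint U * (U * V))"
    using assms by (simp add: mat_adjoint_mult[of _ d d _ d] assoc_mult_square[where d=d])
  also have "\<dots> = 1\<^sub>m d"
    using assms unitary_mat_left[of d V] by (simp add: unitary_mat_cancel[of d U V d])
  finally show ?thesis using assms by (simp add: unitary_mat_def)
qed

lemma unitary_mat_one: "unitary_mat d (1\<^sub>m d)"
proof -
  have "mat_adjoint (1\<^sub>m d) = (1\<^sub>m d :: complex mat)" by (rule eq_matI) auto
  then show ?thesis by (simp add: unitary_mat_def)
qed

text \<open>The eigenvalues form a real sequence of which only the first \<open>d\<close> terms are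
  read; the eigenvectors are the columns of \<open>U\<close>.\<close>

definition spectral :: "nat \<Rightarrow> complex mat \<Rightarrow> (nat \<Rightarrow> real) \<Rightarrow> complex mat" where
  "spectral d U e = U * mat_diag d (\<lambda>i. complex_of_real (e i)) * mat_adjoint U"

lemma spectral_dim [simp]:
  "dim_row (spectral d U e) = dim_row U" "dim_col (spectral d U e) = dim_row U"
  by (simp_all add: spectral_def)

lemma spectral_carrier [simp]: "U \<in> carrier_mat d d \<Longrightarrow> spectral d U e \<in> carrier_mat d d"
  unfolding spectral_def by (intro mult_carrier_mat[of _ d d]) auto

lemma spectral_cong: "(\<And>i. i < d \<Longrightarrow> e i = f i) \<Longrightarrow> spectral d U e = spectral d U f"
proof -
  assume "\<And>i. i < d \<Longrightarrow> e i = f i"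
  then have "mat_diag d (\<lambda>i. complex_of_real (e i)) = mat_diag d (\<lambda>i. complex_of_real (f i))"
    by (auto simp: mat_diag_def)
  then show ?thesis by (simp add: spectral_def)
qed

lemma spectral_index:
  assumes "U \<in> carrier_mat d d" "i < d" "j < d"
  shows "spectral d U e $$ (i, j) = (\<Sum>k<d. U $$ (i, k) * e k * cnj (U $$ (j, k)))"
  unfolding spectral_def
  using assms
  by (subst mult_mat_index[of _ d d _ d])
     (auto simp: mat_diag_mult_right[of U d d] intro!: sum.cong mult_carrier_mat[of _ d d])

lemma spectral_conj:
  assumes "U \<in> carrier_mat d d" "W \<in> carrier_mat d d"
  shows "spectral d (W * U) e = W * spectral d U e * mat_adjoint W"
  using assms unfolding spectral_def
  by (simp add: mat_adjoint_mult[of _ d d _ d] assoc_mult_square[where d=d])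

lemma spectral_adjoint:
  assumes "U \<in> carrier_mat d d"
  shows "mat_adjoint (spectral d U e) = spectral d U e"
  by (rule eq_matI) (use assms in \<open>auto simp: spectral_index intro!: sum.cong\<close>)

text \<open>The deflation step of the spectral theorem: \<open>v\<close> is completed to a basis,
  Gram-Schmidt keeps the first vector, and dividing each column by its norm gives a unitary. The
  factor \<open>c\<close> is the reciprocal of the norm of \<open>v\<close>.\<close>

lemma unitary_with_first_col:
  assumes v: "v \<in> carrier_vec (Suc n)" and v0: "v \<noteq> 0\<^sub>v (Suc n)"
  shows "\<exists>W c. unitary_mat (Suc n) W \<and> (\<forall>i\<le>n. W $$ (i, 0) = c * v $ i)"
proof -
  interpret cof_vec_space "Suc n" "TYPE(complex)" .
  note bc = basis_completion[OF v v0]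
  define ws where "ws = gram_schmidt (Suc n) (basis_completion v)"
  have "length (basis_completion v) = Suc n"
    using bc(1,4) dim_basis[of "set (basis_completion v)"] dim_is_n distinct_card by (metis List.finite_set)
  moreover have "\<not> lin_dep (set (basis_completion v))"
    using bc(1) by (simp add: basis_def)
  moreover note gram_schmidt_result[OF bc(2) bc(4) _ ws_def]
  ultimately have ws: "set ws \<subseteq> carrier_vec (Suc n)" "corthogonal ws" "length ws = Suc n"
    by auto
  have "basis_completion v = v # tl (basis_completion v)"
    by (simp add: basis_completion_def Let_def)
  then have "hd ws = v"
    unfolding ws_def using gram_schmidt_hd[OF v, of "tl (basis_completion v)"] by metis
  then have "ws ! 0 = v"
    using ws(3) by (cases ws) auto
  have wsi: "ws ! i \<in> carrier_vec (Suc n)" if "i \<le> n" for i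
    using ws that by auto
  define N where "N j = (\<Sum>i\<le>n. (cmod (ws ! j $ i))\<^sup>2)" for j
  have ip: "ws ! j \<bullet>c ws ! i = (\<Sum>k\<le>n. ws ! j $ k * cnj (ws ! i $ k))" if "i \<le> n" "j \<le> n" for i j
    using wsi[OF that(1)] wsi[OF that(2)]
    by (auto simp: scalar_prod_def atLeast0_lessThan_Suc lessThan_Suc_atMost[symmetric] lessThan_atLeast0 intro!: sum.cong)
  have ip_self: "ws ! j \<bullet>c ws ! j = N j" if "j \<le> n" for j
    unfolding ip[OF that that] N_def by (simp add: complex_norm_square[symmetric])
  have N: "N j > 0" if "j \<le> n" for j
  proof -
    have "N j \<noteq> 0" using ip_self[OF that] corthogonalD[OF ws(2), of j j] ws(3) that by auto
    moreover have "N j \<ge> 0" unfolding N_def by (intro sum_nonneg) auto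
    ultimately show ?thesis by simp
  qed
  define W where "W = mat (Suc n) (Suc n) (\<lambda>(i, j). ws ! j $ i / complex_of_real (sqrt (N j)))"
  have W: "W \<in> carrier_mat (Suc n) (Suc n)" by (simp add: W_def)
  have "mat_adjoint W * W = 1\<^sub>m (Suc n)"
  proof (rule eq_matI)
    fix i j assume "i < dim_row (1\<^sub>m (Suc n) :: complex mat)" "j < dim_col (1\<^sub>m (Suc n) :: complex mat)"
    then have ij: "i < Suc n" "j < Suc n" by auto
    have "(mat_adjoint W * W) $$ (i, j) = (\<Sum>k\<le>n. cnj (W $$ (k, i)) * W $$ (k, j))"
      using ij W by (subst mult_mat_index[of _ "Suc n" "Suc n" _ "Suc n"]) (auto simp: lessThan_Suc_atMost intro!: sum.cong)
    also have "\<dots> = (\<Sum>k\<le>n. ws ! j $ k * cnj (ws ! i $ k) / complex_of_real (sqrt (N i) * sqrt (N j)))"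
      using ij by (auto simp: W_def intro!: sum.cong)
    also have "\<dots> = (ws ! j \<bullet>c ws ! i) / complex_of_real (sqrt (N i) * sqrt (N j))"
      using ij by (subst ip) (auto simp: sum_divide_distrib)
    also have "\<dots> = 1\<^sub>m (Suc n) $$ (i, j)"
    proof (cases "i = j")
      case True
      then show ?thesis using ij ip_self[of i] N[of i] by (simp flip: of_real_mult)
    next
      case False
      then show ?thesis using ij corthogonalD[OF ws(2), of j i] ws(3) by auto
    qed
    finally show "(mat_adjoint W * W) $$ (i, j) = 1\<^sub>m (Suc n) $$ (i, j)" .
  qed (use W in auto)
  moreover have "\<forall>i\<le>n. W $$ (i, 0) = (1 / complex_of_real (sqrt (N 0))) * v $ i"
    using \<open>ws ! 0 = v\<close> by (auto simp: W_def)
  ultimately show ?thesis using W unfolding unitary_mat_def by blast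
qed

text \<open>Induction on the dimension. An eigenvector is made the first column of a unitary
  \<open>W\<close>; in that basis the first column of the matrix vanishes off the corner, by
  hermiticity so does the first row, and what remains is a hermitian block of size
  \<open>n\<close>.\<close>

theorem hermitian_spectral:
  fixes A :: "complex mat"
  assumes "A \<in> carrier_mat d d" "mat_adjoint A = A"
  shows "\<exists>U e. unitary_mat d U \<and> A = spectral d U e"
  using assms
proof (induction d arbitrary: A)
  case 0
  have "unitary_mat 0 (1\<^sub>m 0)" by (rule unitary_mat_one)
  moreover have "A = spectral 0 (1\<^sub>m 0) (\<lambda>_. 0)"
    by (rule eq_matI) (use 0 in auto)
  ultimately show ?case by blast
next
  case (Suc n)
  note A = Suc.prems(1)
  from spectrum_non_empty[OF A] obtain k where "eigenvalue A k"
    by (auto simp: spectrum_def)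
  then obtain v where v: "v \<in> carrier_vec (Suc n)" "v \<noteq> 0\<^sub>v (Suc n)" "A *\<^sub>v v = k \<cdot>\<^sub>v v"
    using A by (auto simp: eigenvalue_def eigenvector_def)
  obtain W c where W: "unitary_mat (Suc n) W" and W0: "\<And>i. i \<le> n \<Longrightarrow> W $$ (i, 0) = c * v $ i"
    using unitary_with_first_col[OF v(1,2)] by blast
  note Wc = unitary_mat_carrier[OF W]
  define B where "B = mat_adjoint W * (A * W)"
  have B: "B \<in> carrier_mat (Suc n) (Suc n)"
    unfolding B_def using A Wc by (intro mult_carrier_mat[of _ _ "Suc n"]) auto
  have BH: "mat_adjoint B = B"
    unfolding B_def using A Wc Suc.prems(2)
    by (simp add: mat_adjoint_mult[of _ "Suc n" "Suc n" _ "Suc n"] assoc_mult_square[where d="Suc n"])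
  have AWB: "A = W * B * mat_adjoint W"
    unfolding B_def using A Wc W
    by (simp add: assoc_mult_square[where d="Suc n"] unitary_mat_cancel[of "Suc n" W _ "Suc n"]
          unitary_mat_right)
  have AW0: "(A * W) $$ (i, 0) = k * W $$ (i, 0)" if "i \<le> n" for i
  proof -
    have "(A * W) $$ (i, 0) = (\<Sum>l<Suc n. A $$ (i, l) * W $$ (l, 0))"
      using A Wc that by (subst mult_mat_index[of _ "Suc n" "Suc n" _ "Suc n"]) auto
    also have "\<dots> = c * (A *\<^sub>v v) $ i"
      using A v(1) that W0 by (auto simp: scalar_prod_def lessThan_atLeast0 sum_distrib_left less_Suc_eq_le algebra_simps intro!: sum.cong)
    also have "\<dots> = k * W $$ (i, 0)" using W0[OF that] v(1) that unfolding v(3) by auto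
    finally show ?thesis .
  qed
  have B0: "B $$ (i, 0) = (if i = 0 then k else 0)" if "i \<le> n" for i
  proof -
    have "B $$ (i, 0) = (\<Sum>l<Suc n. mat_adjoint W $$ (i, l) * (A * W) $$ (l, 0))"
      unfolding B_def using A Wc that by (subst mult_mat_index[of _ "Suc n" "Suc n" _ "Suc n"]) auto
    also have "\<dots> = k * (\<Sum>l<Suc n. mat_adjoint W $$ (i, l) * W $$ (l, 0))"
      unfolding sum_distrib_left by (rule sum.cong) (auto simp: AW0)
    also have "(\<Sum>l<Suc n. mat_adjoint W $$ (i, l) * W $$ (l, 0)) = (mat_adjoint W * W) $$ (i, 0)"
      using Wc that by (subst mult_mat_index[of _ "Suc n" "Suc n" _ "Suc n"]) auto
    finally show ?thesis using that unitary_mat_left[OF W] by simp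
  qed
  have B0': "B $$ (0, i) = (if i = 0 then k else 0)" if "i \<le> n" for i
  proof -
    have "B $$ (0, i) = cnj (B $$ (i, 0))"
      using B that by (subst BH[symmetric]) simp
    moreover have "B $$ (0, 0) = cnj (B $$ (0, 0))"
      using B by (subst BH[symmetric]) simp
    ultimately show ?thesis using B0[of 0] B0[OF that] by auto
  qed
  have kr: "complex_of_real (Re k) = k"
  proof -
    have "B $$ (0, 0) = cnj (B $$ (0, 0))"
      using B by (subst BH[symmetric]) simp
    then show ?thesis using B0[of 0] by (simp add: complex_eq_iff)
  qed
  define B' where "B' = mat n n (\<lambda>(i, j). B $$ (Suc i, Suc j))"
  have "mat_adjoint B' = B'"
  proof (rule eq_matI)
    fix i j assume "i < dim_row B'" "j < dim_col B'"
    then have ij: "i < n" "j < n" by (auto simp: B'_def)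
    have "B $$ (Suc i, Suc j) = cnj (B $$ (Suc j, Suc i))"
      using B ij by (subst BH[symmetric]) simp
    then show "mat_adjoint B' $$ (i, j) = B' $$ (i, j)"
      using ij by (simp add: B'_def)
  qed (auto simp: B'_def)
  then obtain U' e' where U': "unitary_mat n U'" and B'e: "B' = spectral n U' e'"
    using Suc.IH[of B'] by (auto simp: B'_def)
  \<comment> \<open>The direct sum of the scalar 1 and \<open>U'\<close>, an eigenbasis of the
    matrix with corner \<open>k\<close> and block \<open>B'\<close>.\<close>
  define U where "U = mat (Suc n) (Suc n) (\<lambda>(i, j). case (i, j) of (0, 0) \<Rightarrow> 1 | (Suc i, Suc j) \<Rightarrow> U' $$ (i, j) | _ \<Rightarrow> 0)"
  define e where "e i = (case i of 0 \<Rightarrow> Re k | Suc i \<Rightarrow> e' i)" for i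
  have U: "U \<in> carrier_mat (Suc n) (Suc n)" by (simp add: U_def)
  have "mat_adjoint U * U = 1\<^sub>m (Suc n)"
  proof (rule eq_matI)
    fix i j assume "i < dim_row (1\<^sub>m (Suc n) :: complex mat)" "j < dim_col (1\<^sub>m (Suc n) :: complex mat)"
    then have ij: "i < Suc n" "j < Suc n" by auto
    have "(mat_adjoint U * U) $$ (i, j) = (\<Sum>k<Suc n. cnj (U $$ (k, i)) * U $$ (k, j))"
      using ij U by (subst mult_mat_index[of _ "Suc n" "Suc n" _ "Suc n"]) (auto intro!: sum.cong)
    also have "\<dots> = 1\<^sub>m (Suc n) $$ (i, j)"
    proof (cases "\<exists>i' j'. i = Suc i' \<and> j = Suc j'")
      case True
      then obtain i' j' where ij': "i = Suc i'" "j = Suc j'" by blast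
      have "(\<Sum>k<n. cnj (U' $$ (k, i')) * U' $$ (k, j')) = (mat_adjoint U' * U') $$ (i', j')"
        using ij ij' carrier_matD[OF unitary_mat_carrier[OF U']] unitary_mat_carrier[OF U']
        by (subst mult_mat_index[of _ n n _ n]) (auto intro!: sum.cong)
      then show ?thesis
        using ij unfolding ij' sum.lessThan_Suc_shift by (simp add: U_def unitary_mat_left[OF U'])
    next
      case False
      then show ?thesis using ij unfolding sum.lessThan_Suc_shift
        by (cases i; cases j) (auto simp: U_def)
    qed
    finally show "(mat_adjoint U * U) $$ (i, j) = 1\<^sub>m (Suc n) $$ (i, j)" .
  qed (use U in auto)
  with U have Uu: "unitary_mat (Suc n) U" by (simp add: unitary_mat_def)
  have "B = spectral (Suc n) U e"
  proof (rule eq_matI)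
    fix i j assume "i < dim_row (spectral (Suc n) U e)" "j < dim_col (spectral (Suc n) U e)"
    then have ij: "i < Suc n" "j < Suc n" using U by auto
    show "B $$ (i, j) = spectral (Suc n) U e $$ (i, j)"
    proof (cases "\<exists>i' j'. i = Suc i' \<and> j = Suc j'")
      case True
      then obtain i' j' where ij': "i = Suc i'" "j = Suc j'" by blast
      have "B $$ (i, j) = B' $$ (i', j')" using ij ij' by (simp add: B'_def)
      then show ?thesis
        using ij unfolding ij' spectral_index[OF U ij[unfolded ij']] sum.lessThan_Suc_shift B'e
        by (simp add: U_def e_def spectral_index[OF unitary_mat_carrier[OF U']])
    next
      case False
      then show ?thesis
        using ij B0[of i] B0'[of j] kr unfolding spectral_index[OF U ij] sum.lessThan_Suc_shift
        by (cases i; cases j) (auto simp: U_def e_def)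
    qed
  qed (use U B in auto)
  then have "A = spectral (Suc n) (W * U) e"
    using spectral_conj[OF U Wc] AWB by simp
  with unitary_mat_mult[OF W Uu] show ?case by blast
qed

section \<open>Quadratic forms and supports\<close>

text \<open>Vectors are plain functions on indices, read only below \<open>d\<close>. Truncating,
  adding and slicing vectors then needs no dimension bookkeeping.\<close>

definition app :: "nat \<Rightarrow> complex mat \<Rightarrow> (nat \<Rightarrow> complex) \<Rightarrow> nat \<Rightarrow> complex" where
  "app d A x i = (\<Sum>j<d. A $$ (i, j) * x j)"

text \<open>The form <y, M x>: linear in the first argument \<open>x\<close> and conjugate linear in
  \<open>y\<close>.\<close>

definition sform :: "nat \<Rightarrow> complex mat \<Rightarrow> (nat \<Rightarrow> complex) \<Rightarrow> (nat \<Rightarrow> complex) \<Rightarrow> complex" where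
  "sform d M x y = (\<Sum>i<d. cnj (y i) * app d M x i)"

lemma app_cong: "(\<And>j. j < d \<Longrightarrow> x j = y j) \<Longrightarrow> app d A x i = app d A y i"
  unfolding app_def by (intro sum.cong) auto

lemma sform_cong:
  "(\<And>j. j < d \<Longrightarrow> x j = x' j) \<Longrightarrow> (\<And>j. j < d \<Longrightarrow> y j = y' j) \<Longrightarrow> sform d M x y = sform d M x' y'"
  unfolding sform_def by (intro sum.cong) (auto intro: app_cong arg_cong2[where f = "(*)"])

lemma app_mult:
  assumes "A \<in> carrier_mat n m" "B \<in> carrier_mat m d" "i < n"
  shows "app d (A * B) x i = app m A (app d B x) i"
proof -
  have "app d (A * B) x i = (\<Sum>j<d. (\<Sum>l<m. A $$ (i, l) * B $$ (l, j)) * x j)"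
    unfolding app_def using assms by (intro sum.cong refl) (subst mult_mat_index[of _ n m _ d], auto)
  also have "\<dots> = app m A (app d B x) i"
    unfolding app_def sum_distrib_left sum_distrib_right
    by (subst sum.swap) (simp add: mult.assoc)
  finally show ?thesis .
qed

lemma app_one: "i < d \<Longrightarrow> app d (1\<^sub>m d) x i = x i"
  unfolding app_def by (subst sum.remove[of _ i]) auto

text \<open>The defining property of the adjoint, <y, A x> = <A^H y, x>, for rectangular
  \<open>A\<close>.\<close>

lemma sum_cnj_app:
  assumes "A \<in> carrier_mat n d"
  shows "(\<Sum>i<n. cnj (y i) * app d A x i) = (\<Sum>j<d. cnj (app n (mat_adjoint A) y j) * x j)"
proof -
  have "(\<Sum>i<n. cnj (y i) * app d A x i) = (\<Sum>j<d. \<Sum>i<n. cnj (y i) * (A $$ (i, j) * x j))"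
    unfolding app_def sum_distrib_left by (rule sum.swap)
  also have "\<dots> = (\<Sum>j<d. cnj (app n (mat_adjoint A) y j) * x j)"
    using assms unfolding app_def by (intro sum.cong) (auto simp: sum_distrib_right intro!: sum.cong)
  finally show ?thesis .
qed

lemma sform_conj:
  assumes A: "A \<in> carrier_mat n d" and M: "M \<in> carrier_mat n n"
  shows "sform d (mat_adjoint A * M * A) x y = sform n M (app d A x) (app d A y)"
proof -
  have "sform d (mat_adjoint A * M * A) x y = (\<Sum>i<d. cnj (y i) * app n (mat_adjoint A) (app d (M * A) x) i)"
    unfolding sform_def using assms
    by (intro sum.cong refl)
       (subst app_mult[symmetric, of _ d n _ d], auto simp: assoc_mult_mat[of _ d n _ n _ d])
  also have "\<dots> = (\<Sum>j<n. cnj (app d A y j) * app d (M * A) x j)"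
    using A by (subst sum_cnj_app[of _ d n]) auto
  also have "\<dots> = sform n M (app d A x) (app d A y)"
    unfolding sform_def using assms
    by (intro sum.cong refl) (subst app_mult[of _ n n _ d], auto)
  finally show ?thesis .
qed

lemma sform_scalar_prod:
  assumes "M \<in> carrier_mat d d" "v \<in> carrier_vec d" "w \<in> carrier_vec d"
  shows "(M *\<^sub>v v) \<bullet>c w = sform d M (\<lambda>i. v $ i) (\<lambda>i. w $ i)"
  using assms unfolding sform_def app_def
  by (auto simp: scalar_prod_def lessThan_atLeast0 sum_distrib_left sum_distrib_right mult_ac intro!: sum.cong)

lemma psd_mat_iff:
  "psd_mat d M \<longleftrightarrow> M \<in> carrier_mat d d \<and> mat_adjoint M = M \<and> (\<forall>x. 0 \<le> Re (sform d M x x))"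
proof (cases "M \<in> carrier_mat d d")
  case True
  have "sform d M x x = (M *\<^sub>v vec d x) \<bullet>c vec d x" for x
    using True by (subst sform_scalar_prod[of _ d]) (auto intro: sform_cong)
  then show ?thesis
    using True unfolding psd_mat_def
    by (metis sform_scalar_prod vec_carrier)
qed (simp add: psd_mat_def)

lemma psd_mat_carrier: "psd_mat d M \<Longrightarrow> M \<in> carrier_mat d d"
  by (simp add: psd_mat_def)

lemma psd_mat_conj:
  assumes "psd_mat n M" "A \<in> carrier_mat n d"
  shows "psd_mat d (mat_adjoint A * M * A)"
proof -
  have "mat_adjoint (mat_adjoint A * M * A) = mat_adjoint A * M * A"
    using assms mult_carrier_mat[of "mat_adjoint A" d n M n] mult_carrier_mat[of M n n A d]
    by (simp add: psd_mat_iff mat_adjoint_mult[of _ d n _ n] mat_adjoint_mult[of "mat_adjoint A" d n _ d]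
        mat_adjoint_mult[of M n n A d] assoc_mult_mat[of _ d n _ n _ d])
  moreover have "0 \<le> Re (sform d (mat_adjoint A * M * A) x x)" for x
    using assms by (simp add: psd_mat_iff sform_conj[of A n d])
  ultimately show ?thesis
    using assms mult_carrier_mat[of "mat_adjoint A" d n M n] mult_carrier_mat[of "mat_adjoint A * M" d n A d]
    by (simp add: psd_mat_iff)
qed

lemma sform_diag:
  "sform d (mat_diag d f) x y = (\<Sum>k<d. f k * x k * cnj (y k))"
  unfolding sform_def app_def
  by (intro sum.cong refl) (subst sum.remove, auto simp: mat_diag_def)

lemma sform_add:
  "A \<in> carrier_mat d d \<Longrightarrow> B \<in> carrier_mat d d \<Longrightarrow> sform d (A + B) x y = sform d A x y + sform d B x y"
  unfolding sform_def app_def by (simp add: sum.distrib algebra_simps)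

lemma sform_minus:
  "A \<in> carrier_mat d d \<Longrightarrow> B \<in> carrier_mat d d \<Longrightarrow> sform d (A - B) x y = sform d A x y - sform d B x y"
  unfolding sform_def app_def by (simp add: sum_subtractf algebra_simps)

text \<open>Coordinates of a vector in the orthonormal basis given by the columns of
  \<open>U\<close>.\<close>

abbreviation coord :: "nat \<Rightarrow> complex mat \<Rightarrow> (nat \<Rightarrow> complex) \<Rightarrow> nat \<Rightarrow> complex" where
  "coord d U \<equiv> app d (mat_adjoint U)"

lemma sform_spectral:
  assumes "U \<in> carrier_mat d d"
  shows "sform d (spectral d U e) x y = (\<Sum>k<d. e k * coord d U x k * cnj (coord d U y k))"
  using sform_conj[of "mat_adjoint U" d d "mat_diag d (\<lambda>i. complex_of_real (e i))"] assms
  by (simp add: spectral_def sform_diag)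

lemma sform_spectral_self:
  assumes "U \<in> carrier_mat d d"
  shows "sform d (spectral d U e) x x = complex_of_real (\<Sum>k<d. e k * (cmod (coord d U x k))\<^sup>2)"
  unfolding sform_spectral[OF assms] of_real_sum
  by (intro sum.cong refl) (simp add: complex_norm_square mult.assoc del: of_real_power)

lemma psd_spectral:
  assumes "U \<in> carrier_mat d d" "\<And>i. i < d \<Longrightarrow> 0 \<le> e i"
  shows "psd_mat d (spectral d U e)"
  using assms unfolding psd_mat_iff
  by (auto simp: spectral_adjoint sform_spectral_self intro!: sum_nonneg)

lemma coord_col:
  assumes "unitary_mat d U" "k < d" "l < d"
  shows "coord d U (\<lambda>i. U $$ (i, l)) k = (if k = l then 1 else 0)"
proof -
  have "coord d U (\<lambda>i. U $$ (i, l)) k = (mat_adjoint U * U) $$ (k, l)"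
    using assms unitary_mat_carrier[OF assms(1)] by (subst mult_mat_index[of _ d d _ d]) (auto simp: app_def)
  then show ?thesis using assms unitary_mat_left[OF assms(1)] by simp
qed

lemma coord_basis_change:
  assumes "unitary_mat d U" "V \<in> carrier_mat d d" "k < d"
  shows "coord d V x k = app d (mat_adjoint V * U) (coord d U x) k"
proof -
  have "coord d V x k = app d (mat_adjoint V * (U * mat_adjoint U)) x k"
    using assms by (simp add: unitary_mat_right)
  also have "\<dots> = app d (mat_adjoint V * U * mat_adjoint U) x k"
    using assms by (simp add: assoc_mult_square[where d = d])
  also have "\<dots> = app d (mat_adjoint V * U) (coord d U x) k"
    using assms by (intro app_mult[of _ d d]) auto
  finally show ?thesis .
qed

lemma coord_reconstruct:
  assumes "unitary_mat d U" "i < d"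
  shows "app d U (coord d U x) i = x i"
  using assms app_mult[of U d d "mat_adjoint U" d i x]
  by (simp add: unitary_mat_right app_one)

lemma coord_parseval:
  assumes "unitary_mat d U"
  shows "(\<Sum>k<d. coord d U x k * cnj (coord d U y k)) = (\<Sum>i<d. x i * cnj (y i))"
proof -
  have "(\<Sum>i<d. cnj (y i) * x i) = (\<Sum>i<d. cnj (y i) * app d U (coord d U x) i)"
    by (intro sum.cong) (auto simp: coord_reconstruct[OF assms])
  also have "\<dots> = (\<Sum>k<d. cnj (coord d U y k) * coord d U x k)"
    using assms by (subst sum_cnj_app[of _ d d]) auto
  finally show ?thesis by (simp add: mult.commute)
qed

lemma psd_spectral_exists:
  assumes "psd_mat d M"
  obtains U e where "unitary_mat d U" "M = spectral d U e" "\<And>i. 0 \<le> e i"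
proof -
  from assms obtain U e where U: "unitary_mat d U" "M = spectral d U e"
    using hermitian_spectral[of M d] by (auto simp: psd_mat_def)
  have "0 \<le> e l" if "l < d" for l
  proof -
    have "0 \<le> Re (sform d M (\<lambda>i. U $$ (i, l)) (\<lambda>i. U $$ (i, l)))"
      using assms by (simp add: psd_mat_iff)
    also have "\<dots> = (\<Sum>k<d. if k = l then e k else 0)"
      unfolding U(2) sform_spectral_self[OF unitary_mat_carrier[OF U(1)]] Re_complex_of_real
      by (intro sum.cong) (auto simp: coord_col[OF U(1) _ that])
    also have "\<dots> = e l" using that by simp
    finally show ?thesis .
  qed
  \<comment> \<open>Cutting off at 0 changes nothing below \<open>d\<close> and makes the eigenvalue
    sequence nonnegative at every index, so later uses carry no index bound.\<close>
  then have "M = spectral d U (\<lambda>i. max (e i) 0)" unfolding U(2) by (intro spectral_cong) auto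
  with U(1) show ?thesis by (intro that[of U "\<lambda>i. max (e i) 0"]) auto
qed

text \<open>The functional calculus does not depend on the diagonalisation. The matrix
  \<open>W\<close> = V^H U intertwines the two diagonal matrices, so a nonzero entry of
  \<open>W\<close> links only equal eigenvalues, and it then intertwines their images under
  \<open>g\<close> as well.\<close>

lemma spectral_eq_calculus:
  assumes U: "unitary_mat d U" and V: "unitary_mat d V" and eq: "spectral d U e = spectral d V f"
  shows "spectral d U (\<lambda>i. g (e i)) = spectral d V (\<lambda>i. g (f i))"
proof -
  note c = unitary_mat_carrier[OF U] unitary_mat_carrier[OF V]
  define W where "W = mat_adjoint V * U"
  have W: "W \<in> carrier_mat d d" using c by (simp add: W_def)
  have move: "mat_adjoint V * spectral d U h * U = W * mat_diag d (\<lambda>i. complex_of_real (h i))"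
    and move': "mat_adjoint V * spectral d V h * U = mat_diag d (\<lambda>i. complex_of_real (h i)) * W" for h
    using c unfolding W_def spectral_def
    by (simp_all add: assoc_mult_square[where d = d] unitary_mat_cancel[OF U, of _ d] unitary_mat_cancel[OF V, of _ d]
        unitary_mat_left[OF U] unitary_mat_left[OF V] right_mult_one_mat[of _ d d])
  have We: "W $$ (i, j) * e j = f i * W $$ (i, j)" if "i < d" "j < d" for i j
  proof -
    have "W * mat_diag d (\<lambda>i. complex_of_real (e i)) = mat_diag d (\<lambda>i. complex_of_real (f i)) * W"
      using move[of e] move'[of f] eq by simp
    from arg_cong[OF this, of "\<lambda>M. M $$ (i, j)"] show ?thesis
      using that by (simp add: mat_diag_mult_left[OF W] mat_diag_mult_right[OF W])
  qed
  have "W * mat_diag d (\<lambda>i. complex_of_real (g (e i))) = mat_diag d (\<lambda>i. complex_of_real (g (f i))) * W"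
  proof (rule eq_matI)
    fix i j assume "i < dim_row (mat_diag d (\<lambda>i. complex_of_real (g (f i))) * W)"
      "j < dim_col (mat_diag d (\<lambda>i. complex_of_real (g (f i))) * W)"
    then have ij: "i < d" "j < d" using W by (auto simp: mat_diag_def)
    have "W $$ (i, j) = 0 \<or> e j = f i" using We[OF ij] by auto
    then show "(W * mat_diag d (\<lambda>i. complex_of_real (g (e i)))) $$ (i, j) =
        (mat_diag d (\<lambda>i. complex_of_real (g (f i))) * W) $$ (i, j)"
      using ij by (auto simp: mat_diag_mult_left[OF W] mat_diag_mult_right[OF W])
  qed (use W in \<open>auto simp: mat_diag_def\<close>)
  then have "mat_adjoint V * spectral d U (\<lambda>i. g (e i)) * U = mat_adjoint V * spectral d V (\<lambda>i. g (f i)) * U"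
    using move[of "\<lambda>i. g (e i)"] move'[of "\<lambda>i. g (f i)"] by simp
  then have "V * (mat_adjoint V * spectral d U (\<lambda>i. g (e i)) * U) * mat_adjoint U =
    V * (mat_adjoint V * spectral d V (\<lambda>i. g (f i)) * U) * mat_adjoint U" by simp
  then show ?thesis
    using c
    by (simp add: assoc_mult_square[where d = d] unitary_mat_cancel[OF U, of _ d] unitary_mat_cancel[OF V, of _ d]
        unitary_mat_right[OF U] unitary_mat_right[OF V])
qed

lemma mat_log_spectral:
  assumes U: "unitary_mat d U" and e: "\<And>i. i < d \<Longrightarrow> 0 \<le> e i"
  shows "mat_log (spectral d U e) = spectral d U (\<lambda>i. ln (e i))"
proof -
  let ?g = "\<lambda>x::real. if 0 < x then ln x else 0"
  define P where "P L \<longleftrightarrow> (\<exists>V f. unitary_mat d V \<and> spectral d U e = spectral d V f \<and> L = spectral d V (\<lambda>i. ?g (f i)))" for L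
  have "mat_log (spectral d U e) = (SOME L. P L)"
    using unitary_mat_carrier[OF U]
    unfolding mat_log_def P_def unitary_mat_def spectral_def Let_def by simp
  moreover have "P (spectral d U (\<lambda>i. ?g (e i)))" unfolding P_def using U by blast
  then have "P (SOME L. P L)" by (rule someI)
  then obtain V f where V: "unitary_mat d V" "spectral d U e = spectral d V f"
    and L: "(SOME L. P L) = spectral d V (\<lambda>i. ?g (f i))"
    unfolding P_def by blast
  have "(SOME L. P L) = spectral d U (\<lambda>i. ?g (e i))"
    unfolding L using spectral_eq_calculus[OF U V, where g = ?g] by (rule sym)
  \<comment> \<open>At the eigenvalue 0 the two sides agree because \<open>ln 0 = 0\<close>, which
    is exactly the convention of \<open>mat_log\<close> on the kernel.\<close>
  moreover have "spectral d U (\<lambda>i. ?g (e i)) = spectral d U (\<lambda>i. ln (e i))"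
    by (intro spectral_cong) (use e in \<open>fastforce simp: less_le\<close>)
  ultimately show ?thesis by simp
qed

text \<open>For positive semidefinite matrices the vanishing of the quadratic form describes the kernel, so this
  is the support condition.\<close>

definition dominated :: "nat \<Rightarrow> complex mat \<Rightarrow> complex mat \<Rightarrow> bool" where
  "dominated d \<rho> \<sigma> \<longleftrightarrow> (\<forall>x. Re (sform d \<sigma> x x) = 0 \<longrightarrow> Re (sform d \<rho> x x) = 0)"

section \<open>Supports in terms of eigenbases\<close>

lemma sform_spectral_zero_iff:
  assumes "U \<in> carrier_mat d d" "\<And>i. i < d \<Longrightarrow> 0 \<le> e i"
  shows "Re (sform d (spectral d U e) x x) = 0 \<longleftrightarrow> (\<forall>k<d. e k = 0 \<or> coord d U x k = 0)"
  using assms sum_nonneg_eq_0_iff[of "{..<d}" "\<lambda>k. e k * (cmod (coord d U x k))\<^sup>2"]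
  by (simp add: sform_spectral_self Ball_def)

text \<open>Support inclusion as a statement on overlaps: an eigenvector of the second matrix with
  eigenvalue 0 is orthogonal to every eigenvector of the first with nonzero eigenvalue. Testing the
  columns of \<open>V\<close> gives one direction, a change of basis the other. In this form the
  condition removes the singular terms from double sums over eigenvalues.\<close>

lemma dominated_spectral_iff:
  assumes U: "unitary_mat d U" and V: "unitary_mat d V"
    and e: "\<And>i. i < d \<Longrightarrow> 0 \<le> e i" and f: "\<And>i. i < d \<Longrightarrow> 0 \<le> f i"
  shows "dominated d (spectral d U e) (spectral d V f) \<longleftrightarrow>
    (\<forall>k<d. \<forall>l<d. f l = 0 \<longrightarrow> e k = 0 \<or> (mat_adjoint V * U) $$ (l, k) = 0)" (is "?L \<longleftrightarrow> ?R")
proof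
  note c = unitary_mat_carrier[OF U] unitary_mat_carrier[OF V]
  note zero_e = sform_spectral_zero_iff[where e = e, OF c(1) e]
  note zero_f = sform_spectral_zero_iff[where e = f, OF c(2) f]
  assume ?L
  show ?R
  proof (intro allI impI)
    fix k l assume kl: "k < d" "l < d" "f l = 0"
    have "Re (sform d (spectral d V f) (\<lambda>i. V $$ (i, l)) (\<lambda>i. V $$ (i, l))) = 0"
      using kl by (subst zero_f) (auto simp: coord_col[OF V])
    with \<open>?L\<close> have "Re (sform d (spectral d U e) (\<lambda>i. V $$ (i, l)) (\<lambda>i. V $$ (i, l))) = 0"
      unfolding dominated_def by blast
    then have "e k = 0 \<or> coord d U (\<lambda>i. V $$ (i, l)) k = 0"
      using zero_e kl by blast
    moreover have "(mat_adjoint V * U) $$ (l, k) = cnj (coord d U (\<lambda>i. V $$ (i, l)) k)"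
      using c kl by (subst mult_mat_index[of _ d d _ d]) (auto simp: app_def mult.commute)
    ultimately show "e k = 0 \<or> (mat_adjoint V * U) $$ (l, k) = 0" by auto
  qed
next
  note c = unitary_mat_carrier[OF U] unitary_mat_carrier[OF V]
  note zero_e = sform_spectral_zero_iff[where e = e, OF c(1) e]
  note zero_f = sform_spectral_zero_iff[where e = f, OF c(2) f]
  assume R: ?R
  show ?L unfolding dominated_def
  proof (intro allI impI)
    fix x assume "Re (sform d (spectral d V f) x x) = 0"
    then have z: "f l = 0 \<or> coord d V x l = 0" if "l < d" for l
      using zero_f that by blast
    have "e k = 0 \<or> coord d U x k = 0" if k: "k < d" for k
    proof (cases "e k = 0")
      case False
      have "coord d U x k = (\<Sum>l<d. (mat_adjoint U * V) $$ (k, l) * coord d V x l)"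
        using coord_basis_change[OF V c(1) k] by (simp add: app_def[of d "mat_adjoint U * V"])
      also have "\<dots> = 0"
      proof (intro sum.neutral ballI)
        fix l assume "l \<in> {..<d}"
        then have l: "l < d" by simp
        have "(mat_adjoint U * V) $$ (k, l) = mat_adjoint (mat_adjoint V * U) $$ (k, l)"
          using c by (simp add: mat_adjoint_mult[of _ d d _ d])
        also have "\<dots> = cnj ((mat_adjoint V * U) $$ (l, k))"
          using c k l by (subst mat_adjoint_index) auto
        finally have "(mat_adjoint U * V) $$ (k, l) = cnj ((mat_adjoint V * U) $$ (l, k))" .
        then show "(mat_adjoint U * V) $$ (k, l) * coord d V x l = 0"
          using z[OF l] R k l False by auto
      qed
      finally show ?thesis by simp
    qed simp
    then show "Re (sform d (spectral d U e) x x) = 0"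
      using zero_e by blast
  qed
qed

text \<open>The kernel is spanned by the columns of \<open>U\<close> with eigenvalue 0, and the
  support is its orthogonal complement.\<close>

lemma mat_supp_spectral:
  assumes U: "unitary_mat d U" and e: "\<And>i. i < d \<Longrightarrow> 0 \<le> e i"
  shows "mat_supp (spectral d U e) = {v \<in> carrier_vec d. \<forall>k<d. e k = 0 \<longrightarrow> coord d U (\<lambda>i. v $ i) k = 0}"
proof -
  note c = unitary_mat_carrier[OF U]
  have ker: "mat_kernel (spectral d U e) = {w \<in> carrier_vec d. \<forall>k<d. e k = 0 \<or> coord d U (\<lambda>i. w $ i) k = 0}"
  proof -
    have "spectral d U e *\<^sub>v w = 0\<^sub>v d \<longleftrightarrow> (\<forall>k<d. e k = 0 \<or> coord d U (\<lambda>i. w $ i) k = 0)" if w: "w \<in> carrier_vec d" for w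
    proof
      assume "spectral d U e *\<^sub>v w = 0\<^sub>v d"
      then have "sform d (spectral d U e) (\<lambda>i. w $ i) (\<lambda>i. w $ i) = 0"
        using sform_scalar_prod[OF spectral_carrier[OF c] w w, of e] w by simp
      then show "\<forall>k<d. e k = 0 \<or> coord d U (\<lambda>i. w $ i) k = 0"
        using sform_spectral_zero_iff[where e = e and x = "\<lambda>i. w $ i", OF c e] by simp
    next
      assume z: "\<forall>k<d. e k = 0 \<or> coord d U (\<lambda>i. w $ i) k = 0"
      show "spectral d U e *\<^sub>v w = 0\<^sub>v d"
      proof (rule eq_vecI)
        fix i assume "i < dim_vec (0\<^sub>v d :: complex vec)"
        then have i: "i < d" by simp
        have "(spectral d U e *\<^sub>v w) $ i = app d (spectral d U e) (\<lambda>i. w $ i) i"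
          using c w i by (simp add: app_def scalar_prod_def lessThan_atLeast0)
        also have "\<dots> = app d U (app d (mat_diag d (\<lambda>i. complex_of_real (e i))) (coord d U (\<lambda>i. w $ i))) i"
          unfolding spectral_def using c i by (simp add: app_mult[of _ d d _ d])
        also have "\<dots> = app d U (\<lambda>_. 0) i"
        proof (rule app_cong)
          fix k assume k: "k < d"
          show "app d (mat_diag d (\<lambda>i. complex_of_real (e i))) (coord d U (\<lambda>i. w $ i)) k = 0"
            unfolding app_def[of d "mat_diag d _"] using z k by (intro sum.neutral) (auto simp: mat_diag_def)
        qed
        also have "\<dots> = 0\<^sub>v d $ i" using i by (simp add: app_def)
        finally show "(spectral d U e *\<^sub>v w) $ i = 0\<^sub>v d $ i" .
      qed (use c in auto)
    qed
    then show ?thesis using c by (auto simp: mat_kernel_def)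
  qed
  have ip: "v \<bullet>c w = (\<Sum>k<d. coord d U (\<lambda>i. v $ i) k * cnj (coord d U (\<lambda>i. w $ i) k))"
    if "v \<in> carrier_vec d" "w \<in> carrier_vec d" for v w
    unfolding coord_parseval[OF U] using that by (auto simp: scalar_prod_def lessThan_atLeast0 intro!: sum.cong)
  show ?thesis
  proof (intro Set.set_eqI iffI)
    fix v assume v: "v \<in> mat_supp (spectral d U e)"
    then have vc: "v \<in> carrier_vec d" using c by (auto simp: mat_supp_def)
    have "coord d U (\<lambda>i. v $ i) k = 0" if k: "k < d" "e k = 0" for k
    proof -
      have col: "coord d U (\<lambda>i. col U k $ i) l = (if l = k then 1 else 0)" if "l < d" for l
      proof -
        have "coord d U (\<lambda>i. col U k $ i) l = coord d U (\<lambda>i. U $$ (i, k)) l"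
          using c k by (intro app_cong) auto
        then show ?thesis using coord_col[OF U that k(1)] by simp
      qed
      have col_carrier: "col U k \<in> carrier_vec d" using c k by auto
      have ck: "col U k \<in> mat_kernel (spectral d U e)"
        unfolding ker using c k col by auto
      have "v \<bullet>c col U k = 0"
        using v ck by (auto simp: mat_supp_def)
      moreover have "v \<bullet>c col U k = (\<Sum>l<d. if l = k then coord d U (\<lambda>i. v $ i) l else 0)"
        unfolding ip[OF vc col_carrier] by (intro sum.cong) (auto simp: col)
      ultimately show ?thesis using k by simp
    qed
    with vc show "v \<in> {v \<in> carrier_vec d. \<forall>k<d. e k = 0 \<longrightarrow> coord d U (\<lambda>i. v $ i) k = 0}" by auto
  next
    fix v assume "v \<in> {v \<in> carrier_vec d. \<forall>k<d. e k = 0 \<longrightarrow> coord d U (\<lambda>i. v $ i) k = 0}"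
    then have v: "v \<in> carrier_vec d" "\<And>k. k < d \<Longrightarrow> e k = 0 \<Longrightarrow> coord d U (\<lambda>i. v $ i) k = 0" by auto
    have "v \<bullet>c w = 0" if "w \<in> mat_kernel (spectral d U e)" for w
      using that v unfolding ker by (subst ip) (auto intro!: sum.neutral)
    with v c show "v \<in> mat_supp (spectral d U e)" by (auto simp: mat_supp_def)
  qed
qed

text \<open>Both sides are equivalent to the same condition on the overlaps of the two
  eigenbases.\<close>

lemma mat_supp_subset_iff:
  assumes "psd_mat d \<rho>" "psd_mat d \<sigma>"
  shows "mat_supp \<rho> \<subseteq> mat_supp \<sigma> \<longleftrightarrow> dominated d \<rho> \<sigma>"
proof -
  obtain U e where U: "unitary_mat d U" and \<rho>: "\<rho> = spectral d U e" and e: "\<And>i. 0 \<le> e i"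
    using psd_spectral_exists[OF assms(1)] by blast
  obtain V f where V: "unitary_mat d V" and \<sigma>: "\<sigma> = spectral d V f" and f: "\<And>i. 0 \<le> f i"
    using psd_spectral_exists[OF assms(2)] by blast
  note c = unitary_mat_carrier[OF U] unitary_mat_carrier[OF V]
  let ?W = "mat_adjoint V * U"
  have "mat_supp \<rho> \<subseteq> mat_supp \<sigma> \<longleftrightarrow> (\<forall>k<d. \<forall>l<d. f l = 0 \<longrightarrow> e k = 0 \<or> ?W $$ (l, k) = 0)" (is "_ \<longleftrightarrow> ?R")
  proof
    assume L: "mat_supp \<rho> \<subseteq> mat_supp \<sigma>"
    show ?R
    proof (intro allI impI)
      fix k l assume kl: "k < d" "l < d" "f l = 0"
      show "e k = 0 \<or> ?W $$ (l, k) = 0"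
      proof (cases "e k = 0")
        case False
        have eqc: "coord d X (\<lambda>i. col U k $ i) m = coord d X (\<lambda>i. U $$ (i, k)) m" for X m
          using c kl by (intro app_cong) auto
        have "col U k \<in> mat_supp \<rho>"
          unfolding \<rho> mat_supp_spectral[OF U e]
          using False c kl by (auto simp: eqc coord_col[OF U])
        with L have "col U k \<in> mat_supp \<sigma>" by blast
        then have "coord d V (\<lambda>i. U $$ (i, k)) l = 0"
          unfolding \<sigma> mat_supp_spectral[OF V f] using kl by (auto simp: eqc)
        then show ?thesis using c kl by (subst mult_mat_index[of _ d d _ d]) (auto simp: app_def)
      qed simp
    qed
  next
    assume R: ?R
    show "mat_supp \<rho> \<subseteq> mat_supp \<sigma>"
    proof
      fix v assume "v \<in> mat_supp \<rho>"
      then have v: "v \<in> carrier_vec d" "\<And>k. k < d \<Longrightarrow> e k = 0 \<Longrightarrow> coord d U (\<lambda>i. v $ i) k = 0"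
        unfolding \<rho> mat_supp_spectral[OF U e] by auto
      have "coord d V (\<lambda>i. v $ i) l = 0" if "l < d" "f l = 0" for l
        unfolding coord_basis_change[OF U c(2) that(1)] app_def[of d ?W]
        using v R that by (intro sum.neutral) auto
      with v show "v \<in> mat_supp \<sigma>"
        unfolding \<sigma> mat_supp_spectral[OF V f] by auto
    qed
  qed
  then show ?thesis unfolding \<rho> \<sigma> dominated_spectral_iff[OF U V e f] .
qed

section \<open>The relative entropy in eigenbases\<close>

text \<open>The number <v, M v> for the column v = v_j of \<open>V\<close>; for a state
  \<open>M\<close>, the probability of outcome \<open>j\<close> when measuring in that
  basis.\<close>

definition diag_coef :: "nat \<Rightarrow> complex mat \<Rightarrow> complex mat \<Rightarrow> nat \<Rightarrow> real" where
  "diag_coef d V M j = Re ((mat_adjoint V * M * V) $$ (j, j))"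

text \<open>The finite branch of \<open>rel_entropy\<close>, real valued. It carries the intended
  meaning under \<open>dominated\<close>.\<close>

definition rel_ent :: "complex mat \<Rightarrow> complex mat \<Rightarrow> real" where
  "rel_ent \<rho> \<sigma> = Re (mat_trace (\<rho> * (mat_log \<rho> - mat_log \<sigma>)))"

lemma mat_trace_mult_spectral:
  assumes M: "M \<in> carrier_mat d d" and V: "V \<in> carrier_mat d d"
  shows "mat_trace (M * spectral d V f) = (\<Sum>j<d. f j * (mat_adjoint V * M * V) $$ (j, j))"
proof -
  let ?D = "mat_diag d (\<lambda>i. complex_of_real (f i))"
  have "mat_trace (M * spectral d V f) = mat_trace ((M * (V * ?D)) * mat_adjoint V)"
    unfolding spectral_def using M V by (simp add: assoc_mult_square[where d = d])
  also have "\<dots> = mat_trace (mat_adjoint V * (M * (V * ?D)))"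
    using M V by (intro mat_trace_comm[of _ d d]) auto
  also have "\<dots> = mat_trace ((mat_adjoint V * M * V) * ?D)"
    using M V by (simp add: assoc_mult_square[where d = d])
  also have "\<dots> = (\<Sum>j<d. f j * (mat_adjoint V * M * V) $$ (j, j))"
    using M V by (subst mat_diag_mult_right[of _ d d]) (auto simp: mat_trace_def mult.commute)
  finally show ?thesis .
qed

lemma Re_mat_trace_mult_spectral:
  assumes "M \<in> carrier_mat d d" "V \<in> carrier_mat d d"
  shows "Re (mat_trace (M * spectral d V f)) = (\<Sum>j<d. diag_coef d V M j * f j)"
  unfolding mat_trace_mult_spectral[OF assms] Re_sum diag_coef_def by (intro sum.cong refl) (simp del: index_mult_mat)

lemma diag_coef_spectral:
  assumes U: "U \<in> carrier_mat d d" and V: "V \<in> carrier_mat d d" and j: "j < d"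
  shows "diag_coef d V (spectral d U e) j = (\<Sum>i<d. (cmod ((mat_adjoint V * U) $$ (j, i)))\<^sup>2 * e i)"
proof -
  let ?W = "mat_adjoint V * U"
  have W: "?W \<in> carrier_mat d d" using U V by simp
  have "mat_adjoint V * spectral d U e * V = spectral d ?W e"
    using spectral_conj[of U d "mat_adjoint V" e] U V by simp
  then have "diag_coef d V (spectral d U e) j = Re (\<Sum>k<d. ?W $$ (j, k) * e k * cnj (?W $$ (j, k)))"
    unfolding diag_coef_def by (simp only: spectral_index[OF W j j])
  also have "(\<Sum>k<d. ?W $$ (j, k) * e k * cnj (?W $$ (j, k))) = complex_of_real (\<Sum>k<d. (cmod (?W $$ (j, k)))\<^sup>2 * e k)"
    unfolding of_real_sum of_real_mult complex_norm_square by (intro sum.cong) (auto simp: mult_ac)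
  finally show ?thesis by simp
qed

lemma diag_coef_spectral_self:
  assumes U: "unitary_mat d U" and j: "j < d"
  shows "diag_coef d U (spectral d U e) j = e j"
proof -
  have "diag_coef d U (spectral d U e) j = (\<Sum>i<d. if i = j then e i else 0)"
    unfolding diag_coef_spectral[OF unitary_mat_carrier[OF U] unitary_mat_carrier[OF U] j] unitary_mat_left[OF U]
    using j by (intro sum.cong) auto
  then show ?thesis using j by simp
qed

lemma diag_coef_sform:
  assumes V: "V \<in> carrier_mat d d" and M: "M \<in> carrier_mat d d" and j: "j < d"
  shows "diag_coef d V M j = Re (sform d M (\<lambda>i. V $$ (i, j)) (\<lambda>i. V $$ (i, j)))"
proof -
  have "(mat_adjoint V * M * V) $$ (j, j) = (mat_adjoint V * (M * V)) $$ (j, j)"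
    using V M by (simp add: assoc_mult_square[where d = d])
  also have "\<dots> = (\<Sum>i<d. cnj (V $$ (i, j)) * (M * V) $$ (i, j))"
    using V M j by (subst mult_mat_index[of _ d d _ d]) (auto intro!: sum.cong)
  also have "\<dots> = sform d M (\<lambda>i. V $$ (i, j)) (\<lambda>i. V $$ (i, j))"
    unfolding sform_def app_def using V M j
    by (intro sum.cong refl) (subst mult_mat_index[of _ d d _ d], auto)
  finally show ?thesis by (simp add: diag_coef_def)
qed

text \<open>Only the diagonal of \<rho> in the eigenbasis of \<sigma> enters the cross term, which
  makes the formula convenient when that diagonal is known.\<close>

lemma rel_ent_spectral:
  assumes U: "unitary_mat d U" and V: "unitary_mat d V"
    and e: "\<And>i. i < d \<Longrightarrow> 0 \<le> e i" and f: "\<And>i. i < d \<Longrightarrow> 0 \<le> f i"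
  shows "rel_ent (spectral d U e) (spectral d V f) =
    (\<Sum>i<d. e i * ln (e i)) - (\<Sum>j<d. diag_coef d V (spectral d U e) j * ln (f j))"
proof -
  note c = unitary_mat_carrier[OF U] unitary_mat_carrier[OF V]
  let ?\<rho> = "spectral d U e"
  have logs: "mat_log ?\<rho> = spectral d U (\<lambda>i. ln (e i))" "mat_log (spectral d V f) = spectral d V (\<lambda>i. ln (f i))"
    using mat_log_spectral[OF U, of e] mat_log_spectral[OF V, of f] e f by blast+
  have "mat_trace (?\<rho> * (mat_log ?\<rho> - mat_log (spectral d V f))) =
      mat_trace (?\<rho> * spectral d U (\<lambda>i. ln (e i)) - ?\<rho> * spectral d V (\<lambda>i. ln (f i)))"
    unfolding logs
    using c by (subst mult_minus_distrib_mat[of _ d d]) auto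
  also have "\<dots> = mat_trace (?\<rho> * spectral d U (\<lambda>i. ln (e i))) - mat_trace (?\<rho> * spectral d V (\<lambda>i. ln (f i)))"
    using c by (simp add: mat_trace_def sum_subtractf)
  finally have "rel_ent ?\<rho> (spectral d V f) =
      (\<Sum>i<d. diag_coef d U ?\<rho> i * ln (e i)) - (\<Sum>j<d. diag_coef d V ?\<rho> j * ln (f j))"
    unfolding rel_ent_def using c by (simp only: minus_complex.sel Re_mat_trace_mult_spectral spectral_carrier)
  then show ?thesis using diag_coef_spectral_self[OF U] by simp
qed

lemma rel_entropy_psd:
  assumes "psd_mat d \<rho>" "psd_mat d \<sigma>"
  shows "rel_entropy \<rho> \<sigma> = (if dominated d \<rho> \<sigma> then ereal (rel_ent \<rho> \<sigma>) else \<infinity>)"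
  unfolding rel_entropy_def mat_supp_subset_iff[OF assms] rel_ent_def ..

lemma mat_trace_spectral:
  assumes U: "unitary_mat d U"
  shows "Re (mat_trace (spectral d U e)) = (\<Sum>i<d. e i)"
proof -
  note c = unitary_mat_carrier[OF U]
  have one: "mat_adjoint U * 1\<^sub>m d * U = 1\<^sub>m d"
    using c unitary_mat_left[OF U] right_mult_one_mat[of "mat_adjoint U" d d] by simp
  have "Re (mat_trace (spectral d U e)) = Re (mat_trace (1\<^sub>m d * spectral d U e))"
    using c left_mult_one_mat[OF spectral_carrier[OF c]] by simp
  also have "\<dots> = (\<Sum>j<d. diag_coef d U (1\<^sub>m d) j * e j)"
    by (rule Re_mat_trace_mult_spectral[OF one_carrier_mat c])
  also have "\<dots> = (\<Sum>j<d. e j)"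
    unfolding diag_coef_def one by (intro sum.cong) auto
  finally show ?thesis .
qed

lemma psd_mat_trace_nonneg:
  assumes "psd_mat d M"
  shows "0 \<le> Re (mat_trace M)"
proof -
  obtain U e where U: "unitary_mat d U" and M: "M = spectral d U e" and e: "\<And>i. 0 \<le> e i"
    using psd_spectral_exists[OF assms] by blast
  show ?thesis unfolding M mat_trace_spectral[OF U] using e by (intro sum_nonneg) auto
qed

lemma unitary_mat_col_norm:
  assumes "unitary_mat d W" "i < d"
  shows "(\<Sum>j<d. (cmod (W $$ (j, i)))\<^sup>2) = 1"
proof -
  note c = unitary_mat_carrier[OF assms(1)]
  have "complex_of_real (\<Sum>j<d. (cmod (W $$ (j, i)))\<^sup>2) = (\<Sum>j<d. mat_adjoint W $$ (i, j) * W $$ (j, i))"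
    unfolding of_real_sum complex_norm_square using c carrier_matD[OF c] assms by (intro sum.cong) (auto simp: mult.commute)
  also have "\<dots> = (mat_adjoint W * W) $$ (i, i)"
    using c assms by (subst mult_mat_index[of _ d d _ d]) auto
  finally show ?thesis unfolding unitary_mat_left[OF assms(1)] using assms(2)
    by (metis index_one_mat(1) of_real_eq_1_iff)
qed

lemma unitary_mat_row_norm:
  assumes "unitary_mat d W" "j < d"
  shows "(\<Sum>i<d. (cmod (W $$ (j, i)))\<^sup>2) = 1"
proof -
  have "(\<Sum>i<d. (cmod (W $$ (j, i)))\<^sup>2) = (\<Sum>i<d. (cmod (mat_adjoint W $$ (i, j)))\<^sup>2)"
    using assms carrier_matD[OF unitary_mat_carrier[OF assms(1)]] by (intro sum.cong) auto
  then show ?thesis using unitary_mat_col_norm[OF unitary_mat_adjoint[OF assms(1)] assms(2)] by simp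
qed

text \<open>The squared overlaps form a doubly stochastic matrix, so both sums can be spread over
  pairs of indices. The result is the classical relative entropy of the two Nussbaum-Szkola weights
  |W_ji|^2 e_i and |W_ji|^2 f_j.\<close>

lemma rel_ent_overlap:
  assumes U: "unitary_mat d U" and V: "unitary_mat d V"
    and e: "\<And>i. i < d \<Longrightarrow> 0 \<le> e i" and f: "\<And>i. i < d \<Longrightarrow> 0 \<le> f i"
  shows "rel_ent (spectral d U e) (spectral d V f) =
    (\<Sum>j<d. \<Sum>i<d. (cmod ((mat_adjoint V * U) $$ (j, i)))\<^sup>2 * e i * (ln (e i) - ln (f j)))"
proof -
  note c = unitary_mat_carrier[OF U] unitary_mat_carrier[OF V]
  define W where "W = mat_adjoint V * U"
  have Wu: "unitary_mat d W" unfolding W_def by (intro unitary_mat_mult unitary_mat_adjoint U V)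
  have "(\<Sum>i<d. e i * ln (e i)) = (\<Sum>i<d. (\<Sum>j<d. (cmod (W $$ (j, i)))\<^sup>2) * (e i * ln (e i)))"
    by (intro sum.cong) (auto simp: unitary_mat_col_norm[OF Wu])
  also have "\<dots> = (\<Sum>j<d. \<Sum>i<d. (cmod (W $$ (j, i)))\<^sup>2 * e i * ln (e i))"
    unfolding sum_distrib_right by (subst sum.swap) (simp add: mult.assoc)
  finally have 1: "(\<Sum>i<d. e i * ln (e i)) = (\<Sum>j<d. \<Sum>i<d. (cmod (W $$ (j, i)))\<^sup>2 * e i * ln (e i))" .
  have 2: "(\<Sum>j<d. diag_coef d V (spectral d U e) j * ln (f j)) = (\<Sum>j<d. \<Sum>i<d. (cmod (W $$ (j, i)))\<^sup>2 * e i * ln (f j))"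
    by (intro sum.cong refl) (simp add: diag_coef_spectral[OF c] W_def sum_distrib_right)
  have "rel_ent (spectral d U e) (spectral d V f) =
      (\<Sum>i<d. e i * ln (e i)) - (\<Sum>j<d. diag_coef d V (spectral d U e) j * ln (f j))"
    using rel_ent_spectral[OF U V, of e f] e f by blast
  then show ?thesis unfolding 1 2 W_def[symmetric]
    by (simp add: sum_subtractf right_diff_distrib)
qed

section \<open>Monotonicity of the relative entropy\<close>

text \<open>For fixed \<open>X\<close> this is linear in the pair (\<rho>, \<sigma>); inequalities
  between such functionals are therefore inequalities between traces.\<close>

definition qfun :: "real \<Rightarrow> complex mat \<Rightarrow> complex mat \<Rightarrow> complex mat \<Rightarrow> real" where
  "qfun t \<rho> \<sigma> X = 2 * Re (mat_trace (X * \<rho>)) - Re (mat_trace ((X * mat_adjoint X) * \<sigma>))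
     - t * Re (mat_trace ((mat_adjoint X * X) * \<rho>))"

text \<open>In the coordinates \<open>Y\<close> of \<open>X\<close> the functional decouples: each
  entry of \<open>Y\<close> has its own scalar quadratic, so the supremum can be taken entry by
  entry.\<close>

lemma qfun_spectral:
  assumes U: "unitary_mat d U" and V: "unitary_mat d V" and X: "X \<in> carrier_mat d d"
  defines "W \<equiv> mat_adjoint V * U" and "Y \<equiv> mat_adjoint V * X * U"
  shows "qfun t (spectral d U e) (spectral d V f) X =
    (\<Sum>j<d. \<Sum>i<d. 2 * Re (Y $$ (j, i) * cnj (W $$ (j, i))) * e i - (f j + t * e i) * (cmod (Y $$ (j, i)))\<^sup>2)"
proof -
  note c = unitary_mat_carrier[OF U] unitary_mat_carrier[OF V]
  have WY: "W \<in> carrier_mat d d" "Y \<in> carrier_mat d d" using c X by (simp_all add: W_def Y_def)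
  note canc = unitary_mat_cancel[OF U, of _ d] unitary_mat_cancel[OF V, of _ d]
  have a1: "mat_adjoint U * X * U = mat_adjoint W * Y"
    unfolding W_def Y_def using c X
    by (simp add: mat_adjoint_mult[of _ d d _ d] assoc_mult_square[where d = d] canc)
  have a2: "mat_adjoint V * (X * mat_adjoint X) * V = Y * mat_adjoint Y"
    unfolding Y_def using c X
    by (simp add: mat_adjoint_mult[of _ d d _ d] assoc_mult_square[where d = d] canc)
  have a3: "mat_adjoint U * (mat_adjoint X * X) * U = mat_adjoint Y * Y"
    unfolding Y_def using c X
    by (simp add: mat_adjoint_mult[of _ d d _ d] assoc_mult_square[where d = d] canc)
  have 1: "diag_coef d U X i = (\<Sum>j<d. Re (Y $$ (j, i) * cnj (W $$ (j, i))))" if "i < d" for i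
    unfolding diag_coef_def a1 using WY that
    by (subst mult_mat_index[of _ d d _ d]) (auto simp: Re_sum mult.commute intro!: sum.cong)
  have 2: "diag_coef d V (X * mat_adjoint X) j = (\<Sum>i<d. (cmod (Y $$ (j, i)))\<^sup>2)" if "j < d" for j
  proof -
    have "(Y * mat_adjoint Y) $$ (j, j) = complex_of_real (\<Sum>i<d. (cmod (Y $$ (j, i)))\<^sup>2)"
      unfolding of_real_sum complex_norm_square using WY that
      by (subst mult_mat_index[of _ d d _ d]) (auto intro!: sum.cong)
    then show ?thesis unfolding diag_coef_def a2 by (simp del: index_mult_mat)
  qed
  have 3: "diag_coef d U (mat_adjoint X * X) i = (\<Sum>j<d. (cmod (Y $$ (j, i)))\<^sup>2)" if "i < d" for i
  proof -
    have "(mat_adjoint Y * Y) $$ (i, i) = complex_of_real (\<Sum>j<d. (cmod (Y $$ (j, i)))\<^sup>2)"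
      unfolding of_real_sum complex_norm_square using WY that
      by (subst mult_mat_index[of _ d d _ d]) (auto simp: mult.commute intro!: sum.cong)
    then show ?thesis unfolding diag_coef_def a3 by (simp del: index_mult_mat)
  qed
  have "qfun t (spectral d U e) (spectral d V f) X =
     2 * (\<Sum>i<d. diag_coef d U X i * e i) - (\<Sum>j<d. diag_coef d V (X * mat_adjoint X) j * f j)
      - t * (\<Sum>i<d. diag_coef d U (mat_adjoint X * X) i * e i)"
    unfolding qfun_def using c X by (simp only: Re_mat_trace_mult_spectral mult_carrier_square mat_adjoint_carrier)
  also have "\<dots> = 2 * (\<Sum>i<d. \<Sum>j<d. Re (Y $$ (j, i) * cnj (W $$ (j, i))) * e i)
     - (\<Sum>j<d. \<Sum>i<d. (cmod (Y $$ (j, i)))\<^sup>2 * f j)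
     - t * (\<Sum>i<d. \<Sum>j<d. (cmod (Y $$ (j, i)))\<^sup>2 * e i)"
    using 1 2 3 by (simp add: sum_distrib_right[symmetric])
  also have "\<dots> = 2 * (\<Sum>j<d. \<Sum>i<d. Re (Y $$ (j, i) * cnj (W $$ (j, i))) * e i)
     - (\<Sum>j<d. \<Sum>i<d. (cmod (Y $$ (j, i)))\<^sup>2 * f j)
     - t * (\<Sum>j<d. \<Sum>i<d. (cmod (Y $$ (j, i)))\<^sup>2 * e i)"
    by (simp only: sum.swap[of "\<lambda>i j. Re (Y $$ (j, i) * cnj (W $$ (j, i))) * e i"]
          sum.swap[of "\<lambda>i j. (cmod (Y $$ (j, i)))\<^sup>2 * e i"])
  also have "\<dots> = (\<Sum>j<d. \<Sum>i<d. 2 * (Re (Y $$ (j, i) * cnj (W $$ (j, i))) * e i)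
      - (cmod (Y $$ (j, i)))\<^sup>2 * f j - t * ((cmod (Y $$ (j, i)))\<^sup>2 * e i))"
    by (simp only: sum_subtractf sum_distrib_left)
  also have "\<dots> = (\<Sum>j<d. \<Sum>i<d. 2 * Re (Y $$ (j, i) * cnj (W $$ (j, i))) * e i - (f j + t * e i) * (cmod (Y $$ (j, i)))\<^sup>2)"
    by (intro sum.cong refl) (simp add: algebra_simps)
  finally show ?thesis .
qed

text \<open>Expand |g y - e w|^2 \<ge> 0. Equality holds at y = e w / g, which is where the
  maximiser used later comes from.\<close>

lemma complete_square_bound:
  fixes w y :: complex and e g :: real
  assumes "g > 0"
  shows "2 * Re (y * cnj w) * e - g * (cmod y)\<^sup>2 \<le> (cmod w)\<^sup>2 * e\<^sup>2 / g"
proof -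
  have "0 \<le> (cmod (g *\<^sub>R y - e *\<^sub>R w))\<^sup>2" by simp
  also have "\<dots> = g\<^sup>2 * (cmod y)\<^sup>2 - 2 * g * e * Re (y * cnj w) + e\<^sup>2 * (cmod w)\<^sup>2"
    unfolding cmod_power2 by (simp add: power2_eq_square algebra_simps)
  finally have "g * (2 * Re (y * cnj w) * e - g * (cmod y)\<^sup>2) \<le> (cmod w)\<^sup>2 * e\<^sup>2"
    by (simp add: algebra_simps power2_eq_square)
  then show ?thesis using assms by (simp add: pos_le_divide_eq mult.commute)
qed

text \<open>The identity \<open>ln x = lim (\<integral>\<^sub>0\<^sup>T (1 / (x\<inverse> + t)) dt - ln T)\<close> in disguise: \<open>F\<close> is the antiderivative
  of a function \<open>Q\<close> that is the supremum of the quadratic functionals \<open>qfun t\<close>.\<close>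

lemma rel_ent_variational:
  assumes \<rho>: "psd_mat d \<rho>" and \<sigma>: "psd_mat d \<sigma>" and dominated: "dominated d \<rho> \<sigma>"
  shows "\<exists>F Q. F 0 = 0 \<and> (\<forall>t\<ge>0. (F has_real_derivative Q t) (at t)) \<and>
    (\<forall>t\<ge>0. \<forall>X \<in> carrier_mat d d. qfun t \<rho> \<sigma> X \<le> Q t) \<and>
    (\<forall>t\<ge>0. \<exists>X \<in> carrier_mat d d. qfun t \<rho> \<sigma> X = Q t) \<and>
    ((\<lambda>T. F T - Re (mat_trace \<rho>) * ln T) \<longlongrightarrow> rel_ent \<rho> \<sigma>) at_top"
proof -
  obtain U e where U: "unitary_mat d U" and \<rho>: "\<rho> = spectral d U e" and e: "\<And>i. 0 \<le> e i"
    using psd_spectral_exists[OF \<rho>] by blast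
  obtain V f where V: "unitary_mat d V" and \<sigma>: "\<sigma> = spectral d V f" and f: "\<And>i. 0 \<le> f i"
    using psd_spectral_exists[OF \<sigma>] by blast
  note c = unitary_mat_carrier[OF U] unitary_mat_carrier[OF V]
  define W where "W = mat_adjoint V * U"
  have W: "W \<in> carrier_mat d d" using c by (simp add: W_def)
  have Wu: "unitary_mat d W" unfolding W_def by (intro unitary_mat_mult unitary_mat_adjoint U V)
  have W0: "W $$ (j, i) = 0" if "j < d" "i < d" "f j = 0" "e i \<noteq> 0" for j i
    using dominated dominated_spectral_iff[OF U V, of e f] e f that unfolding \<rho> \<sigma> W_def by blast
  define k where "k j i = (cmod (W $$ (j, i)))\<^sup>2 * e i" for j i
  \<comment> \<open>By support inclusion a term of nonzero weight has both eigenvalues positive, so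
    its logarithms and quotients are regular for all t \<ge> 0.\<close>
  have k: "k j i = 0 \<or> (0 < f j \<and> 0 < e i)" if "j < d" "i < d" for j i
    using W0[OF that] e[of i] f[of j] unfolding k_def by (auto simp: less_le)
  define Q where "Q t = (\<Sum>j<d. \<Sum>i<d. k j i * (e i / (f j + t * e i)))" for t
  define F where "F T = (\<Sum>j<d. \<Sum>i<d. k j i * (ln (f j + T * e i) - ln (f j)))" for T
  have D: "(F has_real_derivative Q t) (at t)" if t: "0 \<le> t" for t
    unfolding F_def Q_def
  proof (intro DERIV_sum)
    fix j i assume "j \<in> {..<d}" "i \<in> {..<d}"
    then consider "k j i = 0" | "0 < f j" "0 < e i" using k[of j i] by auto
    then show "((\<lambda>T. k j i * (ln (f j + T * e i) - ln (f j))) has_real_derivative k j i * (e i / (f j + t * e i))) (at t)"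
    proof cases
      case 1 then show ?thesis by simp
    next
      case 2
      then have "0 < f j + t * e i" using t by (simp add: add_pos_nonneg)
      then show ?thesis by (auto intro!: derivative_eq_intros)
    qed
  qed
  have upper: "qfun t \<rho> \<sigma> X \<le> Q t" if t: "0 \<le> t" and X: "X \<in> carrier_mat d d" for t X
    unfolding \<rho> \<sigma> qfun_spectral[OF U V X] Q_def W_def[symmetric]
  proof (intro sum_mono)
    fix j i assume ji: "j \<in> {..<d}" "i \<in> {..<d}"
    let ?y = "(mat_adjoint V * X * U) $$ (j, i)" and ?w = "W $$ (j, i)"
    show "2 * Re (?y * cnj ?w) * e i - (f j + t * e i) * (cmod ?y)\<^sup>2 \<le> k j i * (e i / (f j + t * e i))"
    proof (cases "f j + t * e i = 0")
      \<comment> \<open>A vanishing denominator makes the right side 0 by the convention on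
        division; the left side is 0 too, since then the overlap or \<open>e i\<close>
        vanishes.\<close>
      case True
      then have "f j = 0" using e[of i] f[of j] t by (simp add: add_nonneg_eq_0_iff)
      then have "?w = 0 \<or> e i = 0" using W0[of j i] ji by auto
      then show ?thesis using True by auto
    next
      case False
      then have "f j + t * e i > 0" using e[of i] f[of j] t by (simp add: less_le)
      from complete_square_bound[OF this, of ?y ?w "e i"] show ?thesis
        by (simp add: k_def power2_eq_square del: index_mult_mat)
    qed
  qed
  have attained: "\<exists>X \<in> carrier_mat d d. qfun t \<rho> \<sigma> X = Q t" if t: "0 \<le> t" for t
  proof
    \<comment> \<open>The maximiser of each scalar quadratic. Where the denominator is 0 the entry
      is 0 by convention.\<close>
    define Y where "Y = mat d d (\<lambda>(j, i). W $$ (j, i) * complex_of_real (e i / (f j + t * e i)))"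
    have Y: "Y \<in> carrier_mat d d" by (simp add: Y_def)
    define X where "X = V * Y * mat_adjoint U"
    show X: "X \<in> carrier_mat d d" using c Y by (simp add: X_def)
    have YX: "mat_adjoint V * X * U = Y"
      unfolding X_def using c Y
      by (simp add: assoc_mult_square[where d = d] unitary_mat_cancel[OF U, of _ d] unitary_mat_cancel[OF V, of _ d]
          unitary_mat_left[OF U] right_mult_one_mat[of _ d d])
    show "qfun t \<rho> \<sigma> X = Q t"
      unfolding \<rho> \<sigma> qfun_spectral[OF U V X] Q_def W_def[symmetric] YX
    proof (intro sum.cong refl)
      fix j i assume ji: "j \<in> {..<d}" "i \<in> {..<d}"
      have *: "Re (Y $$ (j, i) * cnj (W $$ (j, i))) = (cmod (W $$ (j, i)))\<^sup>2 * (e i / (f j + t * e i))"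
        "(cmod (Y $$ (j, i)))\<^sup>2 = (cmod (W $$ (j, i)))\<^sup>2 * (e i / (f j + t * e i))\<^sup>2"
      proof -
        have "Y $$ (j, i) * cnj (W $$ (j, i)) = complex_of_real ((cmod (W $$ (j, i)))\<^sup>2 * (e i / (f j + t * e i)))"
          unfolding of_real_mult complex_norm_square using ji by (simp add: Y_def)
        then show "Re (Y $$ (j, i) * cnj (W $$ (j, i))) = (cmod (W $$ (j, i)))\<^sup>2 * (e i / (f j + t * e i))"
          by simp
        show "(cmod (Y $$ (j, i)))\<^sup>2 = (cmod (W $$ (j, i)))\<^sup>2 * (e i / (f j + t * e i))\<^sup>2"
          using ji by (simp add: Y_def norm_mult norm_divide power_mult_distrib power_divide del: of_real_add of_real_divide of_real_mult)
      qed
      show "2 * Re (Y $$ (j, i) * cnj (W $$ (j, i))) * e i - (f j + t * e i) * (cmod (Y $$ (j, i)))\<^sup>2 =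
          k j i * (e i / (f j + t * e i))"
      proof -
        let ?r = "e i / (f j + t * e i)"
        have "(f j + t * e i) * ?r\<^sup>2 = e i * ?r"
          by (cases "f j + t * e i = 0") (auto simp: power2_eq_square)
        then have "(f j + t * e i) * ((cmod (W $$ (j, i)))\<^sup>2 * ?r\<^sup>2) = (cmod (W $$ (j, i)))\<^sup>2 * (e i * ?r)"
          by (metis mult.left_commute)
        then show ?thesis unfolding * k_def by (simp only: mult_ac) simp
      qed
    qed
  qed
  have tr: "Re (mat_trace \<rho>) = (\<Sum>j<d. \<Sum>i<d. k j i)"
  proof -
    have "(\<Sum>j<d. \<Sum>i<d. k j i) = (\<Sum>i<d. (\<Sum>j<d. (cmod (W $$ (j, i)))\<^sup>2) * e i)"
      unfolding k_def sum_distrib_right by (rule sum.swap)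
    also have "\<dots> = (\<Sum>i<d. e i)"
      by (intro sum.cong) (auto simp: unitary_mat_col_norm[OF Wu])
    finally show ?thesis unfolding \<rho> mat_trace_spectral[OF U] by simp
  qed
  \<comment> \<open>The weights \<open>k\<close> sum to the trace of \<rho>, so \<open>ln T\<close>
    can be distributed over the terms. In a term of nonzero weight
    \<open>ln (f j + T * e i) - ln T\<close> tends to \<open>ln (e i)\<close>.\<close>
  have "((\<lambda>T. \<Sum>j<d. \<Sum>i<d. k j i * (ln (f j + T * e i) - ln T - ln (f j))) \<longlongrightarrow>
      (\<Sum>j<d. \<Sum>i<d. k j i * (ln (e i) - ln (f j)))) at_top"
  proof (intro tendsto_sum)
    fix j i assume "j \<in> {..<d}" "i \<in> {..<d}"
    then consider "k j i = 0" | "0 < f j" "0 < e i" using k[of j i] by auto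
    then show "((\<lambda>T. k j i * (ln (f j + T * e i) - ln T - ln (f j))) \<longlongrightarrow> k j i * (ln (e i) - ln (f j))) at_top"
    proof cases
      case 1 then show ?thesis by simp
    next
      case 2
      have "((\<lambda>T::real. f j / T) \<longlongrightarrow> 0) at_top"
        by (rule real_tendsto_divide_at_top[OF tendsto_const filterlim_ident])
      then have "((\<lambda>T. ln (f j / T + e i)) \<longlongrightarrow> ln (0 + e i)) at_top"
        using 2 by (intro tendsto_intros) auto
      moreover have "\<forall>\<^sub>F T in at_top. ln (f j / T + e i) = ln (f j + T * e i) - ln T"
        using eventually_gt_at_top[of 0]
      proof eventually_elim
        case (elim T)
        then have "0 < f j + T * e i" using 2 by (simp add: add_pos_pos)
        moreover have "f j / T + e i = (f j + T * e i) / T" using elim by (simp add: field_simps)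
        ultimately show ?case using elim by (simp add: ln_div)
      qed
      ultimately have "((\<lambda>T. ln (f j + T * e i) - ln T) \<longlongrightarrow> ln (e i)) at_top"
        by (auto elim: Lim_transform_eventually)
      then show ?thesis by (intro tendsto_intros)
    qed
  qed
  also have "(\<lambda>T. \<Sum>j<d. \<Sum>i<d. k j i * (ln (f j + T * e i) - ln T - ln (f j))) = (\<lambda>T. F T - Re (mat_trace \<rho>) * ln T)"
  proof
    fix T
    have "(\<Sum>j<d. \<Sum>i<d. k j i * (ln (f j + T * e i) - ln T - ln (f j))) =
        (\<Sum>j<d. \<Sum>i<d. k j i * (ln (f j + T * e i) - ln (f j)) - k j i * ln T)"
      by (intro sum.cong refl) (simp only: right_diff_distrib diff_right_commute)
    then show "(\<Sum>j<d. \<Sum>i<d. k j i * (ln (f j + T * e i) - ln T - ln (f j))) = F T - Re (mat_trace \<rho>) * ln T"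
      by (simp only: F_def tr sum_subtractf sum_distrib_right)
  qed
  also have "(\<Sum>j<d. \<Sum>i<d. k j i * (ln (e i) - ln (f j))) = rel_ent \<rho> \<sigma>"
    unfolding \<rho> \<sigma> k_def W_def by (rule rel_ent_overlap[symmetric, OF U V]) (use e f in auto)
  finally have "((\<lambda>T. F T - Re (mat_trace \<rho>) * ln T) \<longlongrightarrow> rel_ent \<rho> \<sigma>) at_top" .
  moreover have "F 0 = 0" by (simp add: F_def)
  ultimately show ?thesis using D upper attained by blast
qed

text \<open>A pointwise bound between the suprema \<open>Q'\<close> and \<open>Q\<close> integrates
  from the common value 0 to a bound between \<open>F'\<close> and \<open>F\<close>, and equal
  traces make the \<open>ln T\<close> corrections coincide. Monotonicity thus reduces to finding,
  for each test matrix \<open>X\<close>, a test matrix \<open>Y\<close> that does at least as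
  well.\<close>

theorem rel_ent_mono:
  assumes "psd_mat d \<rho>" "psd_mat d \<sigma>" "dominated d \<rho> \<sigma>" "psd_mat d' \<rho>'" "psd_mat d' \<sigma>'" "dominated d' \<rho>' \<sigma>'"
    and tr: "Re (mat_trace \<rho>') = Re (mat_trace \<rho>)"
    and le: "\<And>t X. 0 \<le> t \<Longrightarrow> X \<in> carrier_mat d' d' \<Longrightarrow> \<exists>Y \<in> carrier_mat d d. qfun t \<rho>' \<sigma>' X \<le> qfun t \<rho> \<sigma> Y"
  shows "rel_ent \<rho>' \<sigma>' \<le> rel_ent \<rho> \<sigma>"
proof -
  from rel_ent_variational[OF assms(1-3)] obtain F Q where F: "F 0 = 0"
    "\<forall>t\<ge>0. (F has_real_derivative Q t) (at t)"
    "\<forall>t\<ge>0. \<forall>X \<in> carrier_mat d d. qfun t \<rho> \<sigma> X \<le> Q t"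
    "((\<lambda>T. F T - Re (mat_trace \<rho>) * ln T) \<longlongrightarrow> rel_ent \<rho> \<sigma>) at_top"
    by blast
  from rel_ent_variational[OF assms(4-6)] obtain F' Q' where F': "F' 0 = 0"
    "\<forall>t\<ge>0. (F' has_real_derivative Q' t) (at t)"
    "\<forall>t\<ge>0. \<exists>X \<in> carrier_mat d' d'. qfun t \<rho>' \<sigma>' X = Q' t"
    "((\<lambda>T. F' T - Re (mat_trace \<rho>') * ln T) \<longlongrightarrow> rel_ent \<rho>' \<sigma>') at_top"
    by blast
  have QQ: "Q' t \<le> Q t" if "0 \<le> t" for t
  proof -
    obtain X where X: "X \<in> carrier_mat d' d'" "qfun t \<rho>' \<sigma>' X = Q' t" using F'(3) \<open>0 \<le> t\<close> by blast
    obtain Y where Y: "Y \<in> carrier_mat d d" "qfun t \<rho>' \<sigma>' X \<le> qfun t \<rho> \<sigma> Y"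
      using le[OF \<open>0 \<le> t\<close> X(1)] by blast
    show ?thesis using F(3) that X(2) Y by fastforce
  qed
  have "F' T \<le> F T" if "0 \<le> T" for T
  proof -
    have "(\<lambda>t. F t - F' t) 0 \<le> (\<lambda>t. F t - F' t) T"
    proof (rule DERIV_nonneg_imp_nondecreasing[OF that])
      fix t assume "0 \<le> t" "t \<le> T"
      then show "\<exists>y. ((\<lambda>t. F t - F' t) has_real_derivative y) (at t) \<and> 0 \<le> y"
        using DERIV_diff[OF F(2)[rule_format] F'(2)[rule_format]] QQ by (intro exI[of _ "Q t - Q' t"]) auto
    qed
    then show ?thesis using F(1) F'(1) by simp
  qed
  then have "\<forall>\<^sub>F T in at_top. F' T - Re (mat_trace \<rho>') * ln T \<le> F T - Re (mat_trace \<rho>) * ln T"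
    unfolding tr by (intro eventually_mono[OF eventually_ge_at_top[of 0]]) auto
  then show ?thesis
    using tendsto_le[OF _ F(4) F'(4)] by simp
qed

section \<open>Positive perturbations of the second argument; nonnegativity\<close>

lemma hermitian_index:
  fixes M :: "complex mat"
  assumes "mat_adjoint M = M" "M \<in> carrier_mat d d" "i < d" "j < d"
  shows "cnj (M $$ (j, i)) = M $$ (i, j)"
  using mat_adjoint_index[of i M j] assms by auto

lemma psd_mat_add:
  "psd_mat d A \<Longrightarrow> psd_mat d B \<Longrightarrow> psd_mat d (A + B)"
proof -
  assume AB: "psd_mat d A" "psd_mat d B"
  have "mat_adjoint (A + B) = A + B"
  proof (rule eq_matI)
    fix i j assume "i < dim_row (A + B)" "j < dim_col (A + B)"
    with AB have "i < d" "j < d" by (auto simp: psd_mat_iff)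
    then show "mat_adjoint (A + B) $$ (i, j) = (A + B) $$ (i, j)"
      using AB by (auto simp: psd_mat_iff hermitian_index[of _ d])
  qed (use AB in \<open>auto simp: psd_mat_iff\<close>)
  then show ?thesis using AB by (auto simp: psd_mat_iff sform_add)
qed

lemma dominated_trans_le:
  assumes "dominated d \<rho> \<sigma>" "psd_mat d \<sigma>" "psd_mat d \<Delta>"
  shows "dominated d \<rho> (\<sigma> + \<Delta>)"
  unfolding dominated_def
proof (intro allI impI)
  fix x assume "Re (sform d (\<sigma> + \<Delta>) x x) = 0"
  then have "Re (sform d \<sigma> x x) = 0"
    using assms(2,3) by (simp add: psd_mat_iff sform_add add_nonneg_eq_0_iff)
  then show "Re (sform d \<rho> x x) = 0" using assms(1) by (simp add: dominated_def)
qed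

lemma mat_trace_add:
  "A \<in> carrier_mat d d \<Longrightarrow> B \<in> carrier_mat d d \<Longrightarrow> mat_trace (A + B) = mat_trace A + mat_trace B"
  by (simp add: mat_trace_def sum.distrib)

text \<open>The same test matrix works on both sides: adding \<Delta> to \<sigma> changes the
  functional by minus the trace of X^H \<Delta> X, which is nonnegative. Operator monotonicity of
  the logarithm is not invoked.\<close>

lemma rel_ent_antimono:
  assumes \<rho>: "psd_mat d \<rho>" and \<sigma>: "psd_mat d \<sigma>" and \<Delta>: "psd_mat d \<Delta>" and dominated: "dominated d \<rho> \<sigma>"
  shows "rel_ent \<rho> (\<sigma> + \<Delta>) \<le> rel_ent \<rho> \<sigma>"
proof (rule rel_ent_mono[OF \<rho> \<sigma> dominated \<rho> psd_mat_add[OF \<sigma> \<Delta>] dominated_trans_le[OF dominated \<sigma> \<Delta>] refl])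
  fix t :: real and X :: "complex mat" assume X: "X \<in> carrier_mat d d"
  note c = psd_mat_carrier[OF \<rho>] psd_mat_carrier[OF \<sigma>] psd_mat_carrier[OF \<Delta>]
  have "mat_trace ((X * mat_adjoint X) * \<Delta>) = mat_trace (X * (mat_adjoint X * \<Delta>))"
    using X c by (simp add: assoc_mult_square[where d = d])
  also have "\<dots> = mat_trace (mat_adjoint X * \<Delta> * X)"
    using X c by (intro mat_trace_comm[of _ d d]) auto
  finally have "0 \<le> Re (mat_trace ((X * mat_adjoint X) * \<Delta>))"
    using psd_mat_trace_nonneg[OF psd_mat_conj[OF \<Delta> X]] by simp
  moreover have "mat_trace ((X * mat_adjoint X) * (\<sigma> + \<Delta>)) =
      mat_trace ((X * mat_adjoint X) * \<sigma>) + mat_trace ((X * mat_adjoint X) * \<Delta>)"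
    using X c by (simp add: mult_add_distrib_mat[of _ d d _ d] mat_trace_add[of _ d])
  ultimately show "\<exists>Y \<in> carrier_mat d d. qfun t \<rho> (\<sigma> + \<Delta>) X \<le> qfun t \<rho> \<sigma> Y"
    using X by (intro bexI[of _ X]) (auto simp: qfun_def)
qed

text \<open>Klein's inequality: e (ln e - ln f) \<ge> e - f for each pair of eigenvalues, weighted
  with the squared overlaps. The right sides add up to the difference of the traces.\<close>

lemma rel_ent_nonneg:
  assumes \<rho>: "psd_mat d \<rho>" and \<sigma>: "psd_mat d \<sigma>" and dominated: "dominated d \<rho> \<sigma>"
    and tr: "Re (mat_trace \<sigma>) \<le> Re (mat_trace \<rho>)"
  shows "0 \<le> rel_ent \<rho> \<sigma>"
proof -
  obtain U e where U: "unitary_mat d U" and \<rho>: "\<rho> = spectral d U e" and e: "\<And>i. 0 \<le> e i"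
    using psd_spectral_exists[OF \<rho>] by blast
  obtain V f where V: "unitary_mat d V" and \<sigma>: "\<sigma> = spectral d V f" and f: "\<And>i. 0 \<le> f i"
    using psd_spectral_exists[OF \<sigma>] by blast
  define W where "W = mat_adjoint V * U"
  have Wu: "unitary_mat d W" unfolding W_def by (intro unitary_mat_mult unitary_mat_adjoint U V)
  have "(\<Sum>i<d. e i) = (\<Sum>i<d. (\<Sum>j<d. (cmod (W $$ (j, i)))\<^sup>2) * e i)"
    by (intro sum.cong) (auto simp: unitary_mat_col_norm[OF Wu])
  also have "\<dots> = (\<Sum>j<d. \<Sum>i<d. (cmod (W $$ (j, i)))\<^sup>2 * e i)"
    unfolding sum_distrib_right by (rule sum.swap)
  finally have 1: "(\<Sum>i<d. e i) = (\<Sum>j<d. \<Sum>i<d. (cmod (W $$ (j, i)))\<^sup>2 * e i)" .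
  have "(\<Sum>j<d. f j) = (\<Sum>j<d. (\<Sum>i<d. (cmod (W $$ (j, i)))\<^sup>2) * f j)"
    by (intro sum.cong) (auto simp: unitary_mat_row_norm[OF Wu])
  also have "\<dots> = (\<Sum>j<d. \<Sum>i<d. (cmod (W $$ (j, i)))\<^sup>2 * f j)"
    unfolding sum_distrib_right ..
  finally have "(\<Sum>i<d. e i) - (\<Sum>j<d. f j) = (\<Sum>j<d. \<Sum>i<d. (cmod (W $$ (j, i)))\<^sup>2 * (e i - f j))"
    unfolding 1 by (simp add: sum_subtractf right_diff_distrib)
  also have "\<dots> \<le> (\<Sum>j<d. \<Sum>i<d. (cmod (W $$ (j, i)))\<^sup>2 * e i * (ln (e i) - ln (f j)))"
  proof (intro sum_mono)
    fix j i assume "j \<in> {..<d}" "i \<in> {..<d}"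
    then have "f j = 0 \<longrightarrow> e i = 0 \<or> W $$ (j, i) = 0"
      using dominated dominated_spectral_iff[OF U V, of e f] e f unfolding \<rho> \<sigma> W_def by blast
    then consider "W $$ (j, i) = 0" | "e i = 0" | "0 < e i" "0 < f j"
      using e[of i] f[of j] by (auto simp: less_le)
    then show "(cmod (W $$ (j, i)))\<^sup>2 * (e i - f j) \<le> (cmod (W $$ (j, i)))\<^sup>2 * e i * (ln (e i) - ln (f j))"
    proof cases
      case 3
      then have "ln (f j / e i) \<le> f j / e i - 1" by (intro ln_le_minus_one) auto
      then have "e i * (ln (f j) - ln (e i)) \<le> f j - e i"
        using 3 by (simp add: ln_div field_simps)
      then have "e i - f j \<le> e i * (ln (e i) - ln (f j))" by (simp add: algebra_simps)
      then show ?thesis unfolding mult.assoc by (intro mult_left_mono) auto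
    qed (use f[of j] in \<open>auto simp: mult_nonneg_nonneg\<close>)
  qed
  also have "\<dots> = rel_ent \<rho> \<sigma>"
    using rel_ent_overlap[OF U V, of e f] e f unfolding \<rho> \<sigma> W_def by simp
  finally show ?thesis using tr unfolding \<rho> \<sigma> mat_trace_spectral[OF U] mat_trace_spectral[OF V] by linarith
qed

section \<open>Tensor products and partial traces\<close>

text \<open>The pair (i, k) of basis labels has index \<open>i * b + k\<close>, so a sum over the
  product basis is a double sum.\<close>

lemma sum_prod_index:
  fixes g :: "nat \<Rightarrow> 'a :: comm_monoid_add"
  shows "(\<Sum>i<a * b. g i) = (\<Sum>i<a. \<Sum>k<b. g (i * b + k))"
proof -
  have "(\<Sum>i<a * b. g i) = (\<Sum>i<a. \<Sum>k\<in>{i * b..<i * b + b}. g k)"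
    by (rule sum.nat_group[symmetric])
  also have "\<dots> = (\<Sum>i<a. \<Sum>k<b. g (i * b + k))"
    by (rule sum.cong[OF refl], subst sum.atLeastLessThan_shift_0) (simp add: lessThan_atLeast0)
  finally show ?thesis .
qed

lemma prod_index_less: "i < a \<Longrightarrow> k < b \<Longrightarrow> i * b + k < a * (b :: nat)"
proof -
  assume "i < a" "k < b"
  then have "i * b + k < Suc i * b" by simp
  also have "\<dots> \<le> a * b" using \<open>i < a\<close> by (intro mult_right_mono) auto
  finally show ?thesis .
qed

lemma div_less_prod_index: "i < a * b \<Longrightarrow> i div b < (a :: nat)"
  by (simp add: less_mult_imp_div_less)

lemma mod_less_prod_index: "i < a * b \<Longrightarrow> i mod b < (b :: nat)"
  by (cases b) auto

lemma eq_mat_prodI: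
  assumes "A \<in> carrier_mat (a * b) (a * b)" "B \<in> carrier_mat (a * b) (a * b)"
    and "\<And>i k j l. i < a \<Longrightarrow> k < b \<Longrightarrow> j < a \<Longrightarrow> l < b \<Longrightarrow> A $$ (i * b + k, j * b + l) = B $$ (i * b + k, j * b + l)"
  shows "A = B"
proof (rule eq_matI)
  fix i j assume "i < dim_row B" "j < dim_col B"
  then have ij: "i < a * b" "j < a * b" using assms(2) by auto
  then show "A $$ (i, j) = B $$ (i, j)"
    using assms(3)[of "i div b" "i mod b" "j div b" "j mod b"]
    by (simp add: div_less_prod_index mod_less_prod_index)
qed (use assms in auto)

lemma kron_carrier [simp]:
  "A \<in> carrier_mat a a \<Longrightarrow> B \<in> carrier_mat b b \<Longrightarrow> kron A B \<in> carrier_mat (a * b) (a * b)"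
  by (auto simp: kron_def)

lemma kron_index:
  assumes "A \<in> carrier_mat a a" "B \<in> carrier_mat b b" "i < a" "k < b" "j < a" "l < b"
  shows "kron A B $$ (i * b + k, j * b + l) = A $$ (i, j) * B $$ (k, l)"
  using assms prod_index_less[of i a k b] prod_index_less[of j a l b] by (auto simp: kron_def)

lemma kron_mult:
  assumes "A \<in> carrier_mat a a" "B \<in> carrier_mat b b" "C \<in> carrier_mat a a" "D \<in> carrier_mat b b"
  shows "kron A B * kron C D = kron (A * C) (B * D)"
proof (rule eq_mat_prodI[of _ a b])
  fix i k j l assume ij: "i < a" "k < b" "j < a" "l < b"
  have "(kron A B * kron C D) $$ (i * b + k, j * b + l) =
      (\<Sum>m<a * b. kron A B $$ (i * b + k, m) * kron C D $$ (m, j * b + l))"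
    using assms ij by (intro mult_mat_index[of _ "a * b" _ _ "a * b"]) (auto intro: prod_index_less)
  also have "\<dots> = (\<Sum>m<a. \<Sum>n<b. (A $$ (i, m) * C $$ (m, j)) * (B $$ (k, n) * D $$ (n, l)))"
    unfolding sum_prod_index by (intro sum.cong refl) (use assms ij in \<open>auto simp: kron_index\<close>)
  also have "\<dots> = (A * C) $$ (i, j) * (B * D) $$ (k, l)"
    using assms ij by (simp add: mult_mat_index[of _ a a _ a] mult_mat_index[of _ b b _ b] sum_product del: index_mult_mat)
  also have "\<dots> = kron (A * C) (B * D) $$ (i * b + k, j * b + l)"
    using assms ij by (intro kron_index[symmetric]) auto
  finally show "(kron A B * kron C D) $$ (i * b + k, j * b + l) = kron (A * C) (B * D) $$ (i * b + k, j * b + l)" .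
qed (use assms in auto)

lemma kron_adjoint:
  assumes "A \<in> carrier_mat a a" "B \<in> carrier_mat b b"
  shows "mat_adjoint (kron A B) = kron (mat_adjoint A) (mat_adjoint B)"
proof (rule eq_mat_prodI[of _ a b])
  fix i k j l assume ij: "i < a" "k < b" "j < a" "l < b"
  have "mat_adjoint (kron A B) $$ (i * b + k, j * b + l) = cnj (kron A B $$ (j * b + l, i * b + k))"
    using carrier_matD[OF kron_carrier[OF assms]] ij by (intro mat_adjoint_index) (auto intro: prod_index_less)
  then show "mat_adjoint (kron A B) $$ (i * b + k, j * b + l) = kron (mat_adjoint A) (mat_adjoint B) $$ (i * b + k, j * b + l)"
    using assms ij by (simp add: kron_index[of _ a _ b])
qed (use assms in auto)

lemma kron_mat_diag:
  "kron (mat_diag a f) (mat_diag b g) = mat_diag (a * b) (\<lambda>i. f (i div b) * (g (i mod b) :: complex))"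
proof (rule eq_mat_prodI[of _ a b])
  fix i k j l assume ij: "i < a" "k < b" "j < a" "l < b"
  have "i * b + k = j * b + l \<longleftrightarrow> i = j \<and> k = l"
  proof
    assume "i * b + k = j * b + l"
    then have "(i * b + k) div b = (j * b + l) div b" "(i * b + k) mod b = (j * b + l) mod b" by auto
    then show "i = j \<and> k = l" using ij by simp
  qed simp
  then show "kron (mat_diag a f) (mat_diag b g) $$ (i * b + k, j * b + l) =
      mat_diag (a * b) (\<lambda>i. f (i div b) * g (i mod b)) $$ (i * b + k, j * b + l)"
    using ij prod_index_less[of i a k b] prod_index_less[of j a l b]
    by (subst kron_index[of _ a _ b]) (auto simp: mat_diag_def)
qed auto

lemma kron_one: "kron (1\<^sub>m a) (1\<^sub>m b) = (1\<^sub>m (a * b) :: complex mat)"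
  using kron_mat_diag[of a "\<lambda>_. 1" b "\<lambda>_. 1"] by simp

lemma unitary_mat_kron:
  assumes "unitary_mat a U" "unitary_mat b V"
  shows "unitary_mat (a * b) (kron U V)"
  using assms unfolding unitary_mat_def
  by (simp add: kron_adjoint[of _ a _ b] kron_mult[of _ a _ b] kron_one)

lemma kron_spectral:
  assumes "U \<in> carrier_mat a a" "V \<in> carrier_mat b b"
  shows "kron (spectral a U e) (spectral b V f) = spectral (a * b) (kron U V) (\<lambda>i. e (i div b) * f (i mod b))"
proof -
  have "kron (spectral a U e) (spectral b V f) =
      kron U V * kron (mat_diag a (\<lambda>i. complex_of_real (e i))) (mat_diag b (\<lambda>i. complex_of_real (f i))) * kron (mat_adjoint U) (mat_adjoint V)"
    unfolding spectral_def using assms by (simp add: kron_mult[of _ a _ b])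
  then show ?thesis
    unfolding spectral_def using assms by (simp add: kron_mat_diag kron_adjoint[of _ a _ b])
qed

lemma psd_mat_kron:
  assumes "psd_mat a A" "psd_mat b B"
  shows "psd_mat (a * b) (kron A B)"
proof -
  obtain U e where U: "unitary_mat a U" and A: "A = spectral a U e" and e: "\<And>i. 0 \<le> e i"
    using psd_spectral_exists[OF assms(1)] by blast
  obtain V f where V: "unitary_mat b V" and B: "B = spectral b V f" and f: "\<And>i. 0 \<le> f i"
    using psd_spectral_exists[OF assms(2)] by blast
  show ?thesis
    unfolding A B using U V e f by (subst kron_spectral) (auto intro!: psd_spectral)
qed

lemma mat_trace_kron:
  assumes "A \<in> carrier_mat a a" "B \<in> carrier_mat b b"
  shows "mat_trace (kron A B) = mat_trace A * mat_trace B"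
proof -
  have "mat_trace (kron A B) = (\<Sum>i<a. \<Sum>k<b. kron A B $$ (i * b + k, i * b + k))"
    using carrier_matD[OF kron_carrier[OF assms]] by (simp add: mat_trace_def sum_prod_index)
  also have "\<dots> = (\<Sum>i<a. \<Sum>k<b. A $$ (i, i) * B $$ (k, k))"
    by (intro sum.cong refl) (use assms in \<open>auto simp: kron_index\<close>)
  finally show ?thesis using assms by (simp add: mat_trace_def sum_product)
qed

section \<open>Partial traces and data processing\<close>

lemma partial_trace_carrier [simp]: "partial_trace_snd a b M \<in> carrier_mat a a"
  by (simp add: partial_trace_snd_def)

lemma partial_trace_dim [simp]:
  "dim_row (partial_trace_snd a b M) = a" "dim_col (partial_trace_snd a b M) = a"
  by (simp_all add: partial_trace_snd_def)

lemma partial_trace_index: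
  "i < a \<Longrightarrow> j < a \<Longrightarrow> partial_trace_snd a b M $$ (i, j) = (\<Sum>k<b. M $$ (i * b + k, j * b + k))"
  by (simp add: partial_trace_snd_def)

lemma partial_trace_kron:
  assumes "A \<in> carrier_mat a a" "B \<in> carrier_mat b b"
  shows "partial_trace_snd a b (kron A B) = mat_trace B \<cdot>\<^sub>m A"
  by (rule eq_matI)
     (use assms in \<open>auto simp: partial_trace_index kron_index mat_trace_def sum_distrib_left mult.commute\<close>)

lemma partial_trace_add:
  assumes "M \<in> carrier_mat (a * b) (a * b)" "N \<in> carrier_mat (a * b) (a * b)"
  shows "partial_trace_snd a b (M + N) = partial_trace_snd a b M + partial_trace_snd a b N"
  by (rule eq_matI) (use assms in \<open>auto simp: partial_trace_index prod_index_less sum.distrib\<close>)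

lemma mat_trace_partial_trace:
  assumes "M \<in> carrier_mat (a * b) (a * b)"
  shows "mat_trace (partial_trace_snd a b M) = mat_trace M"
  using assms by (simp add: mat_trace_def sum_prod_index partial_trace_snd_def)

text \<open>The partial trace is dual to the embedding of X as X tensor 1. This is what lets a test
  matrix for the marginals be used for the joint states.\<close>

lemma mat_trace_kron_one_mult:
  assumes X: "X \<in> carrier_mat a a" and M: "M \<in> carrier_mat (a * b) (a * b)"
  shows "mat_trace (kron X (1\<^sub>m b) * M) = mat_trace (X * partial_trace_snd a b M)"
proof -
  have "mat_trace (kron X (1\<^sub>m b) * M) =
      (\<Sum>i<a * b. \<Sum>j<a * b. kron X (1\<^sub>m b) $$ (i, j) * M $$ (j, i))"
    using assms by (intro mat_trace_mult) auto
  also have "\<dots> = (\<Sum>i<a. \<Sum>k<b. \<Sum>j<a. X $$ (i, j) * M $$ (j * b + k, i * b + k))"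
    unfolding sum_prod_index
  proof (intro sum.cong refl)
    fix i k j assume "i \<in> {..<a}" "k \<in> {..<b}" "j \<in> {..<a}"
    then have ij: "i < a" "k < b" "j < a" by auto
    have "(\<Sum>l<b. kron X (1\<^sub>m b) $$ (i * b + k, j * b + l) * M $$ (j * b + l, i * b + k)) =
        (\<Sum>l<b. if l = k then X $$ (i, j) * M $$ (j * b + l, i * b + k) else 0)"
      using X ij by (intro sum.cong) (auto simp: kron_index[of _ a _ b])
    then show "(\<Sum>l<b. kron X (1\<^sub>m b) $$ (i * b + k, j * b + l) * M $$ (j * b + l, i * b + k)) =
        X $$ (i, j) * M $$ (j * b + k, i * b + k)" using ij by simp
  qed
  also have "\<dots> = (\<Sum>i<a. \<Sum>j<a. X $$ (i, j) * partial_trace_snd a b M $$ (j, i))"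
    by (rule sum.cong[OF refl], subst sum.swap) (auto simp: partial_trace_index sum_distrib_left)
  also have "\<dots> = mat_trace (X * partial_trace_snd a b M)"
    using X by (intro mat_trace_mult[symmetric]) auto
  finally show ?thesis .
qed

text \<open>The vector x tensor e_k, in index form.\<close>

definition slice :: "nat \<Rightarrow> (nat \<Rightarrow> complex) \<Rightarrow> nat \<Rightarrow> nat \<Rightarrow> complex" where
  "slice b x k i = (if i mod b = k then x (i div b) else 0)"

text \<open>The form of the marginal is a sum of values of the form of \<open>M\<close>. Positivity
  of marginals, and inclusion of their supports, follow term by term.\<close>

lemma sform_partial_trace:
  "sform a (partial_trace_snd a b M) x y = (\<Sum>k<b. sform (a * b) M (slice b x k) (slice b y k))"
proof -
  have app: "app (a * b) M (slice b x k) i = (\<Sum>j<a. M $$ (i, j * b + k) * x j)" if "k < b" for k i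
  proof -
    have "(\<Sum>l<b. M $$ (i, j * b + l) * slice b x k (j * b + l)) = (\<Sum>l<b. if l = k then M $$ (i, j * b + l) * x j else 0)" for j
      by (intro sum.cong) (auto simp: slice_def)
    then show ?thesis using that unfolding app_def sum_prod_index by simp
  qed
  have "sform (a * b) M (slice b x k) (slice b y k) = (\<Sum>i<a. cnj (y i) * (\<Sum>j<a. M $$ (i * b + k, j * b + k) * x j))"
    if "k < b" for k
  proof -
    have "(\<Sum>l<b. cnj (slice b y k (i * b + l)) * app (a * b) M (slice b x k) (i * b + l)) =
        (\<Sum>l<b. if l = k then cnj (y i) * app (a * b) M (slice b x k) (i * b + l) else 0)" for i
      by (intro sum.cong) (auto simp: slice_def)
    then show ?thesis using that unfolding sform_def sum_prod_index by (simp add: app)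
  qed
  then have "(\<Sum>k<b. sform (a * b) M (slice b x k) (slice b y k)) =
      (\<Sum>k<b. \<Sum>i<a. cnj (y i) * (\<Sum>j<a. M $$ (i * b + k, j * b + k) * x j))" by simp
  also have "\<dots> = (\<Sum>i<a. cnj (y i) * (\<Sum>j<a. (\<Sum>k<b. M $$ (i * b + k, j * b + k)) * x j))"
    unfolding sum_distrib_left sum_distrib_right
    by (subst sum.swap, rule sum.cong[OF refl], subst sum.swap) simp
  also have "\<dots> = sform a (partial_trace_snd a b M) x y"
    unfolding sform_def app_def by (intro sum.cong refl arg_cong2[where f = "(*)"]) (auto simp: partial_trace_index)
  finally show ?thesis ..
qed

lemma psd_partial_trace:
  assumes "psd_mat (a * b) M"
  shows "psd_mat a (partial_trace_snd a b M)"
proof -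
  have "mat_adjoint (partial_trace_snd a b M) = partial_trace_snd a b M"
  proof (rule eq_matI)
    fix i j assume "i < dim_row (partial_trace_snd a b M)" "j < dim_col (partial_trace_snd a b M)"
    then have ij: "i < a" "j < a" by (auto simp: partial_trace_snd_def)
    then have "mat_adjoint (partial_trace_snd a b M) $$ (i, j) = (\<Sum>k<b. cnj (M $$ (j * b + k, i * b + k)))"
      by (subst mat_adjoint_index) (auto simp: partial_trace_snd_def)
    also have "\<dots> = partial_trace_snd a b M $$ (i, j)"
      unfolding partial_trace_index[OF ij] using assms ij
      by (intro sum.cong refl) (auto simp: psd_mat_iff hermitian_index[of M "a * b"] prod_index_less)
    finally show "mat_adjoint (partial_trace_snd a b M) $$ (i, j) = partial_trace_snd a b M $$ (i, j)" .
  qed (auto simp: partial_trace_snd_def)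
  then show ?thesis
    using assms by (auto simp: psd_mat_iff sform_partial_trace intro!: sum_nonneg)
qed

lemma dominated_partial_trace:
  assumes "dominated (a * b) \<rho> \<sigma>" "psd_mat (a * b) \<sigma>"
  shows "dominated a (partial_trace_snd a b \<rho>) (partial_trace_snd a b \<sigma>)"
  unfolding dominated_def
proof (intro allI impI)
  fix x assume "Re (sform a (partial_trace_snd a b \<sigma>) x x) = 0"
  then have "(\<Sum>k<b. Re (sform (a * b) \<sigma> (slice b x k) (slice b x k))) = 0"
    by (simp add: sform_partial_trace)
  then have "\<forall>k\<in>{..<b}. Re (sform (a * b) \<sigma> (slice b x k) (slice b x k)) = 0"
    using assms(2) by (subst (asm) sum_nonneg_eq_0_iff) (auto simp: psd_mat_iff)
  then have "\<forall>k\<in>{..<b}. Re (sform (a * b) \<rho> (slice b x k) (slice b x k)) = 0"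
    using assms(1) by (auto simp: dominated_def)
  then show "Re (sform a (partial_trace_snd a b \<rho>) x x) = 0"
    by (simp add: sform_partial_trace)
qed

text \<open>Tensoring with 1 respects products and adjoints, so by duality each of the three traces
  in \<open>qfun\<close> takes the same value for the marginals at \<open>X\<close> as for the joint
  states at X tensor 1.\<close>

theorem rel_ent_partial_trace_le:
  assumes \<rho>: "psd_mat (a * b) \<rho>" and \<sigma>: "psd_mat (a * b) \<sigma>" and dominated: "dominated (a * b) \<rho> \<sigma>"
  shows "rel_ent (partial_trace_snd a b \<rho>) (partial_trace_snd a b \<sigma>) \<le> rel_ent \<rho> \<sigma>"
proof (rule rel_ent_mono[OF \<rho> \<sigma> dominated psd_partial_trace[OF \<rho>] psd_partial_trace[OF \<sigma>] dominated_partial_trace[OF dominated \<sigma>]])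
  note c = psd_mat_carrier[OF \<rho>] psd_mat_carrier[OF \<sigma>]
  show "Re (mat_trace (partial_trace_snd a b \<rho>)) = Re (mat_trace \<rho>)"
    using c by (simp add: mat_trace_partial_trace)
  fix t :: real and X :: "complex mat" assume X: "X \<in> carrier_mat a a"
  have one: "mat_adjoint (1\<^sub>m b) = (1\<^sub>m b :: complex mat)" by (rule eq_matI) auto
  have "mat_adjoint (kron X (1\<^sub>m b)) = kron (mat_adjoint X) (1\<^sub>m b)"
    using X by (simp add: kron_adjoint[of _ a _ b] one)
  then have "qfun t (partial_trace_snd a b \<rho>) (partial_trace_snd a b \<sigma>) X = qfun t \<rho> \<sigma> (kron X (1\<^sub>m b))"
    unfolding qfun_def using X c by (simp add: kron_mult[of _ a _ b] mat_trace_kron_one_mult[of _ a _ b])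
  then show "\<exists>Y \<in> carrier_mat (a * b) (a * b). qfun t (partial_trace_snd a b \<rho>) (partial_trace_snd a b \<sigma>) X \<le> qfun t \<rho> \<sigma> Y"
    using X by (intro bexI[of _ "kron X (1\<^sub>m b)"]) auto
qed

section \<open>Additivity on product states\<close>

lemma sum4_product:
  fixes p q :: "nat \<Rightarrow> nat \<Rightarrow> real"
  shows "(\<Sum>j<a. \<Sum>j'<b. \<Sum>i<a. \<Sum>i'<b. p j i * q j' i') = (\<Sum>j<a. \<Sum>i<a. p j i) * (\<Sum>j<b. \<Sum>i<b. q j i)"
proof -
  have "(\<Sum>j<a. \<Sum>j'<b. \<Sum>i<a. \<Sum>i'<b. p j i * q j' i') = (\<Sum>j<a. \<Sum>j'<b. (\<Sum>i<a. p j i) * (\<Sum>i'<b. q j' i'))"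
    by (simp add: sum_product)
  then show ?thesis by (simp add: sum_product)
qed

text \<open>Overlaps and eigenvalues of the product are products, so the logarithm of each term
  splits into two summands; in each the weights of the other factor add up to its trace, which is
  1.\<close>

lemma rel_ent_kron:
  assumes "psd_mat a \<rho>" "psd_mat a \<sigma>" "dominated a \<rho> \<sigma>" "psd_mat b \<rho>'" "psd_mat b \<sigma>'" "dominated b \<rho>' \<sigma>'"
    and tr: "Re (mat_trace \<rho>) = 1" "Re (mat_trace \<rho>') = 1"
  shows "rel_ent (kron \<rho> \<rho>') (kron \<sigma> \<sigma>') = rel_ent \<rho> \<sigma> + rel_ent \<rho>' \<sigma>'"
proof -
  obtain U e where U: "unitary_mat a U" and \<rho>: "\<rho> = spectral a U e" and e: "\<And>i. 0 \<le> e i"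
    using psd_spectral_exists[OF assms(1)] by blast
  obtain V f where V: "unitary_mat a V" and \<sigma>: "\<sigma> = spectral a V f" and f: "\<And>i. 0 \<le> f i"
    using psd_spectral_exists[OF assms(2)] by blast
  obtain U' e' where U': "unitary_mat b U'" and \<rho>': "\<rho>' = spectral b U' e'" and e': "\<And>i. 0 \<le> e' i"
    using psd_spectral_exists[OF assms(4)] by blast
  obtain V' f' where V': "unitary_mat b V'" and \<sigma>': "\<sigma>' = spectral b V' f'" and f': "\<And>i. 0 \<le> f' i"
    using psd_spectral_exists[OF assms(5)] by blast
  note c = unitary_mat_carrier[OF U] unitary_mat_carrier[OF V] unitary_mat_carrier[OF U'] unitary_mat_carrier[OF V']
  define W where "W = mat_adjoint V * U"
  define W' where "W' = mat_adjoint V' * U'"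
  have Wu: "unitary_mat a W" "unitary_mat b W'"
    unfolding W_def W'_def by (intro unitary_mat_mult unitary_mat_adjoint U V U' V')+
  have W0: "W $$ (j, i) = 0 \<or> e i = 0 \<or> (e i > 0 \<and> f j > 0)" if "j < a" "i < a" for j i
    using assms(3) dominated_spectral_iff[OF U V, of e f] e f that unfolding \<rho> \<sigma> W_def by (metis less_le)
  have W0': "W' $$ (j, i) = 0 \<or> e' i = 0 \<or> (e' i > 0 \<and> f' j > 0)" if "j < b" "i < b" for j i
    using assms(6) dominated_spectral_iff[OF U' V', of e' f'] e' f' that unfolding \<rho>' \<sigma>' W'_def by (metis less_le)
  define w where "w j i = (cmod (W $$ (j, i)))\<^sup>2 * e i" for j i
  define w' where "w' j i = (cmod (W' $$ (j, i)))\<^sup>2 * e' i" for j i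
  have D: "rel_ent \<rho> \<sigma> = (\<Sum>j<a. \<Sum>i<a. w j i * (ln (e i) - ln (f j)))"
    unfolding \<rho> \<sigma> w_def W_def by (rule rel_ent_overlap[OF U V]) (use e f in auto)
  have D': "rel_ent \<rho>' \<sigma>' = (\<Sum>j<b. \<Sum>i<b. w' j i * (ln (e' i) - ln (f' j)))"
    unfolding \<rho>' \<sigma>' w'_def W'_def by (rule rel_ent_overlap[OF U' V']) (use e' f' in auto)
  have T: "(\<Sum>j<a. \<Sum>i<a. w j i) = 1"
  proof -
    have "(\<Sum>j<a. \<Sum>i<a. w j i) = (\<Sum>i<a. (\<Sum>j<a. (cmod (W $$ (j, i)))\<^sup>2) * e i)"
      unfolding w_def sum_distrib_right by (rule sum.swap)
    also have "\<dots> = (\<Sum>i<a. e i)" by (intro sum.cong) (auto simp: unitary_mat_col_norm[OF Wu(1)])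
    finally show ?thesis using tr(1) unfolding \<rho> mat_trace_spectral[OF U] by simp
  qed
  have T': "(\<Sum>j<b. \<Sum>i<b. w' j i) = 1"
  proof -
    have "(\<Sum>j<b. \<Sum>i<b. w' j i) = (\<Sum>i<b. (\<Sum>j<b. (cmod (W' $$ (j, i)))\<^sup>2) * e' i)"
      unfolding w'_def sum_distrib_right by (rule sum.swap)
    also have "\<dots> = (\<Sum>i<b. e' i)" by (intro sum.cong) (auto simp: unitary_mat_col_norm[OF Wu(2)])
    finally show ?thesis using tr(2) unfolding \<rho>' mat_trace_spectral[OF U'] by simp
  qed
  have WW: "mat_adjoint (kron V V') * kron U U' = kron W W'"
    unfolding W_def W'_def using c by (simp add: kron_adjoint[of _ a _ b] kron_mult[of _ a _ b])
  have "rel_ent (kron \<rho> \<rho>') (kron \<sigma> \<sigma>') =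
      (\<Sum>j<a * b. \<Sum>i<a * b. (cmod (kron W W' $$ (j, i)))\<^sup>2 * (e (i div b) * e' (i mod b)) *
        (ln (e (i div b) * e' (i mod b)) - ln (f (j div b) * f' (j mod b))))"
    unfolding \<rho> \<sigma> \<rho>' \<sigma>' kron_spectral[OF c(1,3)] kron_spectral[OF c(2,4)] WW[symmetric]
    by (rule rel_ent_overlap[OF unitary_mat_kron[OF U U'] unitary_mat_kron[OF V V']]) (use e e' f f' in auto)
  also have "\<dots> = (\<Sum>j<a. \<Sum>j'<b. \<Sum>i<a. \<Sum>i'<b.
      w j i * (ln (e i) - ln (f j)) * w' j' i' + w j i * (w' j' i' * (ln (e' i') - ln (f' j'))))"
    unfolding sum_prod_index
  proof (intro sum.cong refl)
    fix j j' i i' assume "j \<in> {..<a}" "j' \<in> {..<b}" "i \<in> {..<a}" "i' \<in> {..<b}"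
    then have ij: "j < a" "j' < b" "i < a" "i' < b" by auto
    have idx: "(j * b + j') div b = j" "(j * b + j') mod b = j'" "(i * b + i') div b = i" "(i * b + i') mod b = i'"
      using ij by auto
    have k: "(cmod (kron W W' $$ (j * b + j', i * b + i')))\<^sup>2 * (e i * e' i') = w j i * w' j' i'"
      unfolding w_def w'_def using ij Wu by (simp add: kron_index[of _ a _ b] norm_mult power_mult_distrib)
    \<comment> \<open>The logarithm of a product splits only for positive factors. Support inclusion
      provides this, except in terms whose weight is 0 anyway.\<close>
    consider "w j i = 0 \<or> w' j' i' = 0" | "e i > 0" "f j > 0" "e' i' > 0" "f' j' > 0"
      using W0[OF ij(1,3)] W0'[OF ij(2,4)] by (auto simp: w_def w'_def)
    then show "(cmod (kron W W' $$ (j * b + j', i * b + i')))\<^sup>2 * (e ((i * b + i') div b) * e' ((i * b + i') mod b)) *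
        (ln (e ((i * b + i') div b) * e' ((i * b + i') mod b)) - ln (f ((j * b + j') div b) * f' ((j * b + j') mod b))) =
      w j i * (ln (e i) - ln (f j)) * w' j' i' + w j i * (w' j' i' * (ln (e' i') - ln (f' j')))"
      unfolding idx k by cases (auto simp: ln_mult_pos algebra_simps)
  qed
  also have "\<dots> = rel_ent \<rho> \<sigma> + rel_ent \<rho>' \<sigma>'"
    unfolding sum.distrib
      sum4_product[of "\<lambda>j i. w j i * (ln (e i) - ln (f j))" w' b a]
      sum4_product[of w "\<lambda>j' i'. w' j' i' * (ln (e' i') - ln (f' j'))" b a] D D' T T' by simp
  finally show ?thesis .
qed

lemma dominated_kron:
  assumes "psd_mat a \<rho>" "psd_mat a \<sigma>" "dominated a \<rho> \<sigma>" "psd_mat b \<rho>'" "psd_mat b \<sigma>'" "dominated b \<rho>' \<sigma>'"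
  shows "dominated (a * b) (kron \<rho> \<rho>') (kron \<sigma> \<sigma>')"
proof -
  obtain U e where U: "unitary_mat a U" and \<rho>: "\<rho> = spectral a U e" and e: "\<And>i. 0 \<le> e i"
    using psd_spectral_exists[OF assms(1)] by blast
  obtain V f where V: "unitary_mat a V" and \<sigma>: "\<sigma> = spectral a V f" and f: "\<And>i. 0 \<le> f i"
    using psd_spectral_exists[OF assms(2)] by blast
  obtain U' e' where U': "unitary_mat b U'" and \<rho>': "\<rho>' = spectral b U' e'" and e': "\<And>i. 0 \<le> e' i"
    using psd_spectral_exists[OF assms(4)] by blast
  obtain V' f' where V': "unitary_mat b V'" and \<sigma>': "\<sigma>' = spectral b V' f'" and f': "\<And>i. 0 \<le> f' i"
    using psd_spectral_exists[OF assms(5)] by blast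
  note c = unitary_mat_carrier[OF U] unitary_mat_carrier[OF V] unitary_mat_carrier[OF U'] unitary_mat_carrier[OF V']
  have WW: "mat_adjoint (kron V V') * kron U U' = kron (mat_adjoint V * U) (mat_adjoint V' * U')"
    using c by (simp add: kron_adjoint[of _ a _ b] kron_mult[of _ a _ b])
  have "\<forall>k<a * b. \<forall>l<a * b. f (l div b) * f' (l mod b) = 0 \<longrightarrow> e (k div b) * e' (k mod b) = 0 \<or>
      (mat_adjoint (kron V V') * kron U U') $$ (l, k) = 0"
  proof (intro allI impI)
    fix k l assume kl: "k < a * b" "l < a * b" and z: "f (l div b) * f' (l mod b) = 0"
    note less = div_less_prod_index[OF kl(1)] div_less_prod_index[OF kl(2)]
      mod_less_prod_index[OF kl(1)] mod_less_prod_index[OF kl(2)]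
    have "kron (mat_adjoint V * U) (mat_adjoint V' * U') $$ (l div b * b + l mod b, k div b * b + k mod b) =
        (mat_adjoint V * U) $$ (l div b, k div b) * (mat_adjoint V' * U') $$ (l mod b, k mod b)"
      using c less by (intro kron_index) auto
    moreover have "f (l div b) = 0 \<longrightarrow> e (k div b) = 0 \<or> (mat_adjoint V * U) $$ (l div b, k div b) = 0"
      using assms(3) dominated_spectral_iff[OF U V, of e f] e f less unfolding \<rho> \<sigma> by blast
    moreover have "f' (l mod b) = 0 \<longrightarrow> e' (k mod b) = 0 \<or> (mat_adjoint V' * U') $$ (l mod b, k mod b) = 0"
      using assms(6) dominated_spectral_iff[OF U' V', of e' f'] e' f' less unfolding \<rho>' \<sigma>' by blast
    ultimately show "e (k div b) * e' (k mod b) = 0 \<or> (mat_adjoint (kron V V') * kron U U') $$ (l, k) = 0"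
      using z unfolding WW by (auto simp del: index_mult_mat)
  qed
  then show ?thesis
    unfolding \<rho> \<sigma> \<rho>' \<sigma>' kron_spectral[OF c(1,3)] kron_spectral[OF c(2,4)]
    by (subst dominated_spectral_iff[OF unitary_mat_kron[OF U U'] unitary_mat_kron[OF V V']]) (use e e' f f' in auto)
qed

section \<open>Pinching\<close>

lemma conj_index:
  assumes "A \<in> carrier_mat d d" "M \<in> carrier_mat d d" "B \<in> carrier_mat d d" "x < d" "y < d"
  shows "(mat_adjoint A * M * B) $$ (x, y) = sform d M (\<lambda>j. B $$ (j, y)) (\<lambda>i. A $$ (i, x))"
proof -
  have "(mat_adjoint A * M * B) $$ (x, y) = (mat_adjoint A * (M * B)) $$ (x, y)"
    using assms by (simp add: assoc_mult_square[where d = d])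
  also have "\<dots> = (\<Sum>i<d. cnj (A $$ (i, x)) * (M * B) $$ (i, y))"
    using assms by (subst mult_mat_index[of _ d d _ d]) (auto intro!: sum.cong)
  also have "\<dots> = sform d M (\<lambda>j. B $$ (j, y)) (\<lambda>i. A $$ (i, x))"
    unfolding sform_def app_def using assms
    by (intro sum.cong refl) (subst mult_mat_index[of _ d d _ d], auto)
  finally show ?thesis .
qed

text \<open>For vectors living in blocks, only the entries joining these blocks are seen; a matrix
  may therefore be exchanged for its block diagonal or rescaled version.\<close>

lemma sform_scale_on_support:
  assumes "\<And>i j. i < d \<Longrightarrow> j < d \<Longrightarrow> y i \<noteq> 0 \<Longrightarrow> x j \<noteq> 0 \<Longrightarrow> M $$ (i, j) = \<gamma> * N $$ (i, j)"
  shows "sform d M x y = \<gamma> * sform d N x y"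
  unfolding sform_def app_def sum_distrib_left
proof (intro sum.cong refl)
  fix i j assume "i \<in> {..<d}" "j \<in> {..<d}"
  then show "cnj (y i) * (M $$ (i, j) * x j) = \<gamma> * (cnj (y i) * (N $$ (i, j) * x j))"
    using assms[of i j] by (cases "y i = 0"; cases "x j = 0") auto
qed

lemma sform_sum_left: "sform d M (\<lambda>i. \<Sum>c\<in>C. x c i) y = (\<Sum>c\<in>C. sform d M (x c) y)"
proof -
  have "app d M (\<lambda>i. \<Sum>c\<in>C. x c i) i = (\<Sum>c\<in>C. app d M (x c) i)" for i
    unfolding app_def sum_distrib_left by (rule sum.swap)
  then show ?thesis unfolding sform_def by (simp add: sum_distrib_left sum.swap[of _ C])
qed

lemma sform_sum_right: "sform d M x (\<lambda>i. \<Sum>c\<in>C. y c i) = (\<Sum>c\<in>C. sform d M x (y c))"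
  unfolding sform_def cnj_sum sum_distrib_right by (rule sum.swap)

lemma sform_hermitian:
  assumes "M \<in> carrier_mat d d" "mat_adjoint M = M"
  shows "sform d M y x = cnj (sform d M x y)"
proof -
  have "sform d M y x = (\<Sum>j<d. cnj (app d M x j) * y j)"
    unfolding sform_def using sum_cnj_app[OF assms(1), of x y] assms(2) by simp
  then show ?thesis unfolding sform_def by (simp add: mult.commute)
qed

text \<open>Expand the form at x - y. It is used to bound the off-diagonal blocks of a positive
  matrix by the diagonal ones.\<close>

lemma Re_sform_le:
  assumes "psd_mat d M"
  shows "2 * Re (sform d M x y) \<le> Re (sform d M x x) + Re (sform d M y y)"
proof -
  have "sform d M (\<lambda>i. x i - y i) (\<lambda>i. x i - y i) = sform d M x x - sform d M x y - sform d M y x + sform d M y y"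
    unfolding sform_def app_def by (simp add: algebra_simps sum_subtractf sum.distrib sum_distrib_left)
  moreover have "0 \<le> Re (sform d M (\<lambda>i. x i - y i) (\<lambda>i. x i - y i))"
    using assms by (simp add: psd_mat_iff)
  moreover have "Re (sform d M y x) = Re (sform d M x y)"
    using assms sform_hermitian[of M d y x] by (simp add: psd_mat_iff)
  ultimately show ?thesis by simp
qed

text \<open>No eigenvalue of a positive matrix exceeds the trace.\<close>

lemma psd_sform_le_trace:
  assumes "psd_mat d M"
  shows "Re (sform d M x x) \<le> Re (mat_trace M) * (\<Sum>i<d. (cmod (x i))\<^sup>2)"
proof -
  obtain U e where U: "unitary_mat d U" and M: "M = spectral d U e" and e: "\<And>i. 0 \<le> e i"
    using psd_spectral_exists[OF assms] by blast
  have "complex_of_real (\<Sum>k<d. (cmod (coord d U x k))\<^sup>2) = complex_of_real (\<Sum>i<d. (cmod (x i))\<^sup>2)"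
    using coord_parseval[OF U, of x x] unfolding of_real_sum complex_norm_square .
  then have p: "(\<Sum>k<d. (cmod (coord d U x k))\<^sup>2) = (\<Sum>i<d. (cmod (x i))\<^sup>2)"
    unfolding of_real_eq_iff .
  have "Re (sform d M x x) = (\<Sum>k<d. e k * (cmod (coord d U x k))\<^sup>2)"
    unfolding M sform_spectral_self[OF unitary_mat_carrier[OF U]] by simp
  also have "\<dots> \<le> (\<Sum>k<d. (\<Sum>i<d. e i) * (cmod (coord d U x k))\<^sup>2)"
    using e by (intro sum_mono mult_right_mono) (auto intro: member_le_sum)
  also have "\<dots> = Re (mat_trace M) * (\<Sum>i<d. (cmod (x i))\<^sup>2)"
    unfolding sum_distrib_left[symmetric] p unfolding M mat_trace_spectral[OF U] ..
  finally show ?thesis .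
qed

text \<open>The columns of \<open>V\<close> carry labels \<open>l\<close>, and \<open>U\<close> is an eigenbasis, with eigenvalues \<open>r\<close> and labels \<open>l'\<close>, of the
  pinching of \<open>R\<close> onto the label spaces.\<close>

definition pinching ::
  "nat \<Rightarrow> complex mat \<Rightarrow> complex mat \<Rightarrow> (nat \<Rightarrow> nat) \<Rightarrow> complex mat \<Rightarrow> (nat \<Rightarrow> nat) \<Rightarrow> (nat \<Rightarrow> real) \<Rightarrow> bool"
where
  "pinching d R V l U l' r \<longleftrightarrow> unitary_mat d V \<and> unitary_mat d U \<and>
    (\<forall>i<d. \<forall>x<d. (mat_adjoint V * U) $$ (i, x) \<noteq> 0 \<longrightarrow> l i = l' x) \<and>
    (\<forall>x<d. \<forall>y<d. l' x = l' y \<longrightarrow>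
      (mat_adjoint U * R * U) $$ (x, y) = (if x = y then complex_of_real (r x) else 0)) \<and>
    l' ` {..<d} \<subseteq> l ` {..<d}"

text \<open>Adding \<open>2 l\<close> separates the blocks: the pinching has spectrum in \<open>[0, 1]\<close>, so every eigenvector of the
  shifted matrix lies in a single block.\<close>

lemma pinching_exists:
  assumes V: "unitary_mat d V" and R: "psd_mat d R" and tr: "Re (mat_trace R) \<le> 1"
  shows "\<exists>U l' r. pinching d R V l U l' r"
proof -
  note Vc = unitary_mat_carrier[OF V] and Rc = psd_mat_carrier[OF R]
  define M where "M = mat_adjoint V * R * V"
  have M: "psd_mat d M" unfolding M_def by (rule psd_mat_conj[OF R Vc])
  note Mc = psd_mat_carrier[OF M]
  have trM: "Re (mat_trace M) \<le> 1"
  proof -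
    have "mat_trace M = mat_trace (V * (mat_adjoint V * R))"
      unfolding M_def using Vc Rc by (intro mat_trace_comm[of _ d d]) auto
    also have "\<dots> = mat_trace R" by (simp add: unitary_mat_cancel[OF V Rc])
    finally show ?thesis using tr by simp
  qed
  \<comment> \<open>In the basis \<open>V\<close>, \<open>K\<close> is the block diagonal part of
    the matrix, that is, the pinching itself, and \<open>G\<close> is the shift.\<close>
  define K where "K = mat d d (\<lambda>(i, j). if l i = l j then M $$ (i, j) else 0)"
  define G where "G = mat_diag d (\<lambda>i. 2 * complex_of_real (real (l i)))"
  have KG: "K \<in> carrier_mat d d" "G \<in> carrier_mat d d" by (simp_all add: K_def G_def)
  have "mat_adjoint (K + G) = K + G"
  proof (rule eq_matI)
    fix i j assume "i < dim_row (K + G)" "j < dim_col (K + G)"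
    then have ij: "i < d" "j < d" using KG by auto
    then show "mat_adjoint (K + G) $$ (i, j) = (K + G) $$ (i, j)"
      using KG hermitian_index[of M d i j] M by (auto simp: K_def G_def mat_diag_def psd_mat_iff)
  qed (use KG in auto)
  then obtain Z h where Z: "unitary_mat d Z" and H: "K + G = spectral d Z h"
    using hermitian_spectral[of "K + G" d] KG by auto
  note Zc = unitary_mat_carrier[OF Z]
  have HZ: "app d (K + G) (\<lambda>j. Z $$ (j, y)) i = h y * Z $$ (i, y)" if "i < d" "y < d" for i y
  proof -
    have "app d (K + G) (\<lambda>j. Z $$ (j, y)) i = (spectral d Z h * Z) $$ (i, y)"
      unfolding H using Zc that by (subst mult_mat_index[of _ d d _ d]) (auto simp: app_def)
    also have "spectral d Z h * Z = Z * mat_diag d (\<lambda>i. complex_of_real (h i))"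
      unfolding spectral_def using Zc
      by (simp add: assoc_mult_square[where d = d] unitary_mat_left[OF Z] right_mult_one_mat[of _ d d])
    finally show ?thesis using Zc that by (simp add: mat_diag_mult_right[of Z d d] mult.commute)
  qed
  have appG: "app d G x i = 2 * real (l i) * x i" if "i < d" for x :: "nat \<Rightarrow> complex" and i
    unfolding app_def G_def using that by (subst sum.remove[of _ i]) (auto simp: mat_diag_def)
  have app_add: "app d (K + G) x i = app d K x i + app d G x i" if "i < d" for x i
    unfolding app_def using that KG by (simp add: sum.distrib algebra_simps)
  \<comment> \<open>The part \<open>z\<close> of the eigenvector in the block of \<open>l i\<close>
    is an eigenvector of \<open>K\<close> for the value \<open>h x - 2 * real (l i)\<close>. On this
    block \<open>K\<close> agrees with \<open>M\<close>, whose form lies between 0 and the squared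
    norm.\<close>
  have range: "0 \<le> h x - 2 * real (l i) \<and> h x - 2 * real (l i) \<le> 1"
    if ix: "i < d" "x < d" and nz: "Z $$ (i, x) \<noteq> 0" for i x
  proof -
    define c where "c = l i"
    define z where "z j = (if l j = c then Z $$ (j, x) else 0)" for j
    let ?n = "\<Sum>j<d. (cmod (z j))\<^sup>2"
    have "(cmod (z i))\<^sup>2 > 0" using nz by (simp add: z_def c_def)
    moreover have "(cmod (z i))\<^sup>2 \<le> ?n" using ix by (intro member_le_sum) auto
    ultimately have n: "?n > 0" by linarith
    have "sform d M z z = 1 * sform d K z z"
      by (rule sform_scale_on_support) (auto simp: z_def K_def split: if_splits)
    also have "\<dots> = (\<Sum>j<d. cnj (z j) * app d K (\<lambda>j. Z $$ (j, x)) j)"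
      unfolding sform_def mult_1
    proof (intro sum.cong refl)
      fix j assume "j \<in> {..<d}"
      then have "app d K z j = app d K (\<lambda>j. Z $$ (j, x)) j" if "l j = c"
        unfolding app_def using that by (intro sum.cong) (auto simp: z_def K_def)
      then show "cnj (z j) * app d K z j = cnj (z j) * app d K (\<lambda>j. Z $$ (j, x)) j"
        by (cases "l j = c") (auto simp: z_def)
    qed
    also have "\<dots> = (\<Sum>j<d. complex_of_real ((h x - 2 * real c) * (cmod (z j))\<^sup>2))"
    proof (intro sum.cong refl)
      fix j assume "j \<in> {..<d}"
      then have j: "j < d" by simp
      show "cnj (z j) * app d K (\<lambda>j. Z $$ (j, x)) j = complex_of_real ((h x - 2 * real c) * (cmod (z j))\<^sup>2)"
      proof (cases "l j = c")
        case True
        have "app d K (\<lambda>j. Z $$ (j, x)) j = (h x - 2 * real c) * z j"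
          using app_add[OF j, of "\<lambda>j. Z $$ (j, x)"] HZ[OF j ix(2)] appG[OF j] True
          by (simp add: z_def algebra_simps)
        then show ?thesis unfolding of_real_mult complex_norm_square by simp
      qed (simp add: z_def)
    qed
    finally have "Re (sform d M z z) = (h x - 2 * real c) * ?n"
      by (simp add: sum_distrib_left)
    moreover have "0 \<le> Re (sform d M z z)" using M by (simp add: psd_mat_iff)
    moreover have "Re (sform d M z z) \<le> 1 * ?n"
      using psd_sform_le_trace[OF M, of z] mult_right_mono[OF trM, of ?n] n by linarith
    ultimately show ?thesis using n unfolding c_def[symmetric]
      by (simp add: zero_le_mult_iff mult_le_cancel_right)
  qed
  \<comment> \<open>Any nonzero entry of the column may supply the label, as they all turn out to
    carry the same one.\<close>
  define l' where "l' x = l (SOME i. i < d \<and> Z $$ (i, x) \<noteq> 0)" for x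
  have some: "(SOME i. i < d \<and> Z $$ (i, x) \<noteq> 0) < d \<and> Z $$ (SOME i. i < d \<and> Z $$ (i, x) \<noteq> 0, x) \<noteq> 0" if "x < d" for x
  proof -
    have "\<exists>i. i < d \<and> Z $$ (i, x) \<noteq> 0"
    proof (rule ccontr)
      assume "\<not> ?thesis"
      then have "(\<Sum>i<d. (cmod (Z $$ (i, x)))\<^sup>2) = 0" by (intro sum.neutral) auto
      then show False using unitary_mat_col_norm[OF Z that] by simp
    qed
    then show ?thesis by (rule someI_ex)
  qed
  \<comment> \<open>Two labels c in one column would place \<open>h x\<close> in two of the
    intervals [2 c, 2 c + 1], and these are disjoint for distinct c.\<close>
  have lab: "l i = l' x" if "i < d" "x < d" "Z $$ (i, x) \<noteq> 0" for i x
    using range[OF that] range[of "SOME i. i < d \<and> Z $$ (i, x) \<noteq> 0" x] some[OF that(2)] that(2)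
    unfolding l'_def by linarith
  define U where "U = V * Z"
  have Uu: "unitary_mat d U" unfolding U_def by (rule unitary_mat_mult[OF V Z])
  have VU: "mat_adjoint V * U = Z" unfolding U_def by (rule unitary_mat_cancel[OF V Zc])
  have URU: "mat_adjoint U * R * U = mat_adjoint Z * M * Z"
    unfolding U_def M_def using Vc Zc Rc
    by (simp add: mat_adjoint_mult[of _ d d _ d] assoc_mult_square[where d = d])
  have "(mat_adjoint Z * M * Z) $$ (x, y) = (if x = y then complex_of_real (h x - 2 * l' x) else 0)"
    if xy: "x < d" "y < d" "l' x = l' y" for x y
  proof -
    have "(mat_adjoint Z * M * Z) $$ (x, y) = sform d M (\<lambda>j. Z $$ (j, y)) (\<lambda>i. Z $$ (i, x))"
      by (rule conj_index[OF Zc Mc Zc xy(1,2)])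
    also have "\<dots> = 1 * sform d K (\<lambda>j. Z $$ (j, y)) (\<lambda>i. Z $$ (i, x))"
    proof (rule sform_scale_on_support)
      fix i j assume "i < d" "j < d" "Z $$ (i, x) \<noteq> 0" "Z $$ (j, y) \<noteq> 0"
      then show "M $$ (i, j) = 1 * K $$ (i, j)"
        using lab[of i x] lab[of j y] xy by (simp add: K_def)
    qed
    also have "\<dots> = (\<Sum>i<d. complex_of_real (h y - 2 * l' y) * (cnj (Z $$ (i, x)) * Z $$ (i, y)))"
      unfolding sform_def mult_1
    proof (intro sum.cong refl)
      fix i assume "i \<in> {..<d}"
      then have i: "i < d" by simp
      have "app d K (\<lambda>j. Z $$ (j, y)) i = h y * Z $$ (i, y) - 2 * real (l i) * Z $$ (i, y)"
        using app_add[OF i, of "\<lambda>j. Z $$ (j, y)"] HZ[OF i xy(2)] appG[OF i] by simp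
      also have "\<dots> = complex_of_real (h y - 2 * l' y) * Z $$ (i, y)"
        using lab[OF i xy(2)] by (cases "Z $$ (i, y) = 0") (auto simp: algebra_simps)
      finally show "cnj (Z $$ (i, x)) * app d K (\<lambda>j. Z $$ (j, y)) i =
          complex_of_real (h y - 2 * l' y) * (cnj (Z $$ (i, x)) * Z $$ (i, y))" by simp
    qed
    also have "\<dots> = complex_of_real (h y - 2 * l' y) * (mat_adjoint Z * Z) $$ (x, y)"
      using Zc xy by (subst mult_mat_index[of _ d d _ d]) (auto simp: sum_distrib_left intro!: sum.cong)
    also have "\<dots> = (if x = y then complex_of_real (h x - 2 * l' x) else 0)"
      unfolding unitary_mat_left[OF Z] using xy by simp
    finally show ?thesis .
  qed
  then have block: "\<forall>x<d. \<forall>y<d. l' x = l' y \<longrightarrow>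
      (mat_adjoint U * R * U) $$ (x, y) = (if x = y then complex_of_real (h x - 2 * l' x) else 0)"
    unfolding URU by blast
  have labels: "\<forall>i<d. \<forall>x<d. (mat_adjoint V * U) $$ (i, x) \<noteq> 0 \<longrightarrow> l i = l' x"
    unfolding VU using lab by blast
  have "l' ` {..<d} \<subseteq> l ` {..<d}" unfolding l'_def using some by blast
  then have "pinching d R V l U l' (\<lambda>x. h x - 2 * l' x)"
    unfolding pinching_def using V Uu block labels by blast
  then show ?thesis by blast
qed

section \<open>The pinching inequality and its entropic form\<close>

lemma pinching_unitary:
  "pinching d R V l U l' r \<Longrightarrow> unitary_mat d V \<and> unitary_mat d U"
  by (simp add: pinching_def)

text \<open>The basis change between \<open>V\<close> and \<open>U\<close> links only equal labels,
  so a function of the label alone defines the same operator in both bases.\<close>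

lemma pinching_spectral_eq:
  assumes "pinching d R V l U l' r"
  shows "spectral d U (\<lambda>x. g (l' x)) = spectral d V (\<lambda>i. g (l i))"
proof -
  have V: "unitary_mat d V" and U: "unitary_mat d U"
    and lab: "\<And>i x. i < d \<Longrightarrow> x < d \<Longrightarrow> (mat_adjoint V * U) $$ (i, x) \<noteq> 0 \<Longrightarrow> l i = l' x"
    using assms by (auto simp: pinching_def)
  note c = unitary_mat_carrier[OF U] unitary_mat_carrier[OF V]
  define Z where "Z = mat_adjoint V * U"
  have Z: "Z \<in> carrier_mat d d" using c by (simp add: Z_def)
  let ?D' = "mat_diag d (\<lambda>x. complex_of_real (g (l' x)))" and ?D = "mat_diag d (\<lambda>x. complex_of_real (g (l x)))"
  have "Z * ?D' = ?D * Z"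
  proof (rule eq_matI)
    fix i j assume "i < dim_row (?D * Z)" "j < dim_col (?D * Z)"
    then have "i < d" "j < d" using Z by (auto simp: mat_diag_def)
    then show "(Z * ?D') $$ (i, j) = (?D * Z) $$ (i, j)"
      using lab[of i j] unfolding Z_def[symmetric]
      by (cases "Z $$ (i, j) = 0") (auto simp: mat_diag_mult_left[OF Z] mat_diag_mult_right[OF Z])
  qed (use Z in \<open>auto simp: mat_diag_def\<close>)
  then have "V * (Z * ?D') * mat_adjoint U = V * (?D * Z) * mat_adjoint U" by simp
  then show ?thesis
    unfolding spectral_def Z_def using c
    by (simp add: assoc_mult_square[where d = d] unitary_mat_cancel[OF V, of _ d] unitary_mat_right[OF U] right_mult_one_mat[of _ d d])
qed

lemma pinching_diag_coef:
  assumes "pinching d R V l U l' r" "x < d"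
  shows "diag_coef d U R x = r x"
proof -
  have "(mat_adjoint U * R * U) $$ (x, x) = complex_of_real (r x)"
    using assms unfolding pinching_def by auto
  then show ?thesis unfolding diag_coef_def by (simp del: index_mult_mat)
qed

lemma psd_diag_coef_nonneg:
  assumes "psd_mat d R" "U \<in> carrier_mat d d" "x < d"
  shows "0 \<le> diag_coef d U R x"
  using assms unfolding diag_coef_sform[OF assms(2) psd_mat_carrier[OF assms(1)] assms(3)] by (simp add: psd_mat_iff)

text \<open>Both sides are the trace of \<open>R\<close> against that common operator. Averages of
  functions of the label may thus be computed before or after the pinching.\<close>

lemma pinching_weighted_sum:
  assumes "pinching d R V l U l' r" "R \<in> carrier_mat d d"
  shows "(\<Sum>x<d. r x * g (l' x)) = (\<Sum>i<d. diag_coef d V R i * g (l i))"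
proof -
  have c: "U \<in> carrier_mat d d" "V \<in> carrier_mat d d" using pinching_unitary[OF assms(1)] by auto
  have "(\<Sum>x<d. r x * g (l' x)) = (\<Sum>x<d. diag_coef d U R x * g (l' x))"
    by (intro sum.cong) (auto simp: pinching_diag_coef[OF assms(1)])
  also have "\<dots> = (\<Sum>i<d. diag_coef d V R i * g (l i))"
    unfolding Re_mat_trace_mult_spectral[OF assms(2) c(1), symmetric] Re_mat_trace_mult_spectral[OF assms(2) c(2), symmetric]
      pinching_spectral_eq[OF assms(1)] ..
  finally show ?thesis .
qed

text \<open>Split the vector into its label components. Each cross term is at most the mean of the
  two diagonal ones, so every diagonal term is counted as often as there are labels, and the
  diagonal terms together give the form of the pinched matrix.\<close>

lemma pinching_inequality:
  assumes P: "pinching d R V l U l' r" and R: "psd_mat d R" and v: "card (l ` {..<d}) \<le> v"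
  shows "Re (sform d R x x) \<le> v * Re (sform d (spectral d U r) x x)"
proof -
  have U: "unitary_mat d U" using pinching_unitary[OF P] by simp
  note c = unitary_mat_carrier[OF U] psd_mat_carrier[OF R]
  define C where "C = l' ` {..<d}"
  have C: "finite C" "card C \<le> v"
  proof -
    have "card C \<le> card (l ` {..<d})" unfolding C_def using P by (intro card_mono) (auto simp: pinching_def)
    with v show "card C \<le> v" by simp
  qed (simp add: C_def)
  define N where "N = mat_adjoint U * R * U"
  have N: "psd_mat d N" unfolding N_def by (rule psd_mat_conj[OF R c(1)])
  define y where "y = coord d U x"
  define z where "z m i = (if l' i = m then y i else 0)" for m i
  have r: "0 \<le> r i" if "i < d" for i
    using pinching_diag_coef[OF P that] psd_diag_coef_nonneg[OF R c(1) that] by simp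
  have yz: "y i = (\<Sum>m\<in>C. z m i)" if "i < d" for i
    unfolding z_def using that C(1) by (simp add: C_def)
  have block: "Re (sform d N (z m) (z m)) = (\<Sum>i<d. if l' i = m then r i * (cmod (y i))\<^sup>2 else 0)" for m
  proof -
    have "sform d N (z m) (z m) = 1 * sform d (mat_diag d (\<lambda>i. complex_of_real (r i))) (z m) (z m)"
    proof (rule sform_scale_on_support)
      fix i j assume "i < d" "j < d" "z m i \<noteq> 0" "z m j \<noteq> 0"
      moreover from this have "l' i = l' j" by (auto simp: z_def split: if_splits)
      ultimately show "N $$ (i, j) = 1 * mat_diag d (\<lambda>i. complex_of_real (r i)) $$ (i, j)"
        using P unfolding pinching_def N_def[symmetric] by (auto simp: mat_diag_def)
    qed
    also have "\<dots> = (\<Sum>i<d. complex_of_real (if l' i = m then r i * (cmod (y i))\<^sup>2 else 0))"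
      unfolding sform_diag mult_1
      by (intro sum.cong refl) (simp add: z_def complex_norm_square mult.assoc del: of_real_power)
    finally show ?thesis by (simp flip: of_real_sum)
  qed
  have xU: "sform d R x x = sform d N y y"
  proof -
    have "sform d N y y = sform d R (app d U y) (app d U y)"
      unfolding N_def by (rule sform_conj[OF c(1,2)])
    also have "\<dots> = sform d R x x"
      by (rule sform_cong) (auto simp: y_def coord_reconstruct[OF U])
    finally show ?thesis ..
  qed
  have "sform d N y y = sform d N (\<lambda>i. \<Sum>m\<in>C. z m i) (\<lambda>i. \<Sum>m\<in>C. z m i)"
    by (rule sform_cong) (auto simp: yz)
  also have "\<dots> = (\<Sum>m\<in>C. \<Sum>m'\<in>C. sform d N (z m) (z m'))"
    unfolding sform_sum_left sform_sum_right ..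
  finally have "2 * Re (sform d R x x) = (\<Sum>m\<in>C. \<Sum>m'\<in>C. 2 * Re (sform d N (z m) (z m')))"
    unfolding xU by (simp add: sum_distrib_left)
  also have "\<dots> \<le> (\<Sum>m\<in>C. \<Sum>m'\<in>C. Re (sform d N (z m) (z m)) + Re (sform d N (z m') (z m')))"
    by (intro sum_mono Re_sform_le[OF N])
  also have "\<dots> = 2 * (card C * (\<Sum>m\<in>C. Re (sform d N (z m) (z m))))"
    by (simp add: sum.distrib sum_distrib_left)
  also have "(\<Sum>m\<in>C. Re (sform d N (z m) (z m))) = (\<Sum>i<d. r i * (cmod (y i))\<^sup>2)"
    unfolding block
    by (subst sum.swap) (auto simp: C_def intro!: sum.cong)
  also have "\<dots> = Re (sform d (spectral d U r) x x)"
    unfolding sform_spectral_self[OF c(1)] y_def by simp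
  finally have "Re (sform d R x x) \<le> card C * Re (sform d (spectral d U r) x x)" by simp
  also have "\<dots> \<le> v * Re (sform d (spectral d U r) x x)"
    using C(2) psd_spectral[OF c(1), of r] r by (intro mult_right_mono) (auto simp: psd_mat_iff)
  finally show ?thesis .
qed

lemma psd_mat_minus:
  assumes "A \<in> carrier_mat d d" "B \<in> carrier_mat d d" "mat_adjoint A = A" "mat_adjoint B = B"
    and "\<And>x. Re (sform d B x x) \<le> Re (sform d A x x)"
  shows "psd_mat d (A - B)"
proof -
  have "mat_adjoint (A - B) = A - B"
  proof (rule eq_matI)
    fix i j assume "i < dim_row (A - B)" "j < dim_col (A - B)"
    with assms have "i < d" "j < d" by auto
    then show "mat_adjoint (A - B) $$ (i, j) = (A - B) $$ (i, j)"
      using assms by (auto simp: hermitian_index[of _ d])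
  qed (use assms in auto)
  then show ?thesis using assms by (auto simp: psd_mat_iff sform_minus)
qed

lemma add_minus_cancel_mat:
  "A \<in> carrier_mat d d \<Longrightarrow> B \<in> carrier_mat d d \<Longrightarrow> A + (B - A) = (B :: complex mat)"
  by (rule eq_matI) auto

lemma spectral_one: "unitary_mat d V \<Longrightarrow> spectral d V (\<lambda>_. 1) = 1\<^sub>m d"
  by (simp add: spectral_def unitary_mat_right right_mult_one_mat[of _ d d])

text \<open>Pinching raises the von Neumann entropy by at least 0 and at most \<open>ln v\<close>.
  The increase equals the relative entropy of the state to its pinching, because the state has
  diagonal \<open>r\<close> in the basis \<open>U\<close>; the lower bound is Klein's inequality,
  the upper one combines the pinching inequality with antitonicity.\<close>

lemma pinching_entropy:
  assumes P: "pinching d (spectral d E e) V l U l' r" and E: "unitary_mat d E" and e: "\<And>i. 0 \<le> e i"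
    and tr: "(\<Sum>i<d. e i) = 1" and v: "card (l ` {..<d}) \<le> v"
  shows "(\<Sum>x<d. r x * ln (r x)) \<le> (\<Sum>i<d. e i * ln (e i))"
    and "(\<Sum>i<d. e i * ln (e i)) \<le> ln v + (\<Sum>x<d. r x * ln (r x))"
    and "dominated d (spectral d E e) (spectral d U r)"
proof -
  let ?R = "spectral d E e"
  have U: "unitary_mat d U" using pinching_unitary[OF P] by simp
  note c = unitary_mat_carrier[OF U] unitary_mat_carrier[OF E]
  have R: "psd_mat d ?R" using c e by (intro psd_spectral)
  have r: "0 \<le> r i" if "i < d" for i
    using pinching_diag_coef[OF P that] psd_diag_coef_nonneg[OF R c(1) that] by simp
  have Pr: "psd_mat d (spectral d U r)" using c r by (intro psd_spectral)
  note ineq = pinching_inequality[OF P R v]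
  show dominated: "dominated d ?R (spectral d U r)"
    unfolding dominated_def
  proof (intro allI impI)
    fix x assume "Re (sform d (spectral d U r) x x) = 0"
    then show "Re (sform d ?R x x) = 0" using ineq[of x] R by (simp add: psd_mat_iff antisym)
  qed
  have rel: "rel_ent ?R (spectral d U r) = (\<Sum>i<d. e i * ln (e i)) - (\<Sum>x<d. r x * ln (r x))"
    using rel_ent_spectral[OF E U, of e r] e r pinching_diag_coef[OF P] by simp
  have V: "unitary_mat d V" using pinching_unitary[OF P] by simp
  have "(\<Sum>x<d. r x) = (\<Sum>i<d. diag_coef d V ?R i * 1)"
    using pinching_weighted_sum[OF P spectral_carrier[OF c(2)], of "\<lambda>_. 1"] by simp
  also have "\<dots> = Re (mat_trace (?R * spectral d V (\<lambda>_. 1)))"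
    by (rule Re_mat_trace_mult_spectral[symmetric, OF spectral_carrier[OF c(2)] unitary_mat_carrier[OF V]])
  also have "\<dots> = 1"
    using tr mat_trace_spectral[OF E, of e] unitary_mat_carrier[OF V]
    by (simp add: spectral_one[OF V] right_mult_one_mat[OF spectral_carrier[OF c(2)]])
  finally have "(\<Sum>x<d. r x) = 1" .
  then have "0 \<le> rel_ent ?R (spectral d U r)"
    using tr by (intro rel_ent_nonneg[OF R Pr dominated]) (simp add: mat_trace_spectral[OF U] mat_trace_spectral[OF E])
  then show "(\<Sum>x<d. r x * ln (r x)) \<le> (\<Sum>i<d. e i * ln (e i))" unfolding rel by simp
  have "v > 0"
  proof (rule ccontr)
    assume "\<not> v > 0"
    then have "d = 0" using v by (auto simp: card_eq_0_iff)
    then show False using tr by simp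
  qed
  \<comment> \<open>The state divided by \<open>v\<close>. The pinching inequality puts it below the
    pinched state, and the relative entropy of the state to it is exactly
    \<open>ln v\<close>.\<close>
  define \<sigma> where "\<sigma> = spectral d E (\<lambda>i. e i / v)"
  have \<sigma>: "psd_mat d \<sigma>" unfolding \<sigma>_def using c e by (intro psd_spectral) auto
  have s\<sigma>: "Re (sform d \<sigma> x x) = Re (sform d ?R x x) / v" for x
    unfolding \<sigma>_def sform_spectral_self[OF c(2)] by (simp add: sum_divide_distrib)
  have \<Delta>: "psd_mat d (spectral d U r - \<sigma>)"
    using Pr \<sigma> ineq \<open>v > 0\<close> by (intro psd_mat_minus) (auto simp: psd_mat_iff s\<sigma> field_simps)
  have dominated\<sigma>: "dominated d ?R \<sigma>" unfolding dominated_def s\<sigma> using \<open>v > 0\<close> by simp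
  have "rel_ent ?R \<sigma> = (\<Sum>i<d. e i * ln (e i)) - (\<Sum>i<d. e i * ln (e i / v))"
    unfolding \<sigma>_def using rel_ent_spectral[OF E E, of e "\<lambda>i. e i / v"] e diag_coef_spectral_self[OF E] by simp
  also have "(\<Sum>i<d. e i * ln (e i / v)) = (\<Sum>i<d. e i * ln (e i) - e i * ln v)"
  proof (intro sum.cong refl)
    fix i
    show "e i * ln (e i / v) = e i * ln (e i) - e i * ln v"
    proof (cases "e i = 0")
      case False
      with e[of i] have "0 < e i" by linarith
      then show ?thesis using \<open>v > 0\<close> by (simp add: ln_div right_diff_distrib)
    qed simp
  qed
  also have "\<dots> = (\<Sum>i<d. e i * ln (e i)) - ln v"
    using tr by (simp add: sum_subtractf sum_distrib_right[symmetric])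
  finally have "rel_ent ?R \<sigma> = ln v" by simp
  moreover have "rel_ent ?R (\<sigma> + (spectral d U r - \<sigma>)) \<le> rel_ent ?R \<sigma>"
    by (rule rel_ent_antimono[OF R \<sigma> \<Delta> dominated\<sigma>])
  ultimately show "(\<Sum>i<d. e i * ln (e i)) \<le> ln v + (\<Sum>x<d. r x * ln (r x))"
    unfolding add_minus_cancel_mat[OF psd_mat_carrier[OF \<sigma>] spectral_carrier[OF c(1)]] rel by linarith
qed

section \<open>A nearly optimal extension\<close>

text \<open>Operators acting on the first factor alone pass through the trace over the second. It is
  used to compute marginals in another basis of A.\<close>

lemma partial_trace_conj:
  assumes A: "A \<in> carrier_mat a a" and M: "M \<in> carrier_mat (a * b) (a * b)" and B: "B \<in> carrier_mat a a"
  shows "partial_trace_snd a b (kron A (1\<^sub>m b) * M * kron B (1\<^sub>m b)) = A * partial_trace_snd a b M * B"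
proof (rule eq_matI)
  fix x y assume "x < dim_row (A * partial_trace_snd a b M * B)" "y < dim_col (A * partial_trace_snd a b M * B)"
  then have xy: "x < a" "y < a" using assms by auto
  note c = kron_carrier[OF A one_carrier_mat[of b]] kron_carrier[OF B one_carrier_mat[of b]]
  have L: "(kron A (1\<^sub>m b) * M) $$ (x * b + k, n) = (\<Sum>i<a. A $$ (x, i) * M $$ (i * b + k, n))"
    if "k < b" "n < a * b" for k n
  proof -
    have "(kron A (1\<^sub>m b) * M) $$ (x * b + k, n) = (\<Sum>i<a * b. kron A (1\<^sub>m b) $$ (x * b + k, i) * M $$ (i, n))"
      using that xy c M
      by (intro mult_mat_index[of _ "a * b" _ _ "a * b"]) (auto intro: prod_index_less)
    also have "\<dots> = (\<Sum>i<a. \<Sum>l<b. if l = k then A $$ (x, i) * M $$ (i * b + l, n) else 0)"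
      unfolding sum_prod_index using A xy that by (intro sum.cong) (auto simp: kron_index[of _ a _ b])
    finally show ?thesis using that by simp
  qed
  have R: "(kron A (1\<^sub>m b) * M * kron B (1\<^sub>m b)) $$ (x * b + k, y * b + k) =
      (\<Sum>j<a. (\<Sum>i<a. A $$ (x, i) * M $$ (i * b + k, j * b + k)) * B $$ (j, y))" if "k < b" for k
  proof -
    have "(kron A (1\<^sub>m b) * M * kron B (1\<^sub>m b)) $$ (x * b + k, y * b + k) =
        (\<Sum>j<a * b. (kron A (1\<^sub>m b) * M) $$ (x * b + k, j) * kron B (1\<^sub>m b) $$ (j, y * b + k))"
      using that xy c M
      by (intro mult_mat_index[of _ "a * b" _ _ "a * b"]) (auto intro: prod_index_less)
    also have "\<dots> = (\<Sum>j<a. \<Sum>l<b. if l = k then (\<Sum>i<a. A $$ (x, i) * M $$ (i * b + k, j * b + l)) * B $$ (j, y) else 0)"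
      unfolding sum_prod_index using B xy that L
      by (intro sum.cong refl) (auto simp: kron_index[of _ a _ b] prod_index_less simp del: index_mult_mat)
    finally show ?thesis using that by simp
  qed
  have "partial_trace_snd a b (kron A (1\<^sub>m b) * M * kron B (1\<^sub>m b)) $$ (x, y) =
      (\<Sum>k<b. \<Sum>j<a. (\<Sum>i<a. A $$ (x, i) * M $$ (i * b + k, j * b + k)) * B $$ (j, y))"
    unfolding partial_trace_index[OF xy] by (intro sum.cong) (auto simp: R)
  also have "\<dots> = (\<Sum>j<a. (\<Sum>i<a. A $$ (x, i) * partial_trace_snd a b M $$ (i, j)) * B $$ (j, y))"
  proof (subst sum.swap, intro sum.cong refl)
    fix j assume "j \<in> {..<a}"
    then show "(\<Sum>k<b. (\<Sum>i<a. A $$ (x, i) * M $$ (i * b + k, j * b + k)) * B $$ (j, y)) =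
        (\<Sum>i<a. A $$ (x, i) * partial_trace_snd a b M $$ (i, j)) * B $$ (j, y)"
      unfolding sum_distrib_right[symmetric]
      by (subst sum.swap) (simp add: partial_trace_index sum_distrib_left)
  qed
  also have "\<dots> = (A * partial_trace_snd a b M * B) $$ (x, y)"
    using A B xy by (simp add: mult_mat_index[of _ a a _ a] del: index_mult_mat)
  finally show "partial_trace_snd a b (kron A (1\<^sub>m b) * M * kron B (1\<^sub>m b)) $$ (x, y) = (A * partial_trace_snd a b M * B) $$ (x, y)" .
qed (use assms in auto)

text \<open>The convex function x ln x lies above its tangent at exp(-K).\<close>

lemma xlnx_tangent:
  fixes r K :: real
  assumes "0 < r"
  shows "- K * r \<le> r * ln r - r + exp (- K)"
proof -
  have "ln (exp (- K) / r) \<le> exp (- K) / r - 1"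
    using assms by (intro ln_le_minus_one) auto
  then have "r * (- K - ln r) \<le> exp (- K) - r"
    using assms by (simp add: ln_div field_simps)
  then show ?thesis by (simp add: algebra_simps)
qed

text \<open>\<open>k\<close> is the integer part of -ln r, capped at \<open>K\<close>, with r = 0
  sent to the cap. Below the cap rounding costs at most \<open>r\<close>; at the cap the tangent
  bounds the cost by exp(-K), however small \<open>r\<close> is.\<close>

lemma neg_bucket_le:
  fixes r :: real and K k :: nat
  assumes "0 \<le> r" "r \<le> 1" and k: "k = (if 0 < r then min K (nat \<lfloor>- ln r\<rfloor>) else K)"
  shows "- (real k * r) \<le> r * ln r + r + exp (- real K)" "r \<le> exp (- real k)"
proof -
  show "- (real k * r) \<le> r * ln r + r + exp (- real K)"
  proof (cases "0 < r")
    case True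
    show ?thesis
    proof (cases "K \<le> nat \<lfloor>- ln r\<rfloor>")
      case True
      then have "k = K" using k \<open>0 < r\<close> by simp
      moreover have "- (real K * r) \<le> r * ln r - r + exp (- real K)"
        using xlnx_tangent[OF \<open>0 < r\<close>, of "real K"] by simp
      ultimately show ?thesis using \<open>0 < r\<close> by simp
    next
      case False
      then have "k = nat \<lfloor>- ln r\<rfloor>" using k \<open>0 < r\<close> by simp
      moreover have "0 \<le> - ln r" using assms \<open>0 < r\<close> by simp
      ultimately have "real k > - ln r - 1" by linarith
      then have "r * (- real k) \<le> r * (ln r + 1)" using \<open>0 < r\<close> by (intro mult_left_mono) auto
      then have "- (real k * r) \<le> r * ln r + r" by (simp add: algebra_simps)
      moreover have "0 < exp (- real K)" by simp
      ultimately show ?thesis by linarith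
    qed
  qed (use assms in simp)
  show "r \<le> exp (- real k)"
  proof (cases "0 < r")
    case True
    then have "k \<le> nat \<lfloor>- ln r\<rfloor>" using k by simp
    moreover have "0 \<le> - ln r" using assms True by simp
    ultimately have "real k \<le> - ln r" by linarith
    then have "exp (ln r) \<le> exp (- real k)" by simp
    then show ?thesis using True by simp
  next
    case False
    then show ?thesis using assms less_le_trans[OF _ exp_ge_zero, of r "- real k"] exp_ge_zero[of "- real k"] by linarith
  qed
qed

text \<open>The state \<open>\<tau>\<close> is built from the pinching of \<open>\<rho>\<close> onto joint blocks: first the eigenvalues \<open>e\<close> of the
  prescribed marginal are grouped by \<open>\<lfloor>- ln e\<rfloor>\<close>, then the eigenvalues \<open>r\<close> of the pinched marginal of \<open>\<rho>\<close>
  by \<open>\<lfloor>- ln r\<rfloor>\<close>. On a block with labels \<open>l, k\<close> the pinching is multiplied by \<open>exp (k - l - 1)\<close>, which makes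
  its marginal at most the prescribed one; the missing marginal \<open>\<Delta>\<close> is supplied as \<open>\<Delta> \<otimes> 1 / b\<close>. Dropping that
  positive term can only increase the relative entropy.\<close>

theorem extension_exists:
  assumes \<rho>: "\<rho> \<in> density_mats (a * b)" and V: "unitary_mat a V" and e: "\<And>i. 0 \<le> e i"
    and s1: "(\<Sum>i<a. e i) = 1" and dominated: "dominated a (partial_trace_snd a b \<rho>) (spectral a V e)"
    and m: "0 < m" "\<And>i. i < a \<Longrightarrow> e i = 0 \<or> m \<le> e i"
    and K: "ln (real a) \<le> real K"
  defines "L \<equiv> nat \<lfloor>- ln m\<rfloor> + 1"
  shows "\<exists>\<tau> \<in> density_mats (a * b). partial_trace_snd a b \<tau> = spectral a V e \<and> dominated (a * b) \<rho> \<tau> \<and>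
    rel_ent \<rho> \<tau> \<le> rel_ent (partial_trace_snd a b \<rho>) (spectral a V e) + 3 + ln (real ((L + 1) * (K + 1)))"
proof -
  define R where "R = partial_trace_snd a b \<rho>"
  have \<rho>p: "psd_mat (a * b) \<rho>" and \<rho>t: "mat_trace \<rho> = 1" using \<rho> by (auto simp: density_mats_def)
  note \<rho>c = psd_mat_carrier[OF \<rho>p] and Vc = unitary_mat_carrier[OF V]
  have Rp: "psd_mat a R" unfolding R_def by (rule psd_partial_trace[OF \<rho>p])
  note Rc = psd_mat_carrier[OF Rp]
  have Rt: "mat_trace R = 1" unfolding R_def using \<rho>c \<rho>t by (simp add: mat_trace_partial_trace)
  have "b > 0" using \<rho>t \<rho>c by (cases b) (auto simp: mat_trace_def)
  obtain ER eR where ER: "unitary_mat a ER" and R_eq: "R = spectral a ER eR" and eR: "\<And>i. 0 \<le> eR i"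
    using psd_spectral_exists[OF Rp] by blast
  have eR1: "(\<Sum>i<a. eR i) = 1" using Rt mat_trace_spectral[OF ER, of eR] unfolding R_eq by simp
  obtain E ee where E: "unitary_mat (a * b) E" and \<rho>_eq: "\<rho> = spectral (a * b) E ee" and ee: "\<And>i. 0 \<le> ee i"
    using psd_spectral_exists[OF \<rho>p] by blast
  have ee1: "(\<Sum>i<a * b. ee i) = 1" using \<rho>t mat_trace_spectral[OF E, of ee] unfolding \<rho>_eq by simp
  have e_le: "e i \<le> 1" if "i < a" for i
    using s1 member_le_sum[of i "{..<a}" e] e that by simp

  \<comment> \<open>The kernel gets the label \<open>L\<close> of its own: every nonzero eigenvalue
    is at least \<open>m\<close>, so its label is strictly below \<open>L\<close>.\<close>
  define l where "l i = (if e i = 0 then L else nat \<lfloor>- ln (e i)\<rfloor>)" for i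
  \<comment> \<open>A lower bound for the eigenvalues on block \<open>n\<close>, at most a factor e
    off for nonzero eigenvalues; it is 0 on the kernel label.\<close>
  define w where "w n = (if n < L then exp (- real n - 1) else 0)" for n
  have w0: "0 \<le> w n" for n by (simp add: w_def)
  have l: "if e i = 0 then l i = L else l i < L \<and> real (l i) \<le> - ln (e i) \<and> - ln (e i) < real (l i) + 1"
    if "i < a" for i
  proof (cases "e i = 0")
    case False
    then have "m \<le> e i" using m(2)[OF that] by simp
    then have "- ln (e i) \<le> - ln m" "0 < e i" using m(1) by auto
    moreover have "0 \<le> - ln (e i)" using e_le[OF that] \<open>0 < e i\<close> by simp
    moreover have "nat \<lfloor>- ln (e i)\<rfloor> \<le> nat \<lfloor>- ln m\<rfloor>"
      using \<open>- ln (e i) \<le> - ln m\<close> by (intro nat_mono floor_mono)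
    ultimately show ?thesis using False unfolding l_def L_def by (simp; linarith)
  qed (simp add: l_def)
  have l_L: "l i \<le> L" if "i < a" for i using l[OF that] by (auto split: if_splits)
  have w_le: "w (l i) \<le> e i" if "i < a" for i
  proof (cases "e i = 0")
    case False
    then have "- real (l i) - 1 \<le> ln (e i)" using l[OF that] by simp
    then have "exp (- real (l i) - 1) \<le> exp (ln (e i))" by simp
    then show ?thesis using False e[of i] by (simp add: w_def)
  qed (use l[OF that] in \<open>simp add: w_def\<close>)

  obtain U l' r where P: "pinching a R V l U l' r"
    using pinching_exists[OF V Rp, of l] Rt by auto
  have U: "unitary_mat a U" using pinching_unitary[OF P] by simp
  note Uc = unitary_mat_carrier[OF U]
  have r0: "0 \<le> r x" if "x < a" for x
    using pinching_diag_coef[OF P that] psd_diag_coef_nonneg[OF Rp Uc that] by simp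
  have r1: "(\<Sum>x<a. r x) = 1"
  proof -
    have "(\<Sum>x<a. r x) = (\<Sum>x<a. diag_coef a U R x * 1)"
      by (intro sum.cong) (auto simp: pinching_diag_coef[OF P])
    also have "\<dots> = Re (mat_trace (R * spectral a U (\<lambda>_. 1)))"
      by (rule Re_mat_trace_mult_spectral[symmetric, OF Rc Uc])
    also have "\<dots> = 1" using Rt by (simp add: spectral_one[OF U] right_mult_one_mat[OF Rc])
    finally show ?thesis .
  qed
  have r_le: "r x \<le> 1" if "x < a" for x
    using r1 member_le_sum[of x "{..<a}" r] r0 that by simp
  have l'_L: "l' x \<le> L" if "x < a" for x
  proof -
    have "l' x \<in> l ` {..<a}" using P that unfolding pinching_def by blast
    then show ?thesis using l_L by auto
  qed
  define k where "k x = (if 0 < r x then min K (nat \<lfloor>- ln (r x)\<rfloor>) else K)" for x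
  have k_le: "k x \<le> K" for x by (simp add: k_def)
  \<comment> \<open>The pair of labels is coded as one number in base \<open>K + 1\<close>, which
    division and remainder decode.\<close>
  define c where "c x = l' x * (K + 1) + k x" for x
  have c_div: "c x div (K + 1) = l' x" "c x mod (K + 1) = k x" for x
    using k_le[of x] unfolding c_def by (auto simp: div_mult_self3 less_Suc_eq_le simp del: mult_Suc_right)
  \<comment> \<open>The rescaling factor as a function of the joint code. On the kernel label it is
    0.\<close>
  define g where "g n = w (n div (K + 1)) * exp (real (n mod (K + 1)))" for n
  have g_c: "g (c x) = w (l' x) * exp (real (k x))" for x unfolding g_def c_div ..
  have g0: "0 \<le> g n" for n by (simp add: g_def w0)

  define U2 where "U2 = kron U (1\<^sub>m b)"
  have U2: "unitary_mat (a * b) U2" unfolding U2_def by (rule unitary_mat_kron[OF U unitary_mat_one])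
  note U2c = unitary_mat_carrier[OF U2]
  \<comment> \<open>The label reads only the A index, so the block projections have the form P
    tensor 1 and are compatible with the partial trace.\<close>
  define c2 where "c2 i = c (i div b)" for i
  obtain F c' q where P2: "pinching (a * b) \<rho> U2 c2 F c' q"
    using pinching_exists[OF U2 \<rho>p, of c2] \<rho>t by auto
  have F: "unitary_mat (a * b) F" using pinching_unitary[OF P2] by simp
  note Fc = unitary_mat_carrier[OF F]
  have q0: "0 \<le> q j" if "j < a * b" for j
    using pinching_diag_coef[OF P2 that] psd_diag_coef_nonneg[OF \<rho>p Fc that] by simp
  have card_c2: "card (c2 ` {..<a * b}) \<le> (L + 1) * (K + 1)"
  proof -
    have "c2 ` {..<a * b} \<subseteq> {..<(L + 1) * (K + 1)}"
    proof
      fix n assume "n \<in> c2 ` {..<a * b}"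
      then obtain i where i: "i < a * b" "n = c (i div b)" by (auto simp: c2_def)
      show "n \<in> {..<(L + 1) * (K + 1)}"
        using prod_index_less[of "l' (i div b)" "L + 1" "k (i div b)" "K + 1"] l'_L[OF div_less_prod_index[OF i(1)]] k_le[of "i div b"]
        unfolding i(2) c_def by simp
    qed
    from card_mono[OF _ this] show ?thesis by simp
  qed
  note ent2 = pinching_entropy[OF P2[unfolded \<rho>_eq] E ee ee1 card_c2]
  have adjU2: "mat_adjoint U2 = kron (mat_adjoint U) (1\<^sub>m b)"
  proof -
    have "mat_adjoint (1\<^sub>m b) = (1\<^sub>m b :: complex mat)" by (rule eq_matI) auto
    then show ?thesis unfolding U2_def using Uc by (simp add: kron_adjoint[of _ a _ b])
  qed
  define \<rho>t where "\<rho>t = mat_adjoint U2 * \<rho> * U2"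
  have pt_\<rho>t: "partial_trace_snd a b \<rho>t = mat_adjoint U * R * U"
    unfolding \<rho>t_def adjU2 R_def unfolding U2_def using Uc \<rho>c by (intro partial_trace_conj) auto
  have \<rho>tc: "\<rho>t \<in> carrier_mat (a * b) (a * b)" unfolding \<rho>t_def using U2c \<rho>c by simp
  have U_block: "(mat_adjoint U * R * U) $$ (x, y) = (if x = y then complex_of_real (r x) else 0)"
    if "x < a" "y < a" "l' x = l' y" for x y
    using P that unfolding pinching_def by blast
  have F_block: "(mat_adjoint F * \<rho> * F) $$ (x, y) = (if x = y then complex_of_real (q x) else 0)"
    if "x < a * b" "y < a * b" "c' x = c' y" for x y
    using P2 that unfolding pinching_def by blast
  have F_label: "c2 i = c' x" if "i < a * b" "x < a * b" "(mat_adjoint U2 * F) $$ (i, x) \<noteq> 0" for i x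
    using P2 that unfolding pinching_def by blast

  \<comment> \<open>The pinched and rescaled state in the basis \<open>U2\<close>. Its entries show
    the marginal directly; the spectrum is read off later in the basis \<open>F\<close>.\<close>
  define \<kappa>t where "\<kappa>t = mat (a * b) (a * b) (\<lambda>(i, j). if c2 i = c2 j then complex_of_real (g (c2 i)) * \<rho>t $$ (i, j) else 0)"
  define \<kappa> where "\<kappa> = U2 * \<kappa>t * mat_adjoint U2"
  have \<kappa>tc: "\<kappa>t \<in> carrier_mat (a * b) (a * b)" by (simp add: \<kappa>t_def)
  have \<kappa>c: "\<kappa> \<in> carrier_mat (a * b) (a * b)" unfolding \<kappa>_def using U2c \<kappa>tc by simp
  have pt_\<kappa>: "partial_trace_snd a b \<kappa> = spectral a U (\<lambda>x. g (c x) * r x)"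
  proof -
    have "partial_trace_snd a b \<kappa>t = mat_diag a (\<lambda>x. complex_of_real (g (c x) * r x))"
    proof (rule eq_matI)
      fix x y assume "x < dim_row (mat_diag a (\<lambda>x. complex_of_real (g (c x) * r x)))"
        "y < dim_col (mat_diag a (\<lambda>x. complex_of_real (g (c x) * r x)))"
      then have xy: "x < a" "y < a" by (auto simp: mat_diag_def)
      have "partial_trace_snd a b \<kappa>t $$ (x, y) =
          (\<Sum>i<b. if c x = c y then complex_of_real (g (c x)) * \<rho>t $$ (x * b + i, y * b + i) else 0)"
        unfolding partial_trace_index[OF xy] using xy
        by (intro sum.cong) (auto simp: \<kappa>t_def c2_def prod_index_less)
      also have "\<dots> = (if c x = c y then complex_of_real (g (c x)) * partial_trace_snd a b \<rho>t $$ (x, y) else 0)"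
        unfolding partial_trace_index[OF xy] by (simp add: sum_distrib_left)
      also have "\<dots> = (if x = y then complex_of_real (g (c x) * r x) else 0)"
      proof (cases "c x = c y")
        \<comment> \<open>Equal joint codes force equal first labels, and there the marginal is
          already diagonal in \<open>U\<close>.\<close>
        case True
        then have "l' x = l' y" using c_div(1)[of x] c_div(1)[of y] by simp
        then show ?thesis using True U_block[OF xy] unfolding pt_\<rho>t by simp
      qed auto
      finally show "partial_trace_snd a b \<kappa>t $$ (x, y) = mat_diag a (\<lambda>x. complex_of_real (g (c x) * r x)) $$ (x, y)"
        using xy by (simp add: mat_diag_def)
    qed (auto simp: mat_diag_def)
    then show ?thesis
      unfolding \<kappa>_def adjU2 unfolding U2_def using Uc \<kappa>tc by (simp add: partial_trace_conj spectral_def)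
  qed
  \<comment> \<open>Every column of \<open>Z\<close> lives in one label block. Between columns of
    equal label \<open>\<kappa>t\<close> acts as a multiple of \<open>\<rho>t\<close>, and between
    different labels it vanishes, so \<open>F\<close> diagonalises \<kappa>.\<close>
  have \<kappa>_spec: "\<kappa> = spectral (a * b) F (\<lambda>j. g (c' j) * q j)"
  proof -
    define Z where "Z = mat_adjoint U2 * F"
    have Zc: "Z \<in> carrier_mat (a * b) (a * b)" unfolding Z_def using U2c Fc by simp
    have FZ: "mat_adjoint F * \<rho> * F = mat_adjoint Z * \<rho>t * Z"
      unfolding Z_def \<rho>t_def using U2c Fc \<rho>c
      by (simp add: mat_adjoint_mult[of _ "a * b" "a * b" _ "a * b"] assoc_mult_square[where d = "a * b"]
          unitary_mat_cancel[OF U2, of _ "a * b"])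
    have "mat_adjoint Z * \<kappa>t * Z = mat_diag (a * b) (\<lambda>j. complex_of_real (g (c' j) * q j))"
    proof (rule eq_matI)
      fix x y assume "x < dim_row (mat_diag (a * b) (\<lambda>j. complex_of_real (g (c' j) * q j)))"
        "y < dim_col (mat_diag (a * b) (\<lambda>j. complex_of_real (g (c' j) * q j)))"
      then have xy: "x < a * b" "y < a * b" by (auto simp: mat_diag_def)
      have "(mat_adjoint Z * \<kappa>t * Z) $$ (x, y) = sform (a * b) \<kappa>t (\<lambda>j. Z $$ (j, y)) (\<lambda>i. Z $$ (i, x))"
        by (rule conj_index[OF Zc \<kappa>tc Zc xy])
      also have "\<dots> = (if c' x = c' y then complex_of_real (g (c' x)) else 0) * sform (a * b) \<rho>t (\<lambda>j. Z $$ (j, y)) (\<lambda>i. Z $$ (i, x))"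
      proof (rule sform_scale_on_support)
        fix i j assume "i < a * b" "j < a * b" "Z $$ (i, x) \<noteq> 0" "Z $$ (j, y) \<noteq> 0"
        then show "\<kappa>t $$ (i, j) = (if c' x = c' y then complex_of_real (g (c' x)) else 0) * \<rho>t $$ (i, j)"
          using F_label[of i x] F_label[of j y] xy unfolding Z_def[symmetric] by (simp add: \<kappa>t_def)
      qed
      also have "\<dots> = (if c' x = c' y then complex_of_real (g (c' x)) else 0) * (mat_adjoint F * \<rho> * F) $$ (x, y)"
        unfolding FZ conj_index[OF Zc \<rho>tc Zc xy] ..
      also have "\<dots> = mat_diag (a * b) (\<lambda>j. complex_of_real (g (c' j) * q j)) $$ (x, y)"
        using F_block[OF xy] xy by (auto simp: mat_diag_def simp del: index_mult_mat)
      finally show "(mat_adjoint Z * \<kappa>t * Z) $$ (x, y) = mat_diag (a * b) (\<lambda>j. complex_of_real (g (c' j) * q j)) $$ (x, y)" .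
    qed (use Zc \<kappa>tc in \<open>auto simp: mat_diag_def\<close>)
    then have "spectral (a * b) F (\<lambda>j. g (c' j) * q j) = F * (mat_adjoint Z * \<kappa>t * Z) * mat_adjoint F"
      by (simp add: spectral_def)
    also have "\<dots> = \<kappa>"
      unfolding Z_def \<kappa>_def using U2c Fc \<kappa>tc
      by (simp add: mat_adjoint_mult[of _ "a * b" "a * b" _ "a * b"] assoc_mult_square[where d = "a * b"]
          unitary_mat_cancel[OF F, of _ "a * b"] unitary_mat_right[OF F] right_mult_one_mat[of _ "a * b" "a * b"])
    finally show ?thesis ..
  qed
  have \<kappa>p: "psd_mat (a * b) \<kappa>"
    unfolding \<kappa>_spec using Fc g0 q0 by (intro psd_spectral) auto

  define \<Delta> where "\<Delta> = spectral a V e - spectral a U (\<lambda>x. g (c x) * r x)"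
  \<comment> \<open>The factor \<open>exp (real (k x))\<close> undoes \<open>r x\<close> up to
    rounding from below, which leaves at most the lower bound \<open>w\<close> of the prescribed
    eigenvalues.\<close>
  have g_r: "g (c x) * r x \<le> w (l' x)" if "x < a" for x
  proof -
    have "r x \<le> exp (- real (k x))" using neg_bucket_le(2)[OF r0[OF that] r_le[OF that] k_def] .
    then have "exp (real (k x)) * r x \<le> exp (real (k x)) * exp (- real (k x))" by (intro mult_left_mono) auto
    then have "exp (real (k x)) * r x \<le> 1" by (simp flip: exp_add)
    from mult_left_mono[OF this w0[of "l' x"]] show ?thesis unfolding g_c by (simp add: mult.assoc)
  qed
  have \<Delta>: "psd_mat a \<Delta>" unfolding \<Delta>_def
  proof (intro psd_mat_minus)
    fix x
    have "Re (sform a (spectral a U (\<lambda>x. g (c x) * r x)) x x) \<le> Re (sform a (spectral a U (\<lambda>x. w (l' x))) x x)"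
      unfolding sform_spectral_self[OF Uc] Re_complex_of_real by (intro sum_mono mult_right_mono) (auto simp: g_r)
    also have "\<dots> = Re (sform a (spectral a V (\<lambda>i. w (l i))) x x)"
      unfolding pinching_spectral_eq[OF P] ..
    also have "\<dots> \<le> Re (sform a (spectral a V e) x x)"
      unfolding sform_spectral_self[OF Vc] Re_complex_of_real by (intro sum_mono mult_right_mono) (auto simp: w_le)
    finally show "Re (sform a (spectral a U (\<lambda>x. g (c x) * r x)) x x) \<le> Re (sform a (spectral a V e) x x)" .
  qed (use Uc Vc in \<open>auto simp: spectral_adjoint\<close>)
  note \<Delta>c = psd_mat_carrier[OF \<Delta>]
  \<comment> \<open>The maximally mixed state, used only to carry \<Delta> over to A tensor
    B.\<close>
  define \<beta> where "\<beta> = spectral b (1\<^sub>m b) (\<lambda>_. 1 / real b)"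
  have \<beta>: "psd_mat b \<beta>" unfolding \<beta>_def by (intro psd_spectral) auto
  have "Re (mat_trace \<beta>) = 1" unfolding \<beta>_def mat_trace_spectral[OF unitary_mat_one] using \<open>b > 0\<close> by simp
  moreover have "Im (mat_trace \<beta>) = 0"
    unfolding mat_trace_def Im_sum using \<beta> 
    by (intro sum.neutral ballI) (auto simp: psd_mat_iff dest!: hermitian_index[of \<beta> b, THEN arg_cong[where f = Im]])
  ultimately have \<beta>t: "mat_trace \<beta> = 1" by (simp add: complex_eq_iff)
  define \<tau> where "\<tau> = \<kappa> + kron \<Delta> \<beta>"
  have k\<Delta>: "psd_mat (a * b) (kron \<Delta> \<beta>)" by (rule psd_mat_kron[OF \<Delta> \<beta>])
  have \<tau>p: "psd_mat (a * b) \<tau>" unfolding \<tau>_def by (rule psd_mat_add[OF \<kappa>p k\<Delta>])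
  have pt_\<tau>: "partial_trace_snd a b \<tau> = spectral a V e"
  proof -
    have "mat_trace \<beta> \<cdot>\<^sub>m \<Delta> = \<Delta>" unfolding \<beta>t by (rule eq_matI) auto
    then have "partial_trace_snd a b \<tau> = spectral a U (\<lambda>x. g (c x) * r x) + \<Delta>"
      unfolding \<tau>_def partial_trace_add[OF \<kappa>c psd_mat_carrier[OF k\<Delta>]] pt_\<kappa>
        partial_trace_kron[OF \<Delta>c psd_mat_carrier[OF \<beta>]] by simp
    then show ?thesis
      unfolding \<Delta>_def add_minus_cancel_mat[OF spectral_carrier[OF Uc] spectral_carrier[OF Vc]] .
  qed
  have "mat_trace \<tau> = mat_trace (spectral a V e)"
    using mat_trace_partial_trace[OF psd_mat_carrier[OF \<tau>p]] pt_\<tau> by simp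
  moreover have "mat_trace (spectral a V e) = 1"
  proof -
    have "Re (mat_trace (spectral a V e)) = 1" using mat_trace_spectral[OF V, of e] s1 by simp
    moreover have "Im (mat_trace (spectral a V e)) = 0"
      unfolding mat_trace_def Im_sum using Vc spectral_adjoint[OF Vc, of e]
      by (intro sum.neutral ballI)
         (auto dest!: hermitian_index[of "spectral a V e" a, OF _ spectral_carrier[OF Vc], THEN arg_cong[where f = Im]])
    ultimately show ?thesis by (simp add: complex_eq_iff)
  qed
  ultimately have \<tau>: "\<tau> \<in> density_mats (a * b)" using \<tau>p by (simp add: density_mats_def)

  \<comment> \<open>The marginal of \<rho> has no weight on the kernel of the prescribed marginal.
    The following facts carry this over to \<open>r\<close> and \<open>q\<close>, so that no
    logarithm of a vanishing factor \<open>g\<close> gets a nonzero weight.\<close>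
  have dV0: "diag_coef a V R i = 0" if "i < a" "e i = 0" for i
  proof -
    have "Re (sform a (spectral a V e) (\<lambda>j. V $$ (j, i)) (\<lambda>j. V $$ (j, i))) = diag_coef a V (spectral a V e) i"
      using diag_coef_sform[OF Vc spectral_carrier[OF Vc] that(1)] by simp
    also have "\<dots> = 0" using diag_coef_spectral_self[OF V that(1)] that by simp
    finally have "Re (sform a R (\<lambda>j. V $$ (j, i)) (\<lambda>j. V $$ (j, i))) = 0"
      using dominated unfolding dominated_def R_def by blast
    then show ?thesis using diag_coef_sform[OF Vc Rc that(1)] by simp
  qed
  \<comment> \<open>The label is a local observable of A, so its distribution is the same under
    \<rho> and under the marginal \<open>R\<close>.\<close>
  have \<rho>_sum: "(\<Sum>j<a * b. q j * \<phi> (c' j)) = (\<Sum>x<a. r x * \<phi> (c x))" for \<phi>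
  proof -
    have "(\<Sum>j<a * b. q j * \<phi> (c' j)) = (\<Sum>i<a * b. diag_coef (a * b) U2 \<rho> i * \<phi> (c2 i))"
      by (rule pinching_weighted_sum[OF P2 \<rho>c])
    also have "\<dots> = (\<Sum>x<a. \<Sum>n<b. Re (\<rho>t $$ (x * b + n, x * b + n)) * \<phi> (c x))"
      unfolding sum_prod_index diag_coef_def \<rho>t_def[symmetric] c2_def by (intro sum.cong refl) simp
    also have "\<dots> = (\<Sum>x<a. Re ((mat_adjoint U * R * U) $$ (x, x)) * \<phi> (c x))"
      unfolding pt_\<rho>t[symmetric] by (intro sum.cong refl) (simp add: partial_trace_index sum_distrib_right)
    also have "\<dots> = (\<Sum>x<a. r x * \<phi> (c x))"
      by (intro sum.cong refl) (simp add: U_block del: index_mult_mat)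
    finally show ?thesis .
  qed
  have null: "(\<Sum>x<a. r x * (if w (l' x) = 0 then 1 else 0)) = 0"
  proof -
    have "(\<Sum>x<a. r x * (if w (l' x) = 0 then 1 else 0)) = (\<Sum>i<a. diag_coef a V R i * (if w (l i) = 0 then 1 else 0))"
      by (rule pinching_weighted_sum[OF P Rc])
    also have "\<dots> = 0"
    proof (intro sum.neutral ballI)
      fix i assume "i \<in> {..<a}"
      then have i: "i < a" by simp
      show "diag_coef a V R i * (if w (l i) = 0 then 1 else 0) = 0"
        using dV0[OF i] l[OF i] by (cases "e i = 0") (auto simp: w_def)
    qed
    finally show ?thesis .
  qed
  have r_pos: "w (l' x) > 0" if "x < a" "r x \<noteq> 0" for x
  proof -
    have "\<forall>x\<in>{..<a}. r x * (if w (l' x) = 0 then 1 else 0) = 0"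
      using null by (subst (asm) sum_nonneg_eq_0_iff) (auto simp: r0)
    then have "w (l' x) \<noteq> 0" using that by auto
    then show ?thesis using w0[of "l' x"] by simp
  qed
  have q_pos: "g (c' j) > 0" if "j < a * b" "q j \<noteq> 0" for j
  proof -
    have "(\<Sum>j<a * b. q j * (if g (c' j) = 0 then 1 else 0)) = (\<Sum>x<a. r x * (if g (c x) = 0 then 1 else 0))"
      by (rule \<rho>_sum)
    also have "\<dots> = 0" using null unfolding g_c by simp
    finally have "\<forall>j\<in>{..<a * b}. q j * (if g (c' j) = 0 then 1 else 0) = 0"
      by (subst (asm) sum_nonneg_eq_0_iff) (auto simp: q0)
    then have "g (c' j) \<noteq> 0" using that by auto
    then show ?thesis using g0[of "c' j"] by simp
  qed
  have dominated\<kappa>: "dominated (a * b) \<rho> \<kappa>"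
    unfolding dominated_def
  proof (intro allI impI)
    fix x assume "Re (sform (a * b) \<kappa> x x) = 0"
    then have "\<forall>j<a * b. g (c' j) * q j = 0 \<or> coord (a * b) F x j = 0"
      unfolding \<kappa>_spec using sform_spectral_zero_iff[of F "a * b" "\<lambda>j. g (c' j) * q j"] Fc g0 q0 by simp
    then have "\<forall>j<a * b. q j = 0 \<or> coord (a * b) F x j = 0"
      using q_pos by force
    then have "Re (sform (a * b) (spectral (a * b) F q) x x) = 0"
      using sform_spectral_zero_iff[of F "a * b" q] Fc q0 by simp
    then show "Re (sform (a * b) \<rho> x x) = 0"
      using ent2(3) unfolding \<rho>_eq[symmetric] dominated_def by blast
  qed
  have dominated\<tau>: "dominated (a * b) \<rho> \<tau>" unfolding \<tau>_def by (rule dominated_trans_le[OF dominated\<kappa> \<kappa>p k\<Delta>])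

  have rel_\<kappa>: "rel_ent \<rho> \<kappa> = (\<Sum>i<a * b. ee i * ln (ee i)) - (\<Sum>j<a * b. q j * ln (q j)) - (\<Sum>j<a * b. q j * ln (g (c' j)))"
  proof -
    have "rel_ent \<rho> \<kappa> = (\<Sum>i<a * b. ee i * ln (ee i)) - (\<Sum>j<a * b. diag_coef (a * b) F \<rho> j * ln (g (c' j) * q j))"
      unfolding \<kappa>_spec unfolding \<rho>_eq by (rule rel_ent_spectral[OF E F]) (use ee g0 q0 in auto)
    also have "(\<Sum>j<a * b. diag_coef (a * b) F \<rho> j * ln (g (c' j) * q j)) =
        (\<Sum>j<a * b. q j * ln (q j) + q j * ln (g (c' j)))"
    proof (intro sum.cong refl)
      fix j assume "j \<in> {..<a * b}"
      then have j: "j < a * b" by simp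
      show "diag_coef (a * b) F \<rho> j * ln (g (c' j) * q j) = q j * ln (q j) + q j * ln (g (c' j))"
      proof (cases "q j = 0")
        case False
        then have "0 < q j" using q0[OF j] by simp
        then show ?thesis
          unfolding pinching_diag_coef[OF P2 j] using q_pos[OF j False] by (simp add: ln_mult_pos algebra_simps)
      qed (simp add: pinching_diag_coef[OF P2 j])
    qed
    finally show ?thesis by (simp add: sum.distrib)
  qed
  \<comment> \<open>The constant 3 has three units: rounding -ln e, rounding -ln r, and the cap,
    which costs at most a exp(-K) \<le> 1.\<close>
  have cost: "- (\<Sum>j<a * b. q j * ln (g (c' j))) \<le>
      3 - (\<Sum>i<a. diag_coef a V R i * ln (e i)) + (\<Sum>x<a. r x * ln (r x))"
  proof -
    have "- (\<Sum>j<a * b. q j * ln (g (c' j))) = (\<Sum>x<a. - (r x * ln (g (c x))))"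
      unfolding \<rho>_sum[of "\<lambda>n. ln (g n)"] by (simp add: sum_negf)
    also have "\<dots> = (\<Sum>x<a. r x * (- ln (w (l' x))) - real (k x) * r x)"
    proof (intro sum.cong refl)
      fix x assume "x \<in> {..<a}"
      then have x: "x < a" by simp
      show "- (r x * ln (g (c x))) = r x * (- ln (w (l' x))) - real (k x) * r x"
        using r_pos[OF x] unfolding g_c by (cases "r x = 0") (auto simp: ln_mult_pos algebra_simps)
    qed
    also have "\<dots> \<le> (\<Sum>x<a. r x * (- ln (w (l' x))) + (r x * ln (r x) + r x + exp (- real K)))"
    proof (intro sum_mono)
      fix x assume "x \<in> {..<a}"
      then have x: "x < a" by simp
      show "r x * (- ln (w (l' x))) - real (k x) * r x \<le> r x * (- ln (w (l' x))) + (r x * ln (r x) + r x + exp (- real K))"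
        using neg_bucket_le(1)[OF r0[OF x] r_le[OF x] k_def] by simp
    qed
    also have "\<dots> = (\<Sum>x<a. r x * (- ln (w (l' x)))) + (\<Sum>x<a. r x * ln (r x)) + 1 + real a * exp (- real K)"
      by (simp only: sum.distrib r1 sum_constant card_lessThan add.assoc)
    also have "(\<Sum>x<a. r x * (- ln (w (l' x)))) = (\<Sum>i<a. diag_coef a V R i * (- ln (w (l i))))"
      by (rule pinching_weighted_sum[OF P Rc])
    also have "\<dots> \<le> (\<Sum>i<a. diag_coef a V R i * (1 - ln (e i)))"
    proof (intro sum_mono)
      fix i assume "i \<in> {..<a}"
      then have i: "i < a" by simp
      show "diag_coef a V R i * (- ln (w (l i))) \<le> diag_coef a V R i * (1 - ln (e i))"
      proof (cases "e i = 0")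
        case False
        then have "- ln (w (l i)) \<le> 1 - ln (e i)" using l[OF i] by (simp add: w_def)
        then show ?thesis using psd_diag_coef_nonneg[OF Rp Vc i] by (rule mult_left_mono)
      qed (simp add: dV0[OF i])
    qed
    also have "\<dots> = 1 - (\<Sum>i<a. diag_coef a V R i * ln (e i))"
    proof -
      have "(\<Sum>i<a. diag_coef a V R i) = 1"
        using pinching_weighted_sum[OF P Rc, of "\<lambda>_. 1"] r1 by simp
      then show ?thesis by (simp add: right_diff_distrib sum_subtractf)
    qed
    also have "real a * exp (- real K) \<le> 1"
    proof -
      have "a > 0" using s1 by (cases a) auto
      then have "real a = exp (ln (real a))" by simp
      also have "\<dots> \<le> exp (real K)" using K by simp
      finally show ?thesis by (simp add: exp_minus field_simps)
    qed
    finally show ?thesis by simp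
  qed
  have R_ent: "rel_ent R (spectral a V e) = (\<Sum>i<a. eR i * ln (eR i)) - (\<Sum>i<a. diag_coef a V R i * ln (e i))"
    unfolding R_eq by (rule rel_ent_spectral[OF ER V]) (use eR e in auto)
  have "rel_ent \<rho> \<tau> \<le> rel_ent \<rho> \<kappa>"
    unfolding \<tau>_def by (rule rel_ent_antimono[OF \<rho>p \<kappa>p k\<Delta> dominated\<kappa>])
  \<comment> \<open>Pinching \<rho> costs the logarithm of the number of labels. Pinching
    \<open>R\<close> is free here: it raises the entropy, hence lowers the sum of
    \<open>r x * ln (r x)\<close> that enters the bound with a positive sign.\<close>
  also have "\<dots> \<le> rel_ent R (spectral a V e) + 3 + ln (real ((L + 1) * (K + 1)))"
    using rel_\<kappa> cost R_ent ent2(2) pinching_entropy(1)[OF P[unfolded R_eq] ER eR eR1 order_refl] by linarith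
  finally show ?thesis using \<tau> pt_\<tau> dominated\<tau> unfolding R_def by blast
qed

section \<open>Tensor powers\<close>

lemma kron_one_left: "M \<in> carrier_mat d d \<Longrightarrow> kron (1\<^sub>m 1) M = M"
  by (rule eq_matI) (auto simp: kron_def)

lemma tensor_pow_carrier [simp]: "M \<in> carrier_mat d d \<Longrightarrow> tensor_pow M n \<in> carrier_mat (d ^ n) (d ^ n)"
proof (induction n)
  case (Suc n)
  then have "kron (tensor_pow M n) M \<in> carrier_mat (d ^ n * d) (d ^ n * d)" by (intro kron_carrier) auto
  then show ?case by (simp add: mult.commute)
qed simp

lemma density_mats_kron:
  "A \<in> density_mats a \<Longrightarrow> B \<in> density_mats b \<Longrightarrow> kron A B \<in> density_mats (a * b)"
  by (auto simp: density_mats_def psd_mat_kron mat_trace_kron[OF psd_mat_carrier psd_mat_carrier])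

lemma density_mats_one: "1\<^sub>m 1 \<in> density_mats 1"
proof -
  have "psd_mat 1 (spectral 1 (1\<^sub>m 1) (\<lambda>_. 1))" by (intro psd_spectral) auto
  then show ?thesis unfolding spectral_one[OF unitary_mat_one] by (simp add: density_mats_def mat_trace_def)
qed

lemma density_mats_tensor_pow: "M \<in> density_mats d \<Longrightarrow> tensor_pow M n \<in> density_mats (d ^ n)"
proof (induction n)
  case 0
  then show ?case using density_mats_one by simp
next
  case (Suc n)
  then show ?case using density_mats_kron[of "tensor_pow M n" "d ^ n" M d] by (simp add: mult.commute)
qed

text \<open>The nonzero eigenvalues of the power are products of \<open>n\<close> nonzero
  eigenvalues. The lower bound \<open>m ^ n\<close> is what keeps the number of labels linear in
  \<open>n\<close>.\<close>

lemma tensor_pow_spectral: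
  assumes V: "unitary_mat d V" and e: "\<And>i. 0 \<le> e i" and m: "0 < m" "\<And>i. i < d \<Longrightarrow> e i = 0 \<or> m \<le> e i"
  shows "\<exists>W f. unitary_mat (d ^ n) W \<and> tensor_pow (spectral d V e) n = spectral (d ^ n) W f \<and>
    (\<forall>i. 0 \<le> f i) \<and> (\<forall>i < d ^ n. f i = 0 \<or> m ^ n \<le> f i)"
proof (induction n)
  case 0
  have "tensor_pow (spectral d V e) 0 = spectral (d ^ 0) (1\<^sub>m (d ^ 0)) (\<lambda>_. 1)"
    unfolding spectral_one[OF unitary_mat_one] by simp
  moreover have "unitary_mat (d ^ 0) (1\<^sub>m (d ^ 0))" by (rule unitary_mat_one)
  ultimately show ?case by (intro exI[of _ "1\<^sub>m (d ^ 0)"] exI[of _ "\<lambda>_. 1"]) auto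
next
  case (Suc n)
  then obtain W f where W: "unitary_mat (d ^ n) W" "tensor_pow (spectral d V e) n = spectral (d ^ n) W f"
    and f: "\<And>i. 0 \<le> f i" "\<And>i. i < d ^ n \<Longrightarrow> f i = 0 \<or> m ^ n \<le> f i" by blast
  have "unitary_mat (d ^ Suc n) (kron W V)"
    using unitary_mat_kron[OF W(1) V] by (simp add: mult.commute)
  moreover have "tensor_pow (spectral d V e) (Suc n) = spectral (d ^ Suc n) (kron W V) (\<lambda>i. f (i div d) * e (i mod d))"
    using kron_spectral[OF unitary_mat_carrier[OF W(1)] unitary_mat_carrier[OF V], of f e] W(2) by (simp add: mult.commute)
  moreover have "f (i div d) * e (i mod d) = 0 \<or> m ^ Suc n \<le> f (i div d) * e (i mod d)" if "i < d ^ Suc n" for i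
  proof -
    have i: "i < d ^ n * d" using that by (simp add: mult.commute)
    show ?thesis
    proof (cases "f (i div d) = 0 \<or> e (i mod d) = 0")
      case False
      then have "m ^ n \<le> f (i div d)" "m \<le> e (i mod d)"
        using f(2)[OF div_less_prod_index[OF i]] m(2)[OF mod_less_prod_index[OF i]] by auto
      then have "m ^ n * m \<le> f (i div d) * e (i mod d)" using m(1) f(1) by (intro mult_mono) auto
      then show ?thesis by (simp add: mult.commute)
    qed auto
  qed
  ultimately show ?case using f(1) e
    by (intro exI[of _ "kron W V"] exI[of _ "\<lambda>i. f (i div d) * e (i mod d)"]) auto
qed

lemma dominated_refl: "dominated d \<rho> \<rho>"
  by (simp add: dominated_def)

lemma rel_ent_self: "psd_mat d \<rho> \<Longrightarrow> rel_ent \<rho> \<rho> = 0"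
proof -
  assume "psd_mat d \<rho>"
  then obtain U e where U: "unitary_mat d U" and \<rho>: "\<rho> = spectral d U e" and e: "\<And>i. 0 \<le> e i"
    using psd_spectral_exists by blast
  show ?thesis unfolding \<rho> using rel_ent_spectral[OF U U, of e e] e diag_coef_spectral_self[OF U] by simp
qed

lemma rel_ent_tensor_pow:
  assumes "\<rho> \<in> density_mats d" "\<sigma> \<in> density_mats d" "dominated d \<rho> \<sigma>"
  shows "dominated (d ^ n) (tensor_pow \<rho> n) (tensor_pow \<sigma> n) \<and>
    rel_ent (tensor_pow \<rho> n) (tensor_pow \<sigma> n) = real n * rel_ent \<rho> \<sigma>"
proof (induction n)
  case 0
  have "psd_mat 1 (1\<^sub>m 1)" using density_mats_one by (simp add: density_mats_def)
  from rel_ent_self[OF this] show ?case by (simp add: dominated_refl)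
next
  case (Suc n)
  have p: "psd_mat d \<rho>" "psd_mat d \<sigma>" "psd_mat (d ^ n) (tensor_pow \<rho> n)" "psd_mat (d ^ n) (tensor_pow \<sigma> n)"
    "mat_trace \<rho> = 1" "mat_trace (tensor_pow \<rho> n) = 1"
    using assms(1,2) density_mats_tensor_pow[OF assms(1), of n] density_mats_tensor_pow[OF assms(2), of n]
    by (simp_all add: density_mats_def)
  have "rel_ent (tensor_pow \<rho> (Suc n)) (tensor_pow \<sigma> (Suc n)) = real n * rel_ent \<rho> \<sigma> + rel_ent \<rho> \<sigma>"
    using rel_ent_kron[OF p(3,4) _ p(1,2) assms(3)] Suc p(5,6) by simp
  moreover have "dominated (d ^ n * d) (tensor_pow \<rho> (Suc n)) (tensor_pow \<sigma> (Suc n))"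
    using dominated_kron[OF p(3,4) _ p(1,2) assms(3)] Suc by simp
  ultimately show ?case by (simp add: mult.commute algebra_simps)
qed

text \<open>Tracing out the last factor preserves support inclusion and, the states having trace 1,
  lowers the power by one.\<close>

lemma dominated_tensor_powD:
  assumes "\<rho> \<in> density_mats d" "\<sigma> \<in> density_mats d"
  shows "dominated (d ^ Suc n) (tensor_pow \<rho> (Suc n)) (tensor_pow \<sigma> (Suc n)) \<Longrightarrow> dominated d \<rho> \<sigma>"
proof (induction n)
  case 0
  then show ?case
    using assms kron_one_left[OF psd_mat_carrier, of d \<rho>] kron_one_left[OF psd_mat_carrier, of d \<sigma>]
    by (simp add: density_mats_def)
next
  case (Suc n)
  have pt: "partial_trace_snd (d ^ Suc n) d (tensor_pow M (Suc (Suc n))) = tensor_pow M (Suc n)"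
    if M: "M \<in> density_mats d" for M
  proof -
    have "M \<in> carrier_mat d d" "mat_trace M = 1" using M by (auto simp: density_mats_def psd_mat_carrier)
    moreover have "1 \<cdot>\<^sub>m tensor_pow M (Suc n) = tensor_pow M (Suc n)" by (rule eq_matI) auto
    ultimately show ?thesis
      using partial_trace_kron[OF tensor_pow_carrier[of M d "Suc n"], of M d] by (simp del: power_Suc)
  qed
  have "d ^ Suc (Suc n) = d ^ Suc n * d" by (simp add: mult.commute)
  then have "dominated (d ^ Suc n) (tensor_pow \<rho> (Suc n)) (tensor_pow \<sigma> (Suc n))"
    using dominated_partial_trace[of "d ^ Suc n" d "tensor_pow \<rho> (Suc (Suc n))" "tensor_pow \<sigma> (Suc (Suc n))"]
      Suc.prems density_mats_tensor_pow[OF assms(2), of "Suc (Suc n)"] pt[OF assms(1)] pt[OF assms(2)]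
    by (simp add: density_mats_def del: power_Suc tensor_pow.simps)
  then show ?case by (rule Suc.IH)
qed

section \<open>The identification of A^n tensor B^n with the n-th power of A tensor B\<close>

lemma regroup_index_Suc:
  assumes "x < a ^ Suc n" "y < b ^ Suc n"
  shows "regroup_index a b (Suc n) (x * b ^ Suc n + y) =
    regroup_index a b n ((x div a) * b ^ n + y div b) * (a * b) + ((x mod a) * b + y mod b)"
proof -
  have idx: "(x * B + y) div B = x \<and> (x * B + y) mod B = y" if "y < B" for x y B :: nat
    using that by simp
  have y: "y div b < b ^ n" using assms(2) by (intro div_less_prod_index) (simp add: mult.commute)
  have "regroup_index a b (Suc n) (x * b ^ Suc n + y) =
      (\<Sum>k<Suc n. ((x div a ^ k mod a) * b + y div b ^ k mod b) * (a * b) ^ k)"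
    unfolding regroup_index_def idx[OF assms(2), THEN conjunct1] idx[OF assms(2), THEN conjunct2] ..
  \<comment> \<open>The digits at k = 0 are the least significant ones and belong to the last tensor
    factor, the one that \<open>tensor_pow\<close> appends on the right.\<close>
  also have "\<dots> = ((x mod a) * b + y mod b) +
      (\<Sum>k<n. ((x div a) div a ^ k mod a * b + (y div b) div b ^ k mod b) * (a * b) ^ k) * (a * b)"
    unfolding sum.lessThan_Suc_shift sum_distrib_right by (simp add: div_mult2_eq mult_ac)
  also have "(\<Sum>k<n. ((x div a) div a ^ k mod a * b + (y div b) div b ^ k mod b) * (a * b) ^ k) =
      regroup_index a b n ((x div a) * b ^ n + y div b)"
    unfolding regroup_index_def idx[OF y, THEN conjunct1] idx[OF y, THEN conjunct2] ..
  finally show ?thesis by simp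
qed

lemma regroup_index_less:
  "x < a ^ n \<Longrightarrow> y < b ^ n \<Longrightarrow> regroup_index a b n (x * b ^ n + y) < (a * b) ^ n"
proof (induction n arbitrary: x y)
  case 0
  then show ?case by (simp add: regroup_index_def)
next
  case (Suc n)
  have x: "x < a ^ n * a" and y: "y < b ^ n * b" using Suc.prems by (simp_all add: mult.commute)
  have "regroup_index a b n ((x div a) * b ^ n + y div b) < (a * b) ^ n"
    by (intro Suc.IH div_less_prod_index x y)
  moreover have "(x mod a) * b + y mod b < a * b"
    by (intro prod_index_less mod_less_prod_index[OF x] mod_less_prod_index[OF y])
  ultimately show ?case
    unfolding regroup_index_Suc[OF Suc.prems] unfolding power_Suc2 by (rule prod_index_less)
qed

lemma tensor_pow_regroup_Suc:
  assumes M: "M \<in> carrier_mat (a * b) (a * b)"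
    and "x < a ^ Suc n" "y < b ^ Suc n" "x' < a ^ Suc n" "y' < b ^ Suc n"
  shows "tensor_pow M (Suc n) $$ (regroup_index a b (Suc n) (x * b ^ Suc n + y), regroup_index a b (Suc n) (x' * b ^ Suc n + y')) =
    tensor_pow M n $$ (regroup_index a b n ((x div a) * b ^ n + y div b), regroup_index a b n ((x' div a) * b ^ n + y' div b))
      * M $$ ((x mod a) * b + y mod b, (x' mod a) * b + y' mod b)"
proof -
  have l: "x < a ^ n * a" "y < b ^ n * b" "x' < a ^ n * a" "y' < b ^ n * b"
    using assms by (simp_all add: mult.commute)
  show ?thesis
    unfolding regroup_index_Suc[OF assms(2,3)] regroup_index_Suc[OF assms(4,5)] tensor_pow.simps
    by (intro kron_index[of _ "(a * b) ^ n"] tensor_pow_carrier M regroup_index_less prod_index_less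
        div_less_prod_index mod_less_prod_index l)
       (use l mod_less_prod_index in auto)
qed

text \<open>Splitting off the last digits turns the sum over B^n into a sum over B^(n-1) times a sum
  over B, so the entries of the marginal obey the same recursion as the tensor power.\<close>

lemma partial_trace_regroup:
  assumes M: "M \<in> carrier_mat (a * b) (a * b)"
  shows "partial_trace_snd (a ^ n) (b ^ n) (regroup a b n (tensor_pow M n)) = tensor_pow (partial_trace_snd a b M) n"
proof (rule eq_matI)
  have sum_eq: "(\<Sum>y<b ^ n. tensor_pow M n $$ (regroup_index a b n (x * b ^ n + y), regroup_index a b n (x' * b ^ n + y))) =
      tensor_pow (partial_trace_snd a b M) n $$ (x, x')" if "x < a ^ n" "x' < a ^ n" for x x'
    using that
  proof (induction n arbitrary: x x')
    case 0
    then show ?case by (simp add: regroup_index_def)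
  next
    case (Suc n)
    note x = Suc.prems
    have l: "x < a ^ n * a" "x' < a ^ n * a" using x by (simp_all add: mult.commute)
    note xl = div_less_prod_index[OF l(1)] div_less_prod_index[OF l(2)] mod_less_prod_index[OF l(1)] mod_less_prod_index[OF l(2)]
    let ?T = "\<lambda>y. tensor_pow M n $$ (regroup_index a b n ((x div a) * b ^ n + y), regroup_index a b n ((x' div a) * b ^ n + y))"
    let ?M = "\<lambda>k. M $$ ((x mod a) * b + k, (x' mod a) * b + k)"
    have "(\<Sum>y<b ^ Suc n. tensor_pow M (Suc n) $$ (regroup_index a b (Suc n) (x * b ^ Suc n + y), regroup_index a b (Suc n) (x' * b ^ Suc n + y))) =
        (\<Sum>y<b ^ Suc n. ?T (y div b) * ?M (y mod b))"
      by (intro sum.cong refl tensor_pow_regroup_Suc[OF M] x) auto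
    also have "\<dots> = (\<Sum>y<b ^ n. \<Sum>k<b. ?T y * ?M k)"
      unfolding power_Suc2 sum_prod_index by (intro sum.cong refl) auto
    also have "\<dots> = (\<Sum>y<b ^ n. ?T y) * (\<Sum>k<b. ?M k)"
      by (simp add: sum_product)
    also have "\<dots> = tensor_pow (partial_trace_snd a b M) n $$ (x div a, x' div a) * partial_trace_snd a b M $$ (x mod a, x' mod a)"
      using xl by (simp add: Suc.IH partial_trace_index)
    also have "\<dots> = kron (tensor_pow (partial_trace_snd a b M) n) (partial_trace_snd a b M) $$
        ((x div a) * a + x mod a, (x' div a) * a + x' mod a)"
      using xl by (intro kron_index[symmetric, of _ "a ^ n"] tensor_pow_carrier) auto
    finally show ?case by simp
  qed
  fix x x' assume "x < dim_row (tensor_pow (partial_trace_snd a b M) n)" "x' < dim_col (tensor_pow (partial_trace_snd a b M) n)"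
  then have x: "x < a ^ n" "x' < a ^ n"
    using carrier_matD[OF tensor_pow_carrier[OF partial_trace_carrier, of a b M n]] by auto
  have "partial_trace_snd (a ^ n) (b ^ n) (regroup a b n (tensor_pow M n)) $$ (x, x') =
      (\<Sum>y<b ^ n. tensor_pow M n $$ (regroup_index a b n (x * b ^ n + y), regroup_index a b n (x' * b ^ n + y)))"
    unfolding partial_trace_index[OF x] using x by (intro sum.cong refl) (simp add: regroup_def prod_index_less)
  then show "partial_trace_snd (a ^ n) (b ^ n) (regroup a b n (tensor_pow M n)) $$ (x, x') = tensor_pow (partial_trace_snd a b M) n $$ (x, x')"
    using sum_eq[OF x] by simp
qed (use carrier_matD[OF tensor_pow_carrier[OF partial_trace_carrier, of a b M n]] in auto)

text \<open>The form of the new matrix at x equals the form of \<open>M\<close> at the sum of the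
  vectors x_i e_(f i).\<close>

lemma psd_mat_reindex:
  assumes M: "psd_mat D M" and f: "\<And>i. i < d \<Longrightarrow> f i < D"
  shows "psd_mat d (mat d d (\<lambda>(i, j). M $$ (f i, f j)))"
proof -
  let ?N = "mat d d (\<lambda>(i, j). M $$ (f i, f j))"
  have "mat_adjoint ?N = ?N"
    by (rule eq_matI) (use M f in \<open>auto simp: psd_mat_iff hermitian_index[of M D]\<close>)
  moreover have "0 \<le> Re (sform d ?N x x)" for x
  proof -
    define u where "u i k = (if k = f i then x i else 0)" for i k
    have "sform D M (u j) (u i) = cnj (x i) * (M $$ (f i, f j) * x j)" if "i < d" "j < d" for i j
    proof -
      have "app D M (u j) k = (\<Sum>m<D. if m = f j then M $$ (k, m) * x j else 0)" for k
        unfolding app_def u_def by (intro sum.cong) auto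
      then have a: "app D M (u j) k = M $$ (k, f j) * x j" for k using f[OF that(2)] by simp
      have "sform D M (u j) (u i) = (\<Sum>k<D. if k = f i then cnj (x i) * (M $$ (k, f j) * x j) else 0)"
        unfolding sform_def a by (intro sum.cong) (auto simp: u_def)
      then show ?thesis using f[OF that(1)] by simp
    qed
    then have "sform d ?N x x = (\<Sum>i<d. \<Sum>j<d. sform D M (u j) (u i))"
      unfolding sform_def[of d] app_def[of d] sum_distrib_left by (intro sum.cong refl) auto
    also have "\<dots> = sform D M (\<lambda>k. \<Sum>j<d. u j k) (\<lambda>k. \<Sum>i<d. u i k)"
      unfolding sform_sum_left sform_sum_right by (rule sum.swap)
    finally show ?thesis using M by (simp add: psd_mat_iff)
  qed
  ultimately show ?thesis by (simp add: psd_mat_iff)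
qed

lemma density_mats_regroup:
  assumes "\<rho> \<in> density_mats (a * b)"
  shows "regroup a b n (tensor_pow \<rho> n) \<in> density_mats (a ^ n * b ^ n)"
proof -
  have \<rho>c: "\<rho> \<in> carrier_mat (a * b) (a * b)" and \<rho>t: "mat_trace \<rho> = 1"
    using assms by (auto simp: density_mats_def psd_mat_carrier)
  have "psd_mat ((a * b) ^ n) (tensor_pow \<rho> n)"
    using density_mats_tensor_pow[OF assms, of n] by (simp add: density_mats_def)
  then have p: "psd_mat (a ^ n * b ^ n) (regroup a b n (tensor_pow \<rho> n))"
    unfolding regroup_def
  proof (rule psd_mat_reindex)
    fix i assume "i < a ^ n * b ^ n"
    then show "regroup_index a b n i < (a * b) ^ n"
      using regroup_index_less[of "i div b ^ n" a n "i mod b ^ n" b]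
      unfolding div_mult_mod_eq by (simp add: div_less_prod_index mod_less_prod_index)
  qed
  have "partial_trace_snd a b \<rho> \<in> density_mats a"
    using assms by (auto simp: density_mats_def psd_partial_trace mat_trace_partial_trace psd_mat_carrier)
  then have "mat_trace (tensor_pow (partial_trace_snd a b \<rho>) n) = 1"
    using density_mats_tensor_pow[of _ a n] by (simp add: density_mats_def)
  \<comment> \<open>The trace is obtained from that of the marginal, which avoids showing that
    \<open>regroup_index\<close> permutes the indices.\<close>
  then have "mat_trace (regroup a b n (tensor_pow \<rho> n)) = 1"
    using mat_trace_partial_trace[OF psd_mat_carrier[OF p]] partial_trace_regroup[OF \<rho>c, of n] by simp
  with p show ?thesis by (simp add: density_mats_def)
qed

section \<open>The regularised relative entropy\<close>

lemma rel_entropy_partial_trace_le: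
  assumes "psd_mat (a * b) \<rho>" "psd_mat (a * b) \<sigma>"
  shows "rel_entropy (partial_trace_snd a b \<rho>) (partial_trace_snd a b \<sigma>) \<le> rel_entropy \<rho> \<sigma>"
  unfolding rel_entropy_psd[OF assms] rel_entropy_psd[OF psd_partial_trace[OF assms(1)] psd_partial_trace[OF assms(2)]]
  using rel_ent_partial_trace_le[OF assms] dominated_partial_trace[OF _ assms(2)] by auto

text \<open>All extensions have the same marginal, so data processing bounds them all at once. The
  bound includes the value \<infinity>, which settles the case of failing support inclusion.\<close>

lemma rel_entropy_set_lower:
  assumes "\<rho> \<in> density_mats (a * b)"
  shows "rel_entropy (tensor_pow (partial_trace_snd a b \<rho>) n) (tensor_pow \<sigma> n) \<le>
    rel_entropy_set (regroup a b n (tensor_pow \<rho> n)) (extensions a b n \<sigma>)"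
  unfolding rel_entropy_set_def
proof (rule INF_greatest)
  fix \<tau> assume "\<tau> \<in> extensions a b n \<sigma>"
  then have \<tau>: "psd_mat (a ^ n * b ^ n) \<tau>" "partial_trace_snd (a ^ n) (b ^ n) \<tau> = tensor_pow \<sigma> n"
    by (auto simp: extensions_def density_mats_def)
  have "psd_mat (a ^ n * b ^ n) (regroup a b n (tensor_pow \<rho> n))"
    using density_mats_regroup[OF assms, of n] by (simp add: density_mats_def)
  from rel_entropy_partial_trace_le[OF this \<tau>(1)]
  show "rel_entropy (tensor_pow (partial_trace_snd a b \<rho>) n) (tensor_pow \<sigma> n) \<le> rel_entropy (regroup a b n (tensor_pow \<rho> n)) \<tau>"
    using assms \<tau>(2) by (simp add: partial_trace_regroup density_mats_def psd_mat_carrier)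
qed

lemma rel_entropy_set_upper:
  assumes \<rho>: "\<rho> \<in> density_mats (a * b)" and \<sigma>: "\<sigma> \<in> density_mats a"
    and dominated: "dominated a (partial_trace_snd a b \<rho>) \<sigma>"
  shows "\<exists>C. \<forall>n\<ge>1. rel_entropy_set (regroup a b n (tensor_pow \<rho> n)) (extensions a b n \<sigma>) \<le>
    ereal (real n * rel_ent (partial_trace_snd a b \<rho>) \<sigma> + (C + 2 * ln (real n)))"
proof -
  define R where "R = partial_trace_snd a b \<rho>"
  have \<rho>c: "\<rho> \<in> carrier_mat (a * b) (a * b)" using \<rho> by (auto simp: density_mats_def psd_mat_carrier)
  have R: "R \<in> density_mats a"
    unfolding R_def using \<rho> by (auto simp: density_mats_def psd_partial_trace mat_trace_partial_trace psd_mat_carrier)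
  have "psd_mat a \<sigma>" using \<sigma> by (simp add: density_mats_def)
  then obtain V e where V: "unitary_mat a V" and \<sigma>_eq: "\<sigma> = spectral a V e" and e: "\<And>i. 0 \<le> e i"
    using psd_spectral_exists by blast
  \<comment> \<open>The smallest nonzero eigenvalue of \<sigma>; inserting 1 keeps the set
    nonempty.\<close>
  define m where "m = Min (insert 1 (e ` {i. i < a \<and> e i \<noteq> 0}))"
  have m0: "0 < m" unfolding m_def using e by (subst Min_gr_iff) (auto simp: less_le)
  have m1: "e i = 0 \<or> m \<le> e i" if "i < a" for i
    unfolding m_def using that by (auto intro!: Min_le)
  have "a > 0" using \<sigma> by (cases a) (auto simp: density_mats_def mat_trace_def psd_mat_def)
  \<comment> \<open>The cap per copy: the dimension of A^n has logarithm n ln a, so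
    \<open>n * k\<close> is an admissible cap for the n-th power. Similarly \<open>n * c\<close>
    bounds the labels of its nonzero eigenvalues.\<close>
  define k where "k = nat \<lceil>ln (real a)\<rceil>"
  define c where "c = nat \<lceil>- ln m\<rceil>"
  have k: "ln (real a) \<le> real k" unfolding k_def by linarith
  have c: "- ln m \<le> real c" unfolding c_def by linarith
  define C where "C = 3 + ln (real ((c + 2) * (k + 1)))"
  have "rel_entropy_set (regroup a b n (tensor_pow \<rho> n)) (extensions a b n \<sigma>) \<le>
      ereal (real n * rel_ent R \<sigma> + (C + 2 * ln (real n)))" if n: "n \<ge> 1" for n
  proof -
    have "\<exists>W f. unitary_mat (a ^ n) W \<and> tensor_pow (spectral a V e) n = spectral (a ^ n) W f \<and>
        (\<forall>i. 0 \<le> f i) \<and> (\<forall>i < a ^ n. f i = 0 \<or> m ^ n \<le> f i)"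
      by (rule tensor_pow_spectral[OF V e m0]) (rule m1)
    then obtain W f where W: "unitary_mat (a ^ n) W" "tensor_pow \<sigma> n = spectral (a ^ n) W f"
      and f: "\<And>i. 0 \<le> f i" "\<And>i. i < a ^ n \<Longrightarrow> f i = 0 \<or> m ^ n \<le> f i"
      unfolding \<sigma>_eq by blast
    have f1: "(\<Sum>i<a ^ n. f i) = 1"
      using mat_trace_spectral[OF W(1), of f] density_mats_tensor_pow[OF \<sigma>, of n] W(2) by (simp add: density_mats_def)
    define T where "T = regroup a b n (tensor_pow \<rho> n)"
    have T: "T \<in> density_mats (a ^ n * b ^ n)" unfolding T_def by (rule density_mats_regroup[OF \<rho>])
    have ptT: "partial_trace_snd (a ^ n) (b ^ n) T = tensor_pow R n"
      unfolding T_def R_def by (rule partial_trace_regroup[OF \<rho>c])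
    note pow = rel_ent_tensor_pow[OF R \<sigma> dominated[folded R_def], of n]
    define L where "L = nat \<lfloor>- ln (m ^ n)\<rfloor> + 1"
    have "ln (real (a ^ n)) \<le> real (n * k)"
      using mult_left_mono[OF k, of "real n"] \<open>a > 0\<close> by (simp add: ln_realpow)
    from extension_exists[OF T W(1) f(1) f1 _ _ f(2) this]
    obtain \<tau> where \<tau>: "\<tau> \<in> density_mats (a ^ n * b ^ n)" "partial_trace_snd (a ^ n) (b ^ n) \<tau> = tensor_pow \<sigma> n"
      "dominated (a ^ n * b ^ n) T \<tau>"
      "rel_ent T \<tau> \<le> real n * rel_ent R \<sigma> + 3 + ln (real ((L + 1) * (n * k + 1)))"
      using pow m0 unfolding ptT W(2)[symmetric] L_def by auto
    have "rel_entropy_set T (extensions a b n \<sigma>) \<le> rel_entropy T \<tau>"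
      unfolding rel_entropy_set_def using \<tau> by (intro INF_lower) (simp add: extensions_def)
    also have "\<dots> = ereal (rel_ent T \<tau>)"
      using T \<tau> by (subst rel_entropy_psd[of "a ^ n * b ^ n"]) (auto simp: density_mats_def)
    also have "\<dots> \<le> ereal (real n * rel_ent R \<sigma> + (C + 2 * ln (real n)))"
    proof -
      have "L + 1 \<le> n * (c + 2)"
      proof -
        have "- ln (m ^ n) \<le> real (n * c)" using mult_left_mono[OF c, of "real n"] m0 by (simp add: ln_realpow)
        then have "nat \<lfloor>- ln (m ^ n)\<rfloor> \<le> n * c" by linarith
        then show ?thesis using n unfolding L_def by simp
      qed
      moreover have "n * k + 1 \<le> n * (k + 1)" using n by simp
      \<comment> \<open>Both label counts are linear in \<open>n\<close>, since the additive
        constants are absorbed for n \<ge> 1. The logarithm of their product is therefore 2 ln n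
        plus a constant independent of \<open>n\<close>.\<close>
      ultimately have "(L + 1) * (n * k + 1) \<le> (n * (c + 2)) * (n * (k + 1))" by (rule mult_le_mono)
      also have "(n * (c + 2)) * (n * (k + 1)) = ((c + 2) * (k + 1)) * (n * n)" by (simp only: mult_ac)
      finally have "real ((L + 1) * (n * k + 1)) \<le> real ((c + 2) * (k + 1)) * (real n * real n)"
        by (simp only: of_nat_mult[symmetric] of_nat_le_iff)
      moreover have "0 < real ((L + 1) * (n * k + 1))" unfolding of_nat_0_less_iff by simp
      ultimately have "ln (real ((L + 1) * (n * k + 1))) \<le> ln (real ((c + 2) * (k + 1)) * (real n * real n))"
        by (intro ln_mono) auto
      also have "\<dots> = ln (real ((c + 2) * (k + 1))) + (ln (real n) + ln (real n))"
      proof -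
        have "0 < real ((c + 2) * (k + 1))" unfolding of_nat_0_less_iff by simp
        moreover have "0 < real n" using n by simp
        ultimately show ?thesis by (simp only: ln_mult_pos mult_pos_pos)
      qed
      finally show ?thesis using \<tau>(4) unfolding C_def by simp
    qed
    finally show ?thesis unfolding T_def .
  qed
  then show ?thesis unfolding R_def by blast
qed

theorem theorem4p1:
  fixes dA dB :: nat and \<rho> \<sigma> :: "complex mat"
  assumes "\<rho> \<in> density_mats (dA * dB)"
    and "\<sigma> \<in> density_mats dA"
  shows "convergent (rel_entropy_seq dA dB \<rho> \<sigma>) \<and>
    rel_entropy (partial_trace_snd dA dB \<rho>) \<sigma> = reg_rel_entropy dA dB \<rho> \<sigma>"
proof -
  define R where "R = partial_trace_snd dA dB \<rho>"
  have R: "R \<in> density_mats dA"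
    unfolding R_def using assms(1) by (auto simp: density_mats_def psd_partial_trace mat_trace_partial_trace psd_mat_carrier)
  have rel: "rel_entropy (tensor_pow R n) (tensor_pow \<sigma> n) =
      (if dominated (dA ^ n) (tensor_pow R n) (tensor_pow \<sigma> n) then ereal (rel_ent (tensor_pow R n) (tensor_pow \<sigma> n)) else \<infinity>)" for n
    using density_mats_tensor_pow[OF R, of n] density_mats_tensor_pow[OF assms(2), of n]
    by (intro rel_entropy_psd) (auto simp: density_mats_def)
  have rel1: "rel_entropy R \<sigma> = (if dominated dA R \<sigma> then ereal (rel_ent R \<sigma>) else \<infinity>)"
    using R assms(2) by (intro rel_entropy_psd) (auto simp: density_mats_def)
  have "rel_entropy_seq dA dB \<rho> \<sigma> \<longlonglongrightarrow> rel_entropy R \<sigma>"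
  proof (cases "dominated dA R \<sigma>")
    case True
    note pow = rel_ent_tensor_pow[OF R assms(2) True]
    obtain C where C: "\<And>n. n \<ge> 1 \<Longrightarrow> rel_entropy_set (regroup dA dB n (tensor_pow \<rho> n)) (extensions dA dB n \<sigma>) \<le>
        ereal (real n * rel_ent R \<sigma> + (C + 2 * ln (real n)))"
      using rel_entropy_set_upper[OF assms True[unfolded R_def]] unfolding R_def by blast
    have lower: "ereal (rel_ent R \<sigma>) \<le> rel_entropy_seq dA dB \<rho> \<sigma> n" if "n \<ge> 1" for n
    proof -
      have "ereal (rel_ent R \<sigma>) = ereal (1 / real n) * ereal (real n * rel_ent R \<sigma>)" using that by simp
      also have "\<dots> \<le> rel_entropy_seq dA dB \<rho> \<sigma> n"
        unfolding rel_entropy_seq_def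
        using rel_entropy_set_lower[OF assms(1), of n \<sigma>] rel[of n] pow[of n]
        by (intro ereal_mult_left_mono) (auto simp: R_def)
      finally show ?thesis .
    qed
    have upper: "rel_entropy_seq dA dB \<rho> \<sigma> n \<le> ereal (rel_ent R \<sigma> + (C / real n + 2 * (ln (real n) / real n)))" if "n \<ge> 1" for n
    proof -
      have "rel_entropy_seq dA dB \<rho> \<sigma> n \<le> ereal (1 / real n) * ereal (real n * rel_ent R \<sigma> + (C + 2 * ln (real n)))"
        unfolding rel_entropy_seq_def using C[OF that] by (intro ereal_mult_left_mono) auto
      also have "\<dots> = ereal (rel_ent R \<sigma> + (C / real n + 2 * (ln (real n) / real n)))"
        using that by (simp add: field_simps)
      finally show ?thesis .
    qed
    have "(\<lambda>n. ln (real n) / real n) \<longlonglongrightarrow> 0"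
      by (rule filterlim_compose[OF ln_x_over_x_tendsto_0 filterlim_real_sequentially])
    then have "(\<lambda>n. rel_ent R \<sigma> + (C / real n + 2 * (ln (real n) / real n))) \<longlonglongrightarrow> rel_ent R \<sigma> + (0 + 2 * 0)"
      by (intro tendsto_intros lim_const_over_n)
    then have lim: "(\<lambda>n. ereal (rel_ent R \<sigma> + (C / real n + 2 * (ln (real n) / real n)))) \<longlonglongrightarrow> ereal (rel_ent R \<sigma>)"
      by simp
    have "rel_entropy_seq dA dB \<rho> \<sigma> \<longlonglongrightarrow> ereal (rel_ent R \<sigma>)"
      by (rule tendsto_sandwich[OF eventually_sequentiallyI[OF lower] eventually_sequentiallyI[OF upper] tendsto_const lim])
    then show ?thesis using True rel1 by simp
  next
    case False
    have "rel_entropy_seq dA dB \<rho> \<sigma> n = \<infinity>" if "n \<ge> 1" for n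
    proof -
      \<comment> \<open>Inclusion of supports for a positive power would descend to a single copy.
        The power 0 satisfies it trivially, hence the shift to \<open>n - 1\<close> that matches the
        \<open>Suc\<close> form of the descent.\<close>
      have "\<not> dominated (dA ^ n) (tensor_pow R n) (tensor_pow \<sigma> n)"
        using False dominated_tensor_powD[OF R assms(2), of "n - 1"] that by (metis Suc_diff_1 less_eq_Suc_le One_nat_def)
      then have "rel_entropy_set (regroup dA dB n (tensor_pow \<rho> n)) (extensions dA dB n \<sigma>) = \<infinity>"
        using rel_entropy_set_lower[OF assms(1), of n \<sigma>] rel[of n] by (simp add: R_def)
      then show ?thesis using that by (simp add: rel_entropy_seq_def)
    qed
    then have "rel_entropy_seq dA dB \<rho> \<sigma> \<longlonglongrightarrow> \<infinity>"
      by (intro tendsto_eventually eventually_sequentiallyI[of 1]) auto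
    then show ?thesis using False rel1 by simp
  qed
  then show ?thesis
    unfolding reg_rel_entropy_def R_def by (auto simp: convergent_def dest: limI)
qed

end
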